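(* Let $p$ be an odd prime, $n>2$, and $(\alpha,\beta,\gamma;\rho,\sigma)$ integers with $\alpha\ge\beta\ge\gamma\ge1$, $\alpha+\beta+\gamma=n$, $0\le\rho\le\gamma$, $0\le\sigma\le\gamma$. Let \[G=\langle a,b: [a,b]^{p^\gamma}=[a,b,a]=[a,b,b]=1,\ a^{p^\alpha}=[a,b]^{p^\rho},\ b^{p^\beta}=[a,b]^{p^\sigma}\rangle,\] a two-generator $p$-group of nilpotency class $2$ and order $p^n$. Then \[\mathbb{Q}G\cong\mathbb{Q}\bigoplus_{\lambda=1}^{\beta}(p^\lambda+p^{\lambda-1})\mathbb{Q}(\zeta_{p^\lambda})\bigoplus_{\lambda=\beta+1}^{\alpha}p^\beta\,\mathbb{Q}(\zeta_{p^\lambda})\bigoplus_{\delta=1}^{\gamma}\bigoplus_{\lambda=1}^{m_\delta}(a_{p^\lambda}-a'_{p^\lambda})M_{p^\delta}(\mathbb{Q}(\zeta_{p^\lambda})),\] where, for each $\delta$, $p^{m_\delta}$ is the exponent of $\langle a^{p^\delta},b^{p^\delta},[a,b]\rangle/\langle[a,b]^{p^\delta}\rangle$, and $a_{p^\lambda}$, $a'_{p^\lambda}$ are the numbers of cyclic subgroups of order $p^\lambda$ of $\langle a^{p^\delta},b^{p^\delta},[a,b]\rangle/\langle[a,b]^{p^\delta}\rangle$ and of $\langle a^{p^\delta},b^{p^\delta},[a,b]\rangle/\langle[a,b]^{p^{\delta-1}}\rangle$, respectively.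
   Context: $[g,h]=g^{-1}h^{-1}gh$, $[x,y,z]=[[x,y],z]$. $\zeta_m$ is a primitive $m$-th root of unity, $M_k(K)$ is the $k\times k$ matrix algebra over $K$, and $c\,A$ denotes the direct sum of $c$ copies of $A$. *)

theory Defs
  imports "HOL-Algebra.Algebra" Complex_Main
begin

definition comm :: "('g, 'b) monoid_scheme \<Rightarrow> 'g \<Rightarrow> 'g \<Rightarrow> 'g" where
  "comm G g h = inv\<^bsub>G\<^esub> g \<otimes>\<^bsub>G\<^esub> inv\<^bsub>G\<^esub> h \<otimes>\<^bsub>G\<^esub> g \<otimes>\<^bsub>G\<^esub> h"

definition grp_exponent :: "('g, 'b) monoid_scheme \<Rightarrow> nat" where
  "grp_exponent G = (LEAST e. 0 < e \<and> (\<forall>x\<in>carrier G. x [^]\<^bsub>G\<^esub> e = \<one>\<^bsub>G\<^esub>))"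

definition num_cyclic_subgroups :: "('g, 'b) monoid_scheme \<Rightarrow> nat \<Rightarrow> nat" where
  "num_cyclic_subgroups G k =
     card {K. (\<exists>x\<in>carrier G. K = generate G {x}) \<and> card K = k}"

definition group_algebra_Q :: "('g, 'b) monoid_scheme \<Rightarrow> ('g \<Rightarrow> rat) ring" where
  "group_algebra_Q G =
    \<lparr> partial_object.carrier = {f. \<forall>x. x \<notin> carrier G \<longrightarrow> f x = 0},
      monoid.mult = (\<lambda>f g x. if x \<in> carrier G
                    then (\<Sum>y\<in>carrier G. f y * g (inv\<^bsub>G\<^esub> y \<otimes>\<^bsub>G\<^esub> x)) else 0),
      monoid.one = (\<lambda>x. if x = \<one>\<^bsub>G\<^esub> then 1 else 0),
      ring.zero = (\<lambda>x. 0),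
      ring.add = (\<lambda>f g x. f x + g x) \<rparr>"

definition zeta :: "nat \<Rightarrow> complex" where
  "zeta m = cis (2 * pi / real m)"

definition cyclotomic_field :: "nat \<Rightarrow> complex set" where
  "cyclotomic_field m = {z. \<exists>N (q :: nat \<Rightarrow> rat). z = (\<Sum>i<N. of_rat (q i) * zeta m ^ i)}"

definition cyclo_matrix_ring :: "nat \<Rightarrow> nat \<Rightarrow> (nat \<times> nat \<Rightarrow> complex) ring" where
  "cyclo_matrix_ring k m =
    \<lparr> partial_object.carrier = {A. (\<forall>i j. i < k \<and> j < k \<longrightarrow> A (i, j) \<in> cyclotomic_field m) \<and>
                    (\<forall>i j. \<not> (i < k \<and> j < k) \<longrightarrow> A (i, j) = 0)},
      monoid.mult = (\<lambda>A B (i, j). if i < k \<and> j < k then (\<Sum>l<k. A (i, l) * B (l, j)) else 0),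
      monoid.one = (\<lambda>(i, j). if i = j \<and> i < k then 1 else 0),
      ring.zero = (\<lambda>_. 0),
      ring.add = (\<lambda>A B ij. A ij + B ij) \<rparr>"

text \<open>Direct sum of the algebras M_k(Q(zeta_m)) for a list of pairs (k, m).
  Note Q = M_1(Q(zeta_1)) and Q(zeta_m) = M_1(Q(zeta_m)).\<close>
definition wedderburn_sum :: "(nat \<times> nat) list \<Rightarrow> ((nat \<times> nat \<Rightarrow> complex) list) ring" where
  "wedderburn_sum L = RDirProd_list (map (\<lambda>(k, m). cyclo_matrix_ring k m) L)"

end

(*
  Let c = [a,b].  It is central, and the order of G forces c to have order p^gamma and G/<c> to be
  C_{p^alpha} x C_{p^beta}.  For 0 <= delta <= gamma let H_delta = <a^{p^delta}, b^{p^delta}, c> be the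
  preimage of the centre of G/<c^{p^delta}>.  A linear character psi of H_delta whose value at c has exact
  order p^delta is fully ramified in G.  Multiplying b by a power of a (or a by a power of b) yields y with
  psi(y^{p^delta}) = 1; this uses that p is odd and that of two p-power roots of unity one is a power of the
  other.  Extending psi to <y, H_delta> by y |-> 1 and inducing gives a representation of degree p^delta
  with entries in Q(psi) = Q(zeta_{p^lambda}) and trace p^delta psi on H_delta, 0 elsewhere; in particular
  no Schur index occurs.

  Take one psi from each Galois class (delta = 0 gives the commutative components).  An element of QG killed
  by all these representations is killed by all Galois conjugates, hence is 0, because the sum over delta of
  p^{2 delta} sum_psi psi telescopes to the regular character.  As the dimensions over Q on both sides
  agree, QG is the product of the matrix algebras.  The number of classes for given delta and lambda comes
  from |{chi : chi^m = 1}| = |{x : x^m = 1}| for finite abelian groups.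
*)
theory Submission
  imports "HOL-Library.Function_Algebras" "HOL-Number_Theory.Totient" "HOL-Computational_Algebra.Polynomial_Factorial" Defs
begin

section \<open>Conjugation of relations between roots of unity\<close>

text \<open>Galois conjugation is never carried out by field automorphisms. It is replaced by a
  statement about relations: a rational linear relation between powers of a primitive p^l-th root of
  unity z survives the substitution z |-> z^r for r prime to p. This rests on the irreducibility of
  the cyclotomic polynomials of prime-power index, obtained from Eisenstein's criterion. The
  comparison of dimensions works through spanning sets: each matrix entry in Q(zeta_m) is a rational
  combination of totient(m) powers of zeta_m, which gives at most |G| spanning vectors for the
  target, and injectivity on QG then forces surjectivity. Cyclic subgroups appear in the
  multiplicities because totient(p^\<lambda>) is at once the size of a Galois class of characters of
  order p^\<lambda> and the number of generators of a cyclic group of that order. The subtracted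
  term belongs to the characters whose value at c has order smaller than p^\<delta>.\<close>

lemma map_poly_of_int_mult:
  "map_poly (of_int :: int \<Rightarrow> complex) (p * q) = map_poly of_int p * map_poly of_int q"
  by (intro poly_eqI) (simp add: coeff_map_poly coeff_mult)

lemma map_poly_of_int_add:
  "map_poly (of_int :: int \<Rightarrow> complex) (p + q) = map_poly of_int p + map_poly of_int q"
  by (intro poly_eqI) (simp add: coeff_map_poly)

lemma map_poly_of_int_smult:
  "map_poly (of_int :: int \<Rightarrow> complex) (Polynomial.smult c q) = Polynomial.smult (of_int c) (map_poly of_int q)"
  by (intro poly_eqI) (simp add: coeff_map_poly)

lemma map_poly_of_int_sum:
  "map_poly (of_int :: int \<Rightarrow> complex) (sum f A) = (\<Sum>x\<in>A. map_poly of_int (f x))"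
  by (intro poly_eqI) (simp add: coeff_map_poly coeff_sum)

text \<open>Stated for factorisations of a multiple of \<open>f\<close>, so that it excludes
  factorisations over the rationals while staying in Z[X]; pseudo-division produces exactly such
  multiples. By Gauss's lemma the primitive parts of \<open>D\<close> and \<open>E\<close> already
  multiply to \<open>f\<close> up to sign, and the usual comparison modulo p applies to
  them.\<close>

lemma eisenstein:
  fixes f D E :: "int poly" and p N :: int
  assumes p: "Factorial_Ring.prime p" and N: "N \<noteq> 0" and eq: "D * E = Polynomial.smult N f"
    and monic: "Polynomial.lead_coeff f = 1"
    and low: "\<And>i. i < Polynomial.degree f \<Longrightarrow> p dvd Polynomial.coeff f i"
    and const: "\<not> p\<^sup>2 dvd Polynomial.coeff f 0"
  shows "Polynomial.degree D = 0 \<or> Polynomial.degree E = 0"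
proof (rule ccontr)
  assume contra: "\<not> ?thesis"
  define D' where "D' = primitive_part D"
  define E' where "E' = primitive_part E"
  have f0: "f \<noteq> 0" using monic by auto
  have DE0: "D \<noteq> 0" "E \<noteq> 0" using eq N f0 by auto
  have cf: "content f = 1"
  proof -
    have "content f dvd Polynomial.lead_coeff f" by (rule content_dvd_coeff)
    then have "is_unit (content f)" using monic by simp
    then have "normalize (content f) = 1" by (rule is_unit_normalize)
    then show ?thesis by (simp only: normalize_content)
  qed
  have "Polynomial.smult (content D * content E) (D' * E') = Polynomial.smult N f"
    by (metis D'_def E'_def content_times_primitive_part eq mult_smult_left mult_smult_right smult_smult)
  moreover have "content (D' * E') = 1"
    using DE0 by (simp add: content_mult D'_def E'_def)
  ultimately have "normalize (content D * content E) = normalize N"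
    using cf by (metis content_smult mult.right_neutral)
  then have "content D * content E = N \<or> content D * content E = - N"
    by (simp add: abs_eq_iff)
  then obtain s :: int where s: "content D * content E = s * N" "s = 1 \<or> s = -1"
    by (metis mult_1 mult_minus1)
  have "Polynomial.smult N (Polynomial.smult s (D' * E')) = Polynomial.smult N f"
    using \<open>Polynomial.smult (content D * content E) (D' * E') = Polynomial.smult N f\<close> s(1)
    by (simp only: smult_smult mult.commute[of N])
  then have f: "f = Polynomial.smult s (D' * E')" using N
    by (metis diff_eq_diff_eq diff_self right_minus_eq smult_diff_right smult_eq_0_iff)
  have deg: "Polynomial.degree f = Polynomial.degree D' + Polynomial.degree E'"
    using s DE0 unfolding f by (auto simp: Polynomial.degree_mult_eq D'_def E'_def)
  have lc: "Polynomial.lead_coeff D' * Polynomial.lead_coeff E' = 1 \<or> Polynomial.lead_coeff D' * Polynomial.lead_coeff E' = -1"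
    using monic s unfolding f by (auto simp: lead_coeff_mult)
  have pu: "\<not> is_unit p" using p by auto
  have ndvd: "\<not> p dvd Polynomial.lead_coeff D' * Polynomial.lead_coeff E'" using lc pu by (metis dvd_minus_iff)
  have np: "\<not> p dvd Polynomial.lead_coeff D'" "\<not> p dvd Polynomial.lead_coeff E'"
    using ndvd by (auto intro: dvd_mult dvd_mult2)
  \<comment> \<open>The lowest coefficients of \<open>D'\<close> and \<open>E'\<close> that are
    nonzero modulo p. In coefficient i + j of the product only the term k = i survives modulo p, so
    i + j is the degree of \<open>f\<close>, and all lower coefficients of both factors, the
    constant ones included, are divisible by p.\<close>
  obtain i where i: "\<not> p dvd Polynomial.coeff D' i" "\<And>k. k < i \<Longrightarrow> p dvd Polynomial.coeff D' k"
    using exists_least_iff[of "\<lambda>i. \<not> p dvd Polynomial.coeff D' i"] np(1) by blast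
  obtain j where j: "\<not> p dvd Polynomial.coeff E' j" "\<And>k. k < j \<Longrightarrow> p dvd Polynomial.coeff E' k"
    using exists_least_iff[of "\<lambda>i. \<not> p dvd Polynomial.coeff E' i"] np(2) by blast
  have "i \<le> Polynomial.degree D'" "j \<le> Polynomial.degree E'"
    using i(1) j(1) by (metis dvd_0_right coeff_eq_0 not_le)+
  have "Polynomial.coeff (D' * E') (i + j) =
      (\<Sum>k\<le>i + j. Polynomial.coeff D' k * Polynomial.coeff E' (i + j - k))"
    by (rule coeff_mult)
  also have "\<dots> = Polynomial.coeff D' i * Polynomial.coeff E' (i + j - i) +
      (\<Sum>k\<in>{..i + j} - {i}. Polynomial.coeff D' k * Polynomial.coeff E' (i + j - k))"
    by (rule sum.remove) simp_all
  also have "i + j - i = j" by simp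
  finally have "Polynomial.coeff (D' * E') (i + j) = Polynomial.coeff D' i * Polynomial.coeff E' j +
      (\<Sum>k\<in>{..i + j} - {i}. Polynomial.coeff D' k * Polynomial.coeff E' (i + j - k))" .
  moreover have "p dvd (\<Sum>k\<in>{..i + j} - {i}. Polynomial.coeff D' k * Polynomial.coeff E' (i + j - k))"
  proof (rule dvd_sum)
    fix k assume "k \<in> {..i + j} - {i}"
    then have "k < i \<or> i + j - k < j" by auto
    then show "p dvd Polynomial.coeff D' k * Polynomial.coeff E' (i + j - k)"
      using i(2) j(2) by auto
  qed
  ultimately have "\<not> p dvd Polynomial.coeff (D' * E') (i + j)"
    using i(1) j(1) p by (simp add: dvd_add_left_iff prime_dvd_mult_iff)
  then have "\<not> p dvd Polynomial.coeff f (i + j)" using s unfolding f by auto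
  then have "\<not> i + j < Polynomial.degree f" using low by blast
  then have "i = Polynomial.degree D'" "j = Polynomial.degree E'"
    using deg \<open>i \<le> _\<close> \<open>j \<le> _\<close> by auto
  moreover have "Polynomial.degree D' > 0" "Polynomial.degree E' > 0"
    using contra by (auto simp: D'_def E'_def)
  ultimately have "p dvd Polynomial.coeff D' 0" "p dvd Polynomial.coeff E' 0"
    using i(2) j(2) by auto
  then have "p * p dvd Polynomial.coeff D' 0 * Polynomial.coeff E' 0" by (rule mult_dvd_mono)
  then have "p\<^sup>2 dvd Polynomial.coeff f 0"
    by (subst f) (simp add: coeff_mult power2_eq_square)
  then show False using const by simp
qed

text \<open>From i * C(p^k, i) = p^k * C(p^k - 1, i - 1): if p did not divide the binomial
  coefficient, p^k would divide i, which is too small.\<close>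

lemma prime_dvd_choose_prime_power:
  fixes p :: nat
  assumes "Factorial_Ring.prime p" "0 < i" "i < p ^ k"
  shows "p dvd (p ^ k choose i)"
proof (rule ccontr)
  assume "\<not> ?thesis"
  then have "coprime (p ^ k) (p ^ k choose i)"
    using assms(1) by (simp add: prime_imp_coprime)
  moreover have "p ^ k dvd i * (p ^ k choose i)"
    using times_binomial_minus1_eq[of i "p ^ k"] assms(2) by simp
  ultimately have "p ^ k dvd i" by (simp add: coprime_dvd_mult_left_iff)
  then show False using assms by (auto dest: dvd_imp_le)
qed

text \<open>This is (1 + X)^(p^k) = 1 + X^(p^k) modulo p. The explicit remainder \<open>s\<close>
  keeps the congruence an equation in Z[X], where coefficients can be compared.\<close>

lemma linear_power_prime_power:
  fixes p :: nat
  assumes "Factorial_Ring.prime p"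
  obtains s :: "int poly" where "[:1, 1:] ^ (p ^ k) - 1 = Polynomial.monom 1 (p ^ k) + Polynomial.smult (int p) s"
proof -
  have "[:int p:] dvd [:1, 1:] ^ (p ^ k) - 1 - Polynomial.monom 1 (p ^ k)"
    unfolding const_poly_dvd_iff
  proof
    fix i
    have "int p dvd int (p ^ k choose i)" if "0 < i" "i < p ^ k"
      using prime_dvd_choose_prime_power[OF assms that] by simp
    moreover have "p ^ k > 0" using assms by (simp add: prime_gt_0_nat)
    ultimately show "int p dvd Polynomial.coeff ([:1, 1:] ^ (p ^ k) - 1 - Polynomial.monom 1 (p ^ k)) i"
      using coeff_linear_poly_power[where n = "p ^ k" and a = "1::int" and b = 1 and i = i]
      by (cases "i = 0"; cases "i < p ^ k"; cases "i = p ^ k")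
         (auto simp: coeff_diff Polynomial.coeff_monom coeff_eq_0 degree_linear_power)
  qed
  then obtain s where "[:1, 1:] ^ (p ^ k) - 1 - Polynomial.monom 1 (p ^ k) = [:int p:] * s" by (auto elim: dvdE)
  then show ?thesis by (intro that[of s]) (simp add: algebra_simps)
qed

text \<open>This is the cyclotomic polynomial of index \<open>p ^ Suc l\<close>, not \<open>p ^ l\<close>.\<close>
definition prime_power_cyclotomic :: "nat \<Rightarrow> nat \<Rightarrow> int poly" where
  "prime_power_cyclotomic p l = (\<Sum>k<p. Polynomial.monom 1 (k * p ^ l))"

lemma prime_power_cyclotomic_mult:
  "prime_power_cyclotomic p l * (Polynomial.monom 1 (p ^ l) - 1) = Polynomial.monom 1 (p ^ Suc l) - 1"
proof -
  have "prime_power_cyclotomic p l = (\<Sum>k<p. Polynomial.monom 1 (p ^ l) ^ k)"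
    unfolding prime_power_cyclotomic_def by (simp add: monom_power mult.commute)
  then have "prime_power_cyclotomic p l * (Polynomial.monom 1 (p ^ l) - 1) = Polynomial.monom 1 (p ^ l) ^ p - 1"
    by (simp add: power_diff_1_eq mult.commute)
  then show ?thesis by (simp add: monom_power mult.commute)
qed

lemma ev_prime_power_cyclotomic:
  assumes "z ^ (p ^ l) \<noteq> 1" "z ^ (p ^ Suc l) = 1"
  shows "poly (map_poly of_int (prime_power_cyclotomic p l)) (z :: complex) = 0"
proof -
  have "map_poly of_int (Polynomial.monom (1::int) n - 1) = Polynomial.monom (1::complex) n - 1" for n
    by (intro poly_eqI) (auto simp: coeff_map_poly)
  then have "poly (map_poly of_int (prime_power_cyclotomic p l)) z * (z ^ (p ^ l) - 1) = 0"
    using arg_cong[OF prime_power_cyclotomic_mult[of p l], of "\<lambda>P. poly (map_poly of_int P) z"] assms(2)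
    by (simp add: map_poly_of_int_mult poly_monom)
  then show ?thesis using assms(1) by simp
qed

lemma degree_prime_power_cyclotomic:
  assumes "p > 0"
  shows "Polynomial.degree (prime_power_cyclotomic p l) = (p - 1) * p ^ l"
    and "Polynomial.lead_coeff (prime_power_cyclotomic p l) = 1"
proof -
  have c: "Polynomial.coeff (prime_power_cyclotomic p l) i = (\<Sum>k<p. if i = k * p ^ l then 1 else 0)" for i
    by (auto simp: prime_power_cyclotomic_def coeff_sum intro!: sum.cong)
  have "Polynomial.coeff (prime_power_cyclotomic p l) ((p - 1) * p ^ l)
      = (\<Sum>k<p. if k = p - 1 then 1 else 0)"
    unfolding c using assms by (intro sum.cong) auto
  then have 1: "Polynomial.coeff (prime_power_cyclotomic p l) ((p - 1) * p ^ l) = 1"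
    using assms by simp
  have "Polynomial.degree (prime_power_cyclotomic p l) \<le> (p - 1) * p ^ l"
  proof (rule degree_le, intro allI impI)
    fix i assume i: "(p - 1) * p ^ l < i"
    have "i \<noteq> k * p ^ l" if "k < p" for k
    proof -
      have "k * p ^ l \<le> (p - 1) * p ^ l" using that by (intro mult_right_mono) auto
      then show ?thesis using i by linarith
    qed
    then show "Polynomial.coeff (prime_power_cyclotomic p l) i = 0" unfolding c by simp
  qed
  with 1 show 2: "Polynomial.degree (prime_power_cyclotomic p l) = (p - 1) * p ^ l"
    by (metis le_antisym le_degree zero_neq_one)
  show "Polynomial.lead_coeff (prime_power_cyclotomic p l) = 1" using 1 2 by simp
qed

text \<open>Eisenstein's criterion after X |-> X + 1. The shifted polynomial \<open>F\<close>
  satisfies X^(p^l) F = X^(p^(l+1)) modulo p, so p divides every coefficient below the leading one,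
  and F(0) is the value of the cyclotomic polynomial at 1, which is p.\<close>

lemma prime_power_cyclotomic_irreducible:
  fixes D E :: "int poly"
  assumes p: "Factorial_Ring.prime p" and N: "N \<noteq> 0"
    and eq: "D * E = Polynomial.smult N (prime_power_cyclotomic p l)"
  shows "Polynomial.degree D = 0 \<or> Polynomial.degree E = 0"
proof -
  let ?s = "\<lambda>P. pcompose P [:1, 1::int:]"
  define F where "F = ?s (prime_power_cyclotomic p l)"
  have p0: "p > 0" using p by (simp add: prime_gt_0_nat)
  note deg = degree_prime_power_cyclotomic[OF p0, of l]
  have dF: "Polynomial.degree F = (p - 1) * p ^ l"
    unfolding F_def by (simp add: degree_pcompose deg(1))
  have lF: "Polynomial.lead_coeff F = 1"
    unfolding F_def by (subst lead_coeff_comp) (auto simp: deg(2))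
  have sm: "?s (Polynomial.monom 1 n) = [:1, 1:] ^ n" for n
    by (induction n) (simp_all add: monom_Suc pcompose_pCons monom_0)
  obtain s where s: "[:1, 1:] ^ (p ^ l) - 1 = Polynomial.monom 1 (p ^ l) + Polynomial.smult (int p) s"
    using linear_power_prime_power[OF p] by blast
  obtain t where t: "[:1, 1:] ^ (p ^ Suc l) - 1 = Polynomial.monom 1 (p ^ Suc l) + Polynomial.smult (int p) t"
    using linear_power_prime_power[OF p] by blast
  have "F * ([:1, 1:] ^ (p ^ l) - 1) = [:1, 1:] ^ (p ^ Suc l) - 1"
    using arg_cong[OF prime_power_cyclotomic_mult[of p l], of ?s]
    by (simp add: pcompose_mult pcompose_diff sm F_def pcompose_1)
  then have Feq: "Polynomial.monom 1 (p ^ l) * F + Polynomial.smult (int p) (F * s)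
      = Polynomial.monom 1 (p ^ Suc l) + Polynomial.smult (int p) t"
    by (simp only: s t) (simp add: algebra_simps)
  have low: "int p dvd Polynomial.coeff F i" if "i < Polynomial.degree F" for i
  proof -
    \<comment> \<open>Coefficient i of \<open>F\<close> sits at position i + p^l in
      \<open>Feq\<close>; below p^(l+1) the monomial on the right contributes nothing.\<close>
    have "i + p ^ l < p ^ Suc l"
    proof -
      have "i + p ^ l < (p - 1) * p ^ l + p ^ l" using that dF by linarith
      also have "\<dots> = ((p - 1) + 1) * p ^ l" by (simp only: distrib_right mult_1)
      also have "(p - 1) + 1 = p" using p0 by linarith
      also have "p * p ^ l = p ^ Suc l" by (rule power_Suc[symmetric])
      finally show ?thesis .
    qed
    then have "Polynomial.coeff F i + int p * Polynomial.coeff (F * s) (i + p ^ l)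
        = int p * Polynomial.coeff t (i + p ^ l)"
      using arg_cong[OF Feq, of "\<lambda>P. Polynomial.coeff P (i + p ^ l)"]
      by (simp add: coeff_monom_mult)
    then have "Polynomial.coeff F i = int p * (Polynomial.coeff t (i + p ^ l) - Polynomial.coeff (F * s) (i + p ^ l))"
      by (simp add: algebra_simps)
    then show ?thesis by simp
  qed
  have "Polynomial.coeff F 0 = poly F 0" by (simp add: poly_0_coeff_0)
  also have "\<dots> = int p" by (simp add: F_def poly_pcompose prime_power_cyclotomic_def poly_sum poly_monom)
  finally have const: "\<not> (int p)\<^sup>2 dvd Polynomial.coeff F 0"
  proof -
    assume c: "Polynomial.coeff F 0 = int p"
    have "\<not> p * p dvd p * 1" using p p0 by (subst dvd_times_left_cancel_iff) auto
    then have "\<not> p * p dvd p" by simp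
    then show ?thesis unfolding c power2_eq_square by (metis int_dvd_int_iff of_nat_mult)
  qed
  have "?s D * ?s E = Polynomial.smult N F"
    using arg_cong[OF eq, of ?s] by (simp add: pcompose_mult pcompose_smult F_def)
  from eisenstein[OF _ N this lF low const] p
  show ?thesis by (simp add: degree_pcompose)
qed

text \<open>An integer polynomial \<open>d\<close> of least degree vanishing at z divides, up to
  integer factors, every other one. Applied to the cyclotomic polynomial, irreducibility makes
  \<open>d\<close> a rational multiple of it; hence \<open>d\<close>, and with it \<open>g\<close>,
  vanishes at the other primitive root \<open>w\<close> too.\<close>

lemma int_poly_conjugate_root:
  fixes g :: "int poly" and z w :: complex
  assumes p: "Factorial_Ring.prime p"
    and z: "z ^ (p ^ l) \<noteq> 1" "z ^ (p ^ Suc l) = 1" and w: "w ^ (p ^ l) \<noteq> 1" "w ^ (p ^ Suc l) = 1"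
    and g: "poly (map_poly of_int g) z = 0"
  shows "poly (map_poly of_int g) w = 0"
proof -
  let ?ev = "\<lambda>P z. poly (map_poly of_int P) (z :: complex)"
  let ?P = "\<lambda>d. d \<noteq> (0 :: int poly) \<and> ?ev d z = 0"
  define f where "f = prime_power_cyclotomic p l"
  have p0: "p > 0" using p by (simp add: prime_gt_0_nat)
  have f0: "f \<noteq> 0" using degree_prime_power_cyclotomic(2)[OF p0, of l] unfolding f_def by auto
  have fz: "?ev f z = 0" "?ev f w = 0"
    unfolding f_def using ev_prime_power_cyclotomic z w by blast+
  define d where "d = arg_min Polynomial.degree ?P"
  have d: "?P d" and dmin: "\<And>e. ?P e \<Longrightarrow> Polynomial.degree d \<le> Polynomial.degree e"
    using arg_min_natI[of ?P f Polynomial.degree] arg_min_nat_le[of ?P _ Polynomial.degree] f0 fz(1)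
    unfolding d_def by auto
  have div: "\<exists>a q. a \<noteq> 0 \<and> Polynomial.smult a h = d * q" if "?ev h z = 0" for h
  proof -
    obtain a q where aq: "a \<noteq> 0" "Polynomial.smult a h = d * q + pseudo_mod h d"
      using pseudo_mod(1)[of d h] d by blast
    have "?ev (pseudo_mod h d) z = 0"
      using arg_cong[OF aq(2), of "\<lambda>P. ?ev P z"] that d
      by (simp add: map_poly_of_int_add map_poly_of_int_mult map_poly_of_int_smult)
    then have "pseudo_mod h d = 0"
      using pseudo_mod(2)[of d h] d dmin[of "pseudo_mod h d"] by (meson not_le)
    then show ?thesis using aq by auto
  qed
  have dw: "?ev d w = 0"
  proof -
    obtain a q where aq: "a \<noteq> 0" "Polynomial.smult a f = d * q" using div[OF fz(1)] by blast
    have "Polynomial.degree d \<noteq> 0"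
    proof
      assume "Polynomial.degree d = 0"
      then obtain c where "d = [:c:]" by (metis degree_eq_zeroE)
      then show False using d by (auto simp: map_poly_pCons)
    qed
    moreover have "Polynomial.degree d = 0 \<or> Polynomial.degree q = 0"
      using prime_power_cyclotomic_irreducible[OF p aq(1), of d q l] aq(2) by (simp add: f_def)
    ultimately obtain c where c: "q = [:c:]" by (metis degree_eq_zeroE)
    have "c \<noteq> 0" using c aq f0 by auto
    moreover have "of_int c * ?ev d w = 0"
      using arg_cong[OF aq(2), of "\<lambda>P. ?ev P w"] c fz(2)
      by (simp add: map_poly_of_int_smult)
    ultimately show ?thesis by simp
  qed
  obtain a q where aq: "a \<noteq> 0" "Polynomial.smult a g = d * q" using div[OF g] by blast
  have "of_int a * ?ev g w = 0"
    using arg_cong[OF aq(2), of "\<lambda>P. ?ev P w"] dw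
    by (simp add: map_poly_of_int_smult map_poly_of_int_mult)
  then show ?thesis using aq(1) by simp
qed

lemma common_denominator:
  fixes q :: "'i \<Rightarrow> rat"
  assumes "finite I"
  obtains N :: int and r :: "'i \<Rightarrow> int" where "N \<noteq> 0" "\<And>i. i \<in> I \<Longrightarrow> of_int N * q i = of_int (r i)"
proof -
  have "\<exists>N::int. N \<noteq> 0 \<and> (\<forall>i\<in>I. \<exists>r. of_int N * q i = of_int r)"
    using assms
  proof (induction I)
    case empty
    show ?case by (intro exI[of _ 1]) simp
  next
    case (insert x I)
    then obtain N :: int where N: "N \<noteq> 0" "\<forall>i\<in>I. \<exists>r. of_int N * q i = of_int r" by blast
    obtain u v where uv: "quotient_of (q x) = (u, v)" by (cases "quotient_of (q x)")
    then have v: "v > 0" "q x = of_int u / of_int v"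
      using quotient_of_denom_pos quotient_of_div by blast+
    have "\<exists>r. of_int (v * N) * q i = of_int r" if "i \<in> insert x I" for i
    proof (cases "i = x")
      case True
      have "of_int (v * N) * q x = of_int (N * u)" using v by simp
      then show ?thesis using True by blast
    next
      case False
      then have "i \<in> I" using that by simp
      from bspec[OF N(2) this] obtain r where "of_int N * q i = of_int r" by (elim exE)
      then have "of_int (v * N) * q i = of_int (v * r)" by (metis mult.assoc of_int_mult)
      then show ?thesis by blast
    qed
    then show ?case using v(1) N(1) by (intro exI[of _ "v * N"]) auto
  qed
  then obtain N :: int where N: "N \<noteq> 0" "\<forall>i\<in>I. \<exists>r. of_int N * q i = of_int r"
    by (elim exE conjE)
  from bchoice[OF N(2)] obtain r where "\<forall>i\<in>I. of_int N * q i = of_int (r i)" by (elim exE)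
  with N(1) show ?thesis by (intro that[of N r]) simp_all
qed

text \<open>Stands in for the Galois automorphism z |-> z^r: only relations are transported, no
  field map is built. The exponents \<open>e i\<close> may repeat, so that a sum over group elements
  fits directly.\<close>

lemma rat_relation_conjugate:
  fixes q :: "'i \<Rightarrow> rat" and e :: "'i \<Rightarrow> nat" and z :: complex
  assumes p: "Factorial_Ring.prime p" and fin: "finite I"
    and z: "z ^ (p ^ l) = 1" "\<And>k. k < l \<Longrightarrow> z ^ (p ^ k) \<noteq> 1"
    and r: "coprime r (p ^ l)"
    and sum: "(\<Sum>i\<in>I. of_rat (q i) * z ^ e i) = 0"
  shows "(\<Sum>i\<in>I. of_rat (q i) * z ^ (r * e i)) = 0"
proof (cases l)
  case 0
  then have "z = 1" using z(1) by simp
  then show ?thesis using sum by simp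
next
  \<comment> \<open>The index shifts by one, since \<open>prime_power_cyclotomic p k\<close> belongs
    to the roots of order p^(k+1).\<close>
  case (Suc k)
  obtain N s where N: "N \<noteq> 0" "\<And>i. i \<in> I \<Longrightarrow> of_int N * q i = of_int (s i)"
    using common_denominator[OF fin] by blast
  define g where "g = (\<Sum>i\<in>I. Polynomial.monom (s i) (e i))"
  have "of_int N * of_rat (q i) = (of_int (s i) :: complex)" if "i \<in> I" for i
    using arg_cong[OF N(2)[OF that], of "of_rat :: rat \<Rightarrow> complex"] by (simp add: of_rat_mult)
  then have ev: "poly (map_poly of_int g) w = of_int N * (\<Sum>i\<in>I. of_rat (q i) * w ^ e i)" for w :: complex
    unfolding g_def map_poly_of_int_sum sum_distrib_left poly_sum
    by (intro sum.cong) (auto simp: map_poly_monom poly_monom mult.assoc[symmetric])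
  have "poly (map_poly of_int g) (z ^ r) = 0"
  proof (rule int_poly_conjugate_root[OF p])
    show "z ^ p ^ k \<noteq> 1" "z ^ p ^ Suc k = 1" using z Suc by auto
    show "(z ^ r) ^ p ^ Suc k = 1" using z(1) Suc by (metis power_commutes power_mult power_one mult.commute)
    show "poly (map_poly of_int g) z = 0" using ev[of z] sum by simp
    have "coprime r p" using r Suc by simp
    moreover have "r \<noteq> 0" using \<open>coprime r p\<close> p by (cases "r = 0") auto
    \<comment> \<open>\<open>u\<close> inverts r modulo p, so that (z^r)^(p^k) = 1 would give
      z^(p^k) = 1.\<close>
    ultimately obtain u v :: nat where uv: "r * u = p * v + 1"
      using bezout_nat[of r p] by auto
    show "(z ^ r) ^ p ^ k \<noteq> 1"
    proof
      assume a: "(z ^ r) ^ p ^ k = 1"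
      have "1 = ((z ^ r) ^ p ^ k) ^ u" using a by simp
      also have "\<dots> = (z ^ p ^ k) ^ (r * u)" by (simp add: power_mult[symmetric] mult_ac)
      also have "\<dots> = (z ^ p ^ Suc k) ^ v * z ^ p ^ k" unfolding uv by (simp add: power_add power_mult[symmetric] mult_ac)
      also have "\<dots> = z ^ p ^ k" using z(1) Suc by simp
      finally show False using z(2)[of k] Suc by simp
    qed
  qed
  then have "(\<Sum>i\<in>I. of_rat (q i) * (z ^ r) ^ e i) = 0" using ev N(1) by simp
  then show ?thesis by (simp add: power_mult)
qed

section \<open>Cyclotomic fields of prime power index\<close>

lemma zeta_pow_self: "m > 0 \<Longrightarrow> zeta m ^ m = 1"
  by (simp add: zeta_def DeMoivre)

lemma root_of_unity_eq_zeta_pow: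
  assumes "m > 0" "z ^ m = 1"
  obtains k where "k < m" "z = zeta m ^ k"
proof -
  have "z \<in> (\<lambda>k. cis (2 * pi * real k / real m)) ` {..<m}"
    using bij_betw_roots_unity[OF assms(1)] assms(2) by (auto simp: bij_betw_def)
  then show ?thesis using that by (auto simp: zeta_def DeMoivre mult_ac)
qed

lemma zeta_pow_neq_1:
  assumes "0 < k" "k < m"
  shows "zeta m ^ k \<noteq> 1"
proof
  assume a: "zeta m ^ k = 1"
  have "inj_on (\<lambda>k. cis (2 * pi * real k / real m)) {..<m}"
    using bij_betw_roots_unity[of m] assms by (auto simp: bij_betw_def)
  moreover have "cis (2 * pi * real k / real m) = cis (2 * pi * real 0 / real m)"
    using a by (simp add: zeta_def DeMoivre mult_ac)
  ultimately have "k = 0" by (rule inj_onD) (use assms in auto)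
  then show False using assms by simp
qed

lemma cyclotomic_fieldI:
  "(\<Sum>i<N. of_rat (q i) * zeta m ^ i) \<in> cyclotomic_field m"
  unfolding cyclotomic_field_def by blast

lemma rat_span_zeta_in_cyclotomic_field:
  assumes "finite I"
  shows "(\<Sum>i\<in>I. of_rat (q i) * zeta m ^ (e i :: nat)) \<in> cyclotomic_field m"
proof -
  obtain N where N: "\<And>i. i \<in> I \<Longrightarrow> e i < N"
    using assms finite_nat_set_iff_bounded[of "e ` I"] by auto
  have "(\<Sum>i\<in>I. of_rat (q i) * zeta m ^ e i) = (\<Sum>j<N. \<Sum>i\<in>{i\<in>I. e i = j}. of_rat (q i) * zeta m ^ e i)"
    using N assms by (intro sum.group[symmetric]) auto
  also have "\<dots> = (\<Sum>j<N. of_rat (\<Sum>i\<in>{i\<in>I. e i = j}. q i) * zeta m ^ j)"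
    by (intro sum.cong) (auto simp: of_rat_sum sum_distrib_right)
  also have "\<dots> \<in> cyclotomic_field m" by (rule cyclotomic_fieldI)
  finally show ?thesis .
qed

lemma zeta_pow_in_cyclotomic_field: "zeta m ^ k \<in> cyclotomic_field m"
  using rat_span_zeta_in_cyclotomic_field[of "{0::nat}" "\<lambda>_. 1" m "\<lambda>_. k"] by simp

lemma zero_in_cyclotomic_field: "0 \<in> cyclotomic_field m"
  using rat_span_zeta_in_cyclotomic_field[of "{}"] by simp

lemma cyclotomic_field_add:
  assumes "x \<in> cyclotomic_field m" "y \<in> cyclotomic_field m"
  shows "x + y \<in> cyclotomic_field m"
proof -
  obtain N q M r where x: "x = (\<Sum>i<N. of_rat (q i) * zeta m ^ i)" and y: "y = (\<Sum>i<M. of_rat (r i) * zeta m ^ i)"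
    using assms unfolding cyclotomic_field_def by blast
  have "x + y = (\<Sum>i\<in>{..<N} <+> {..<M}. of_rat (case i of Inl i \<Rightarrow> q i | Inr i \<Rightarrow> r i) *
      zeta m ^ (case i of Inl i \<Rightarrow> i | Inr i \<Rightarrow> i))"
    by (simp add: x y sum.Plus)
  also have "\<dots> \<in> cyclotomic_field m" by (intro rat_span_zeta_in_cyclotomic_field) simp
  finally show ?thesis .
qed

lemma cyclotomic_field_scale:
  assumes "x \<in> cyclotomic_field m"
  shows "of_rat c * x \<in> cyclotomic_field m"
proof -
  obtain N q where x: "x = (\<Sum>i<N. of_rat (q i) * zeta m ^ i)"
    using assms unfolding cyclotomic_field_def by blast
  have "of_rat c * x = (\<Sum>i<N. of_rat (c * q i) * zeta m ^ i)"
    by (simp add: x sum_distrib_left of_rat_mult mult.assoc)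
  also have "\<dots> \<in> cyclotomic_field m" by (rule cyclotomic_fieldI)
  finally show ?thesis .
qed

lemma cyclotomic_field_sum:
  assumes "\<And>i. i \<in> I \<Longrightarrow> f i \<in> cyclotomic_field m"
  shows "(\<Sum>i\<in>I. f i) \<in> cyclotomic_field m"
  using assms
  by (induction I rule: infinite_finite_induct) (auto intro: zero_in_cyclotomic_field cyclotomic_field_add)

lemma root_of_unity_in_cyclotomic_field:
  assumes "m > 0" "z ^ m = 1"
  shows "z \<in> cyclotomic_field m"
  using root_of_unity_eq_zeta_pow[OF assms] zeta_pow_in_cyclotomic_field by metis

lemma sum_powers_root_of_unity:
  fixes z :: complex
  assumes "z ^ m = 1" "z \<noteq> 1"
  shows "(\<Sum>i<m. z ^ i) = 0"
  using assms power_diff_1_eq[of z m] by auto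

text \<open>For l = n + 1 the root w = zeta^(p^n) has order p, so 1 + w + ... + w^(p-1) = 0 rewrites
  zeta^k with k at least (p-1) p^n = totient(p^l) through strictly smaller exponents. Iterating
  leaves exponents below the totient.\<close>

lemma zeta_pow_reduce:
  assumes p: "Factorial_Ring.prime p"
  shows "\<exists>q::nat\<Rightarrow>rat. zeta (p ^ l) ^ k = (\<Sum>j<totient (p ^ l). of_rat (q j) * zeta (p ^ l) ^ j)"
proof (cases l)
  case 0
  then show ?thesis by (intro exI[of _ "\<lambda>_. 1"]) (simp add: zeta_def)
next
  case (Suc n)
  let ?m = "p ^ l" and ?t = "totient (p ^ l)"
  have p1: "p > 1" using p by (rule prime_gt_1_nat)
  have t: "?t = (p - 1) * p ^ n"
    using totient_prime_power_Suc[OF p, of n] Suc by (simp add: mult.commute)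
  show ?thesis
  proof (induction k rule: less_induct)
    case (less k)
    show ?case
    proof (cases "k < ?t")
      case True
      then have "zeta ?m ^ k = (\<Sum>j<?t. of_rat (if j = k then 1 else 0) * zeta ?m ^ j)"
        by (simp add: if_distrib[of of_rat] if_distrib[of "\<lambda>x. x * _"] cong: if_cong)
      then show ?thesis by (rule exI[of _ "\<lambda>j. if j = k then 1 else 0"])
    next
      case False
      then have k: "k = (k - ?t) + ?t" by simp
      define w where "w = zeta ?m ^ p ^ n"
      have "w \<noteq> 1" unfolding w_def using p1 Suc by (intro zeta_pow_neq_1) auto
      moreover have "w ^ p = 1"
        unfolding w_def using p1 Suc zeta_pow_self[of ?m] by (simp add: power_mult[symmetric] mult.commute)
      ultimately have "(\<Sum>i<p. w ^ i) = 0" by (intro sum_powers_root_of_unity)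
      then have "(\<Sum>i<Suc (p - 1). w ^ i) = 0" using p1 by simp
      then have "w ^ (p - 1) = - (\<Sum>i<p - 1. w ^ i)"
        by (simp only: sum.lessThan_Suc) (simp add: eq_neg_iff_add_eq_0 add.commute)
      moreover have "zeta ?m ^ k = zeta ?m ^ (k - ?t) * w ^ (p - 1)"
        by (subst k) (simp only: power_add w_def t power_mult[symmetric] mult.commute)
      ultimately have "zeta ?m ^ k = (\<Sum>i<p - 1. - (zeta ?m ^ (k - ?t) * w ^ i))"
        by (simp add: sum_distrib_left sum_negf)
      also have "\<dots> = (\<Sum>i<p - 1. - (zeta ?m ^ (k - ?t + p ^ n * i)))"
        by (simp add: w_def power_add power_mult)
      finally have eq: "zeta ?m ^ k = (\<Sum>i<p - 1. - (zeta ?m ^ (k - ?t + p ^ n * i)))" .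
      have "\<forall>i\<in>{..<p - 1}. \<exists>q::nat\<Rightarrow>rat. zeta ?m ^ (k - ?t + p ^ n * i) = (\<Sum>j<?t. of_rat (q j) * zeta ?m ^ j)"
      proof
        fix i assume "i \<in> {..<p - 1}"
        then have "p ^ n * i < p ^ n * (p - 1)" using p1 by simp
        then have "p ^ n * i < ?t" by (simp only: t mult.commute)
        then have "k - ?t + p ^ n * i < k" using False by linarith
        then show "\<exists>q::nat\<Rightarrow>rat. zeta ?m ^ (k - ?t + p ^ n * i) = (\<Sum>j<?t. of_rat (q j) * zeta ?m ^ j)"
          by (rule less.IH)
      qed
      from bchoice[OF this] obtain q :: "nat \<Rightarrow> nat \<Rightarrow> rat" where
        q: "\<forall>i\<in>{..<p - 1}. zeta ?m ^ (k - ?t + p ^ n * i) = (\<Sum>j<?t. of_rat (q i j) * zeta ?m ^ j)"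
        by (elim exE)
      have "zeta ?m ^ k = (\<Sum>i<p - 1. \<Sum>j<?t. of_rat (- q i j) * zeta ?m ^ j)"
        unfolding eq using q by (intro sum.cong) (simp_all add: of_rat_minus sum_negf)
      also have "\<dots> = (\<Sum>j<?t. of_rat (\<Sum>i<p - 1. - q i j) * zeta ?m ^ j)"
        by (subst sum.swap) (simp add: of_rat_sum sum_distrib_right)
      finally show ?thesis by (rule exI[of _ "\<lambda>j. \<Sum>i<p - 1. - q i j"])
    qed
  qed
qed

lemma cyclotomic_field_span:
  assumes p: "Factorial_Ring.prime p" and x: "x \<in> cyclotomic_field (p ^ l)"
  shows "\<exists>q::nat\<Rightarrow>rat. x = (\<Sum>j<totient (p ^ l). of_rat (q j) * zeta (p ^ l) ^ j)"
proof -
  let ?m = "p ^ l" and ?t = "totient (p ^ l)"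
  obtain N r where x: "x = (\<Sum>i<N. of_rat (r i) * zeta ?m ^ i)"
    using x unfolding cyclotomic_field_def by blast
  have "\<forall>i. \<exists>q::nat\<Rightarrow>rat. zeta ?m ^ i = (\<Sum>j<?t. of_rat (q j) * zeta ?m ^ j)"
    using zeta_pow_reduce[OF p] by blast
  from choice[OF this] obtain q :: "nat \<Rightarrow> nat \<Rightarrow> rat"
    where q: "\<forall>i. zeta ?m ^ i = (\<Sum>j<?t. of_rat (q i j) * zeta ?m ^ j)" by (elim exE)
  have "x = (\<Sum>i<N. of_rat (r i) * (\<Sum>j<?t. of_rat (q i j) * zeta ?m ^ j))"
    unfolding x by (intro sum.cong) (simp_all only: q[rule_format, symmetric])
  also have "\<dots> = (\<Sum>j<?t. of_rat (\<Sum>i<N. r i * q i j) * zeta ?m ^ j)"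
    unfolding sum_distrib_left
    by (subst sum.swap) (simp add: of_rat_sum sum_distrib_right of_rat_mult mult.assoc)
  finally show ?thesis by (rule exI[of _ "\<lambda>j. \<Sum>i<N. r i * q i j"])
qed

text \<open>The p^l-th roots of unity form a cyclic p-group, whose subgroups are a chain. This
  comparability decides later which of \<open>a\<close> and \<open>b\<close> is corrected by a power
  of the other.\<close>

lemma prime_power_roots_of_unity_comparable:
  fixes u v :: complex
  assumes p: "Factorial_Ring.prime p" and u: "u ^ (p ^ l) = 1" and v: "v ^ (p ^ l) = 1"
  shows "(\<exists>k. v = u ^ k) \<or> (\<exists>k. u = v ^ k)"
proof -
  \<comment> \<open>A root \<open>u\<close> of exact order p^s is a power of zeta with exponent
    prime to p, hence a generator; \<open>x\<close> below inverts that exponent modulo p^s.\<close>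
  have *: "\<exists>k. v = u ^ k" if st: "v ^ (p ^ s) = 1" "u ^ (p ^ s) = 1" "\<And>i. i < s \<Longrightarrow> u ^ (p ^ i) \<noteq> 1" for u v :: complex and s
  proof (cases s)
    case 0
    then show ?thesis using st by simp
  next
    case (Suc r)
    have p0: "p ^ s > 0" using p by (simp add: prime_gt_0_nat)
    obtain i where i: "u = zeta (p ^ s) ^ i" using root_of_unity_eq_zeta_pow[OF p0 st(2)] by blast
    obtain j where j: "v = zeta (p ^ s) ^ j" using root_of_unity_eq_zeta_pow[OF p0 st(1)] by blast
    have "\<not> p dvd i"
    proof
      assume "p dvd i"
      then obtain t where "i = p * t" by blast
      then have "u ^ (p ^ r) = (zeta (p ^ s) ^ (p ^ s)) ^ t"
        by (simp add: i Suc power_mult[symmetric] mult_ac)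
      then show False using st(3)[of r] Suc p0 by (simp add: zeta_pow_self)
    qed
    then have "coprime (p ^ s) i" using p by (simp add: prime_imp_coprime)
    then have cop: "coprime i (p ^ s)" by (simp only: coprime_commute)
    moreover have "i \<noteq> 0" using \<open>\<not> p dvd i\<close> by (cases "i = 0") auto
    ultimately obtain x y :: nat where xy: "i * x = p ^ s * y + 1"
      using bezout_nat[of i "p ^ s"] by auto
    have "u ^ (x * j) = zeta (p ^ s) ^ (i * x * j)" by (simp add: i power_mult)
    also have "\<dots> = (zeta (p ^ s) ^ (p ^ s)) ^ (y * j) * v"
      by (simp only: xy j power_mult[symmetric] power_add[symmetric]) (simp add: algebra_simps)
    also have "\<dots> = v" using p0 by (simp add: zeta_pow_self)
    finally show ?thesis by metis
  qed
  define s where "s = (LEAST s. u ^ (p ^ s) = 1)"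
  define t where "t = (LEAST s. v ^ (p ^ s) = 1)"
  have s: "u ^ (p ^ s) = 1" "\<And>i. i < s \<Longrightarrow> u ^ (p ^ i) \<noteq> 1"
    unfolding s_def using u LeastI[of "\<lambda>s. u ^ (p ^ s) = 1"] not_less_Least by blast+
  have t: "v ^ (p ^ t) = 1" "\<And>i. i < t \<Longrightarrow> v ^ (p ^ i) \<noteq> 1"
    unfolding t_def using v LeastI[of "\<lambda>s. v ^ (p ^ s) = 1"] not_less_Least by blast+
  have up: "z ^ (p ^ b) = 1" if "z ^ (p ^ a) = 1" "a \<le> b" for z :: complex and a b
  proof -
    have "z ^ (p ^ b) = (z ^ (p ^ a)) ^ (p ^ (b - a))"
      using that by (metis le_add_diff_inverse power_add power_mult)
    then show ?thesis using that by simp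
  qed
  show ?thesis
  proof (cases "t \<le> s")
    case True
    then show ?thesis using *[OF up[OF t(1)] s] by blast
  next
    case False
    then show ?thesis using *[OF up[OF s(1)] t] by simp
  qed
qed

section \<open>Linear characters of abelian sections\<close>

lemma complex_root_exists:
  assumes "m > 0"
  obtains z :: complex where "z ^ m = w"
proof
  show "rcis (root m (cmod w)) (Arg w / real m) ^ m = w"
    using assms by (simp add: DeMoivre2 rcis_cmod_Arg)
qed

context group
begin

lemma finite_closed_subgroup:
  assumes fin: "finite (carrier G)" and S: "S \<subseteq> carrier G" "\<one> \<in> S"
    and closed: "\<And>x y. x \<in> S \<Longrightarrow> y \<in> S \<Longrightarrow> x \<otimes> y \<in> S"
  shows "subgroup S G"
proof (rule subgroupI)
  fix x assume x: "x \<in> S"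
  have pow: "x [^] (k::nat) \<in> S" for k
    using x S closed by (induction k) auto
  have "order G > 0" using fin by (simp add: order_gt_0_iff_finite)
  then have "x [^] (order G - 1) \<otimes> x = x [^] order G"
    by (metis Suc_diff_1 nat_pow_Suc)
  also have "\<dots> = \<one>" using pow_order_eq_1 x S by blast
  finally have "inv x = x [^] (order G - 1)"
    using x S by (intro inv_equality) auto
  then show "inv x \<in> S" using pow by simp
qed (use S closed in auto)

lemma subgroup_nat_pow_closed:
  assumes "subgroup B G" "x \<in> B"
  shows "x [^] (k::nat) \<in> B"
  using assms by (induction k) (auto simp: subgroup.one_closed subgroup.m_closed)

text \<open>\<open>m\<close> is the order of x modulo \<open>B\<close>, the exponent at which a
  character of \<open>B\<close> constrains the value of an extension at x.\<close>

lemma power_in_subgroup_iff_dvd: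
  assumes fin: "finite (carrier G)" and B: "subgroup B G" and x: "x \<in> carrier G"
  obtains m :: nat where "m > 0" "\<And>k::nat. x [^] k \<in> B \<longleftrightarrow> m dvd k"
proof -
  let ?P = "\<lambda>k::nat. k > 0 \<and> x [^] k \<in> B"
  have "?P (order G)"
    using fin x B by (simp add: order_gt_0_iff_finite pow_order_eq_1 subgroup.one_closed)
  define m where "m = (LEAST k. ?P k)"
  have m: "?P m" unfolding m_def by (rule LeastI[of ?P, OF \<open>?P (order G)\<close>])
  have least: "\<not> ?P j" if "j < m" for j using that unfolding m_def by (rule not_less_Least)
  have mult: "x [^] (m * t) \<in> B" for t
  proof (induction t)
    case 0
    then show ?case using B by (simp add: subgroup.one_closed)
  next
    case (Suc t)
    have "x [^] (m * Suc t) = x [^] m \<otimes> x [^] (m * t)"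
      using x by (simp add: nat_pow_mult)
    then show ?case using Suc m B by (simp add: subgroup.m_closed)
  qed
  have "x [^] k \<in> B \<longleftrightarrow> m dvd k" for k :: nat
  proof
    assume k: "x [^] k \<in> B"
    have "x [^] k = x [^] (m * (k div m)) \<otimes> x [^] (k mod m)"
      using x by (simp add: nat_pow_mult)
    then have "x [^] (k mod m) = inv (x [^] (m * (k div m))) \<otimes> x [^] k"
      using x by (simp add: inv_solve_left)
    then have "x [^] (k mod m) \<in> B"
      using mult k B by (simp add: subgroup.m_closed subgroup.m_inv_closed)
    moreover have "k mod m < m" using m by simp
    ultimately have "k mod m = 0" using least[of "k mod m"] by simp
    then show "m dvd k" by (simp add: dvd_eq_mod_eq_0)
  next
    assume "m dvd k"
    then show "x [^] k \<in> B" using mult by auto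
  qed
  with m that show ?thesis by blast
qed

text \<open>Adjoins one element x that normalises \<open>B\<close> and fixes \<chi>. A value z at x
  is compatible with \<chi> when z^m = \<chi>(x^m), m being the order of x modulo \<open>B\<close>.
  The freedom in z serves three purposes: an arbitrary root in \<open>extend_char\<close>, a
  primitive root of unity in \<open>char_separates\<close>, and z = 1 in
  \<open>rep_exists\<close>.\<close>

lemma extend_linear_character:
  fixes \<chi> :: "'a \<Rightarrow> complex"
  assumes fin: "finite (carrier G)" and B: "subgroup B G" and x: "x \<in> carrier G"
    and hom: "\<And>b b'. b \<in> B \<Longrightarrow> b' \<in> B \<Longrightarrow> \<chi> (b \<otimes> b') = \<chi> b * \<chi> b'" and one: "\<chi> \<one> = 1"
    and conj: "\<And>b. b \<in> B \<Longrightarrow> x \<otimes> b \<otimes> inv x \<in> B" "\<And>b. b \<in> B \<Longrightarrow> \<chi> (x \<otimes> b \<otimes> inv x) = \<chi> b"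
    and m: "\<And>k::nat. x [^] k \<in> B \<longleftrightarrow> m dvd k" and z: "z ^ m = \<chi> (x [^] m)"
  obtains B' \<theta> where "subgroup B' G" "B' = {b \<otimes> x [^] (k::nat) | b k. b \<in> B}"
    "\<And>b k::nat. b \<in> B \<Longrightarrow> \<theta> (b \<otimes> x [^] k) = \<chi> b * z ^ k"
    "\<And>g h. g \<in> B' \<Longrightarrow> h \<in> B' \<Longrightarrow> \<theta> (g \<otimes> h) = \<theta> g * \<theta> h"
    "\<And>g. g \<notin> B' \<Longrightarrow> \<theta> g = 0"
proof -
  define B' where "B' = {b \<otimes> x [^] (k::nat) | b k. b \<in> B}"
  have Bc: "b \<in> carrier G" if "b \<in> B" for b using that B by (rule subgroup.mem_carrier[rotated])
  have pow: "\<chi> (x [^] (m * t)) = z ^ (m * t)" for t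
  proof (induction t)
    case (Suc t)
    have "\<chi> (x [^] (m * Suc t)) = \<chi> (x [^] m \<otimes> x [^] (m * t))"
      using x by (simp add: nat_pow_mult)
    also have "\<dots> = z ^ m * z ^ (m * t)" using m by (subst hom) (auto simp: z Suc)
    finally show ?case by (simp add: power_add)
  qed (simp add: one)
  \<comment> \<open>Two expressions of one element differ by x^(j - i) in \<open>B\<close>, whose
    exponent is divisible by m, and there \<chi> agrees with the power of z.\<close>
  have wd': "\<chi> b * z ^ i = \<chi> b' * z ^ j"
    if "b \<in> B" "b' \<in> B" "b \<otimes> x [^] i = b' \<otimes> x [^] j" "i \<le> j" for b b' and i j :: nat
  proof -
    have "b' \<otimes> x [^] j = b' \<otimes> x [^] (j - i) \<otimes> x [^] i"
      using that x Bc by (simp add: m_assoc nat_pow_mult)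
    then have b: "b = b' \<otimes> x [^] (j - i)"
      using that x Bc by (simp add: r_cancel)
    then have "x [^] (j - i) = inv b' \<otimes> b" using that x Bc by (simp add: inv_solve_left)
    then have xB: "x [^] (j - i) \<in> B" using that B by (simp add: subgroup.m_closed subgroup.m_inv_closed)
    then obtain t where t: "j - i = m * t" using m by blast
    have "\<chi> b = \<chi> b' * z ^ (j - i)" using b hom[OF that(2) xB] pow[of t] t by simp
    then show ?thesis using that(4) by (simp add: mult.assoc power_add[symmetric])
  qed
  have wd: "\<chi> b * z ^ i = \<chi> b' * z ^ j"
    if "b \<in> B" "b' \<in> B" "b \<otimes> x [^] i = b' \<otimes> x [^] j" for b b' and i j :: nat
    using wd'[of b b' i j] wd'[of b' b j i] that by (cases "i \<le> j") auto
  define \<theta> where "\<theta> = (\<lambda>g. if g \<in> B' then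
      (THE w. \<exists>b k. b \<in> B \<and> g = b \<otimes> x [^] (k::nat) \<and> w = \<chi> b * z ^ k) else 0)"
  have \<theta>: "\<theta> (b \<otimes> x [^] k) = \<chi> b * z ^ k" if "b \<in> B" for b and k :: nat
  proof -
    have "b \<otimes> x [^] k \<in> B'" using that by (auto simp: B'_def)
    moreover have "(THE w. \<exists>b' j. b' \<in> B \<and> b \<otimes> x [^] k = b' \<otimes> x [^] (j::nat) \<and> w = \<chi> b' * z ^ j) = \<chi> b * z ^ k"
    proof (rule the_equality)
      show "\<exists>b' j. b' \<in> B \<and> b \<otimes> x [^] k = b' \<otimes> x [^] (j::nat) \<and> \<chi> b * z ^ k = \<chi> b' * z ^ j"
        using that by (intro exI[of _ b] exI[of _ k]) simp
      fix w assume "\<exists>b' j. b' \<in> B \<and> b \<otimes> x [^] k = b' \<otimes> x [^] (j::nat) \<and> w = \<chi> b' * z ^ j"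
      then obtain b' and j :: nat where "b' \<in> B" "b \<otimes> x [^] k = b' \<otimes> x [^] j" "w = \<chi> b' * z ^ j"
        by (elim exE conjE)
      then show "w = \<chi> b * z ^ k" using wd[OF that, of b' k j] by simp
    qed
    ultimately show ?thesis by (simp add: \<theta>_def)
  qed
  have conjk: "x [^] k \<otimes> b \<otimes> inv (x [^] k) \<in> B \<and> \<chi> (x [^] k \<otimes> b \<otimes> inv (x [^] k)) = \<chi> b"
    if "b \<in> B" for b and k :: nat
  proof (induction k)
    case (Suc k)
    let ?c = "x [^] k \<otimes> b \<otimes> inv (x [^] k)"
    have "x [^] Suc k = x \<otimes> x [^] k" using x nat_pow_Suc2 by blast
    then have "x [^] Suc k \<otimes> b \<otimes> inv (x [^] Suc k) = x \<otimes> ?c \<otimes> inv x"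
      using x Bc[OF that] by (simp add: inv_mult_group m_assoc)
    then show ?case using conj Suc by metis
  qed (use that Bc in simp)
  \<comment> \<open>Collecting the powers of x on the right conjugates b' by x^i, which \<chi> does
    not notice.\<close>
  have mult: "(b \<otimes> x [^] i) \<otimes> (b' \<otimes> x [^] j) = (b \<otimes> (x [^] i \<otimes> b' \<otimes> inv (x [^] i))) \<otimes> x [^] (i + j)"
    if "b \<in> B" "b' \<in> B" for b b' and i j :: nat
  proof -
    have "inv (x [^] i) \<otimes> x [^] (i + j) = x [^] j"
      using x by (simp add: nat_pow_mult[symmetric] m_assoc[symmetric])
    then show ?thesis using that x Bc by (simp add: m_assoc)
  qed
  have cl: "b \<otimes> (x [^] i \<otimes> b' \<otimes> inv (x [^] i)) \<in> B" if "b \<in> B" "b' \<in> B" for b b' and i :: nat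
    using that conjk[of b' i] B by (simp add: subgroup.m_closed)
  show ?thesis
  proof (rule that[of B' \<theta>])
    show "subgroup B' G"
    proof (rule finite_closed_subgroup[OF fin])
      show "B' \<subseteq> carrier G" using x Bc by (auto simp: B'_def)
      have "\<one> = \<one> \<otimes> x [^] (0::nat)" by simp
      then show "\<one> \<in> B'" using B subgroup.one_closed unfolding B'_def by blast
      fix g h assume "g \<in> B'" "h \<in> B'"
      then show "g \<otimes> h \<in> B'" using mult cl unfolding B'_def by blast
    qed
    show "\<theta> (g \<otimes> h) = \<theta> g * \<theta> h" if gh: "g \<in> B'" "h \<in> B'" for g h
    proof -
      obtain b i b' j where g: "g = b \<otimes> x [^] (i::nat)" "h = b' \<otimes> x [^] (j::nat)" and b: "b \<in> B" "b' \<in> B"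
        using gh unfolding B'_def by blast
      show ?thesis unfolding g mult[OF b] \<theta>[OF cl[OF b]]
        using b conjk[of b' i] by (simp add: hom \<theta> power_add)
    qed
    show "B' = {b \<otimes> x [^] (k::nat) | b k. b \<in> B}" by (rule B'_def)
    show "\<theta> g = 0" if "g \<notin> B'" for g using that by (simp add: \<theta>_def)
  qed (rule \<theta>)
qed

end

text \<open>Characters of \<open>H\<close> trivial on \<open>N\<close>, extended by zero outside \<open>H\<close>.\<close>
definition linear_chars :: "('g, 'b) monoid_scheme \<Rightarrow> 'g set \<Rightarrow> 'g set \<Rightarrow> ('g \<Rightarrow> complex) set" where
  "linear_chars G H N = {\<chi>. (\<forall>x\<in>H. \<forall>y\<in>H. \<chi> (x \<otimes>\<^bsub>G\<^esub> y) = \<chi> x * \<chi> y) \<and> (\<forall>x\<in>N. \<chi> x = 1) \<and> (\<forall>x. x \<notin> H \<longrightarrow> \<chi> x = 0)}"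

lemma linear_charsD:
  assumes "\<chi> \<in> linear_chars G H N"
  shows "x \<in> H \<Longrightarrow> y \<in> H \<Longrightarrow> \<chi> (x \<otimes>\<^bsub>G\<^esub> y) = \<chi> x * \<chi> y" "x \<in> N \<Longrightarrow> \<chi> x = 1" "x \<notin> H \<Longrightarrow> \<chi> x = 0"
  using assms by (auto simp: linear_chars_def)

text \<open>Characters of the abelian group H/N are kept as functions on G, so that extending them
  involves no cosets. That \<open>N\<close> is normal in \<open>H\<close> follows from the
  commutator condition, by \<open>conj_H\<close> with B = N.\<close>

locale abelian_section = group G for G (structure) +
  fixes H N :: "'a set"
  assumes finite_G: "finite (carrier G)" and subH: "subgroup H G" and subN: "subgroup N G"
    and N_H: "N \<subseteq> H"
    and commutator_N: "\<And>x y. x \<in> H \<Longrightarrow> y \<in> H \<Longrightarrow> x \<otimes> y \<otimes> inv x \<otimes> inv y \<in> N"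
begin

lemma H_carrier: "x \<in> H \<Longrightarrow> x \<in> carrier G"
  using subH by (rule subgroup.mem_carrier)

lemma finite_H: "finite H"
  using finite_G subH by (meson finite_subset subgroup.subset)

lemma finite_N: "finite N"
  using finite_H N_H by (rule finite_subset[rotated])

lemma one_N: "\<one> \<in> N" and one_H: "\<one> \<in> H"
  using subN subH by (auto intro: subgroup.one_closed)

lemma char_one: "\<chi> \<in> linear_chars G H N \<Longrightarrow> \<chi> \<one> = 1"
  by (rule linear_charsD(2)[OF _ one_N])

lemma char_pow:
  assumes "\<chi> \<in> linear_chars G H N" "x \<in> H"
  shows "\<chi> (x [^] (k::nat)) = \<chi> x ^ k"
proof (induction k)
  case (Suc k)
  have "x [^] k \<in> H" using subgroup_nat_pow_closed[OF subH assms(2)] .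
  then show ?case using Suc assms by (simp add: linear_charsD)
qed (use assms char_one in simp)

lemma char_root_of_unity:
  assumes "\<chi> \<in> linear_chars G H N" "x \<in> H"
  shows "\<chi> x ^ order G = 1"
  using assms char_pow[OF assms, of "order G", symmetric] pow_order_eq_1[OF H_carrier[OF assms(2)]] char_one
  by simp

lemma char_nonzero:
  assumes "\<chi> \<in> linear_chars G H N" "x \<in> H"
  shows "\<chi> x \<noteq> 0"
proof -
  have "order G > 0" using finite_G order_gt_0_iff_finite by blast
  then show ?thesis using char_root_of_unity[OF assms] by (auto simp: power_0_left)
qed

lemma finite_linear_chars: "finite (linear_chars G H N)"
proof (rule finite_subset)
  show "linear_chars G H N \<subseteq> {f. \<forall>x. (x \<in> H \<longrightarrow> f x \<in> {z. z ^ order G = 1}) \<and> (x \<notin> H \<longrightarrow> f x = 0)}"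
    by (auto simp: char_root_of_unity linear_charsD(3))
  have "finite {z::complex. z ^ order G = 1}"
    using finite_G by (intro finite_roots_unity) (auto simp: order_gt_0_iff_finite Suc_le_eq)
  then show "finite {f. \<forall>x. (x \<in> H \<longrightarrow> f x \<in> {z::complex. z ^ order G = 1}) \<and> (x \<notin> H \<longrightarrow> f x = 0)}"
    by (rule finite_set_of_finite_funs[OF finite_H])
qed

lemma char_mult:
  assumes "\<chi> \<in> linear_chars G H N" "\<theta> \<in> linear_chars G H N"
  shows "(\<lambda>x. \<chi> x * \<theta> x) \<in> linear_chars G H N"
  using assms by (auto simp: linear_chars_def)

lemma char_power:
  assumes "\<chi> \<in> linear_chars G H N" "k > 0"
  shows "(\<lambda>x. \<chi> x ^ k) \<in> linear_chars G H N"
  using assms by (auto simp: linear_chars_def power_mult_distrib power_0_left)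

lemma char_inverse:
  assumes "\<chi> \<in> linear_chars G H N"
  shows "(\<lambda>x. inverse (\<chi> x)) \<in> linear_chars G H N"
  using assms by (auto simp: linear_chars_def)

text \<open>A conjugate of b differs from b by a commutator, which lies in N; hence every B between
  N and H is normal in H and its characters trivial on N are invariant. These are the conditions
  under which a character can be extended.\<close>

lemma conj_H:
  assumes "x \<in> H" "b \<in> B" "subgroup B G" "N \<subseteq> B" "B \<subseteq> H"
  shows "x \<otimes> b \<otimes> inv x \<in> B" and "\<chi> \<in> linear_chars G B N \<Longrightarrow> \<chi> (x \<otimes> b \<otimes> inv x) = \<chi> b"
proof -
  have c: "x \<in> carrier G" "b \<in> carrier G" using assms H_carrier by auto
  have n: "x \<otimes> b \<otimes> inv x \<otimes> inv b \<in> N" using assms by (intro commutator_N) auto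
  have eq: "x \<otimes> b \<otimes> inv x = (x \<otimes> b \<otimes> inv x \<otimes> inv b) \<otimes> b" using c by (simp add: m_assoc)
  have "(x \<otimes> b \<otimes> inv x \<otimes> inv b) \<otimes> b \<in> B" using n assms(2-4) by (auto intro: subgroup.m_closed[OF assms(3)])
  then show "x \<otimes> b \<otimes> inv x \<in> B" by (simp only: eq[symmetric])
  show "\<chi> (x \<otimes> b \<otimes> inv x) = \<chi> b" if "\<chi> \<in> linear_chars G B N"
  proof -
    have "\<chi> ((x \<otimes> b \<otimes> inv x \<otimes> inv b) \<otimes> b) = \<chi> b"
      using n assms that by (auto simp: linear_charsD)
    then show ?thesis by (simp only: eq[symmetric])
  qed
qed

lemma extend_char_step:
  assumes B: "subgroup B G" "N \<subseteq> B" "B \<subseteq> H" and \<chi>: "\<chi> \<in> linear_chars G B N" and x: "x \<in> H"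
    and m: "\<And>k::nat. x [^] k \<in> B \<longleftrightarrow> m dvd k" and z: "z ^ m = \<chi> (x [^] m)"
  obtains B' \<theta> where "subgroup B' G" "B \<subseteq> B'" "x \<in> B'" "B' \<subseteq> H" "\<theta> \<in> linear_chars G B' N"
    "\<And>b. b \<in> B \<Longrightarrow> \<theta> b = \<chi> b" "\<theta> x = z"
proof -
  have one: "\<chi> \<one> = 1" using \<chi> one_N by (rule linear_charsD(2))
  obtain B' \<theta> where B': "subgroup B' G" "B' = {b \<otimes> x [^] (k::nat) | b k. b \<in> B}"
    and \<theta>: "\<And>b k::nat. b \<in> B \<Longrightarrow> \<theta> (b \<otimes> x [^] k) = \<chi> b * z ^ k"
    "\<And>g h. g \<in> B' \<Longrightarrow> h \<in> B' \<Longrightarrow> \<theta> (g \<otimes> h) = \<theta> g * \<theta> h" "\<And>g. g \<notin> B' \<Longrightarrow> \<theta> g = 0"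
    by (rule extend_linear_character[OF finite_G B(1) H_carrier[OF x] linear_charsD(1)[OF \<chi>] one
          conj_H(1)[OF x _ B] conj_H(2)[OF x _ B \<chi>] m z]; (assumption | (rule that; assumption)))
  have Bc: "b \<in> carrier G" if "b \<in> B" for b using that B H_carrier by auto
  have sub: "B \<subseteq> B'"
  proof
    fix b assume "b \<in> B"
    then have "b = b \<otimes> x [^] (0::nat)" using Bc by simp
    then show "b \<in> B'" unfolding B'(2) using \<open>b \<in> B\<close> by blast
  qed
  have eq: "\<theta> b = \<chi> b" if "b \<in> B" for b
    using \<theta>(1)[OF that, of 0] that Bc by simp
  have x1: "x = \<one> \<otimes> x [^] (1::nat)" using H_carrier[OF x] by simp
  have oneB: "\<one> \<in> B" using B(1) by (rule subgroup.one_closed)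
  have xB': "x \<in> B'" unfolding B'(2) using x1 oneB by blast
  have \<theta>x: "\<theta> x = z" using \<theta>(1)[OF oneB, of 1] one H_carrier[OF x] by simp
  have B'H: "B' \<subseteq> H"
    unfolding B'(2) using B(3) subH subgroup_nat_pow_closed[OF subH x]
    by (auto intro!: subgroup.m_closed)
  have \<theta>N: "\<theta> g = 1" if "g \<in> N" for g
    using that eq B(2) linear_charsD(2)[OF \<chi>] by (metis subsetD)
  have "\<theta> \<in> linear_chars G B' N"
    unfolding linear_chars_def using \<theta>(2,3) \<theta>N by simp
  from that[OF B'(1) sub xB' B'H this eq \<theta>x] show ?thesis .
qed

text \<open>Roots exist in the multiplicative group of the complex numbers, so adjoining elements of
  \<open>H\<close> one at a time meets no obstruction; the induction runs on what is left of
  \<open>H\<close>.\<close>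

lemma extend_char:
  assumes "subgroup B G" "N \<subseteq> B" "B \<subseteq> H" "\<chi> \<in> linear_chars G B N"
  obtains \<theta> where "\<theta> \<in> linear_chars G H N" "\<And>b. b \<in> B \<Longrightarrow> \<theta> b = \<chi> b"
  using assms
proof (induction "card (H - B)" arbitrary: B \<chi> thesis rule: less_induct)
  case less
  show ?case
  proof (cases "B = H")
    case True
    then show ?thesis using less.prems by blast
  next
    case False
    then obtain x where x: "x \<in> H" "x \<notin> B" using less.prems by blast
    obtain m where m: "m > 0" "\<And>k::nat. x [^] k \<in> B \<longleftrightarrow> m dvd k"
      using power_in_subgroup_iff_dvd[OF finite_G less.prems(2) H_carrier[OF x(1)]] by metis
    obtain z where z: "z ^ m = \<chi> (x [^] m)" using complex_root_exists[OF m(1)] by metis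
    obtain B' \<theta> where B': "subgroup B' G" "B \<subseteq> B'" "x \<in> B'" "B' \<subseteq> H" "\<theta> \<in> linear_chars G B' N"
      "\<And>b. b \<in> B \<Longrightarrow> \<theta> b = \<chi> b" "\<theta> x = z"
      using extend_char_step[OF less.prems(2-5) x(1) m(2) z] by metis
    have "card (H - B') < card (H - B)"
      using B' x finite_H by (intro psubset_card_mono) auto
    moreover have "N \<subseteq> B'" using B' less.prems by auto
    ultimately obtain \<theta>' where "\<theta>' \<in> linear_chars G H N" "\<And>b. b \<in> B' \<Longrightarrow> \<theta>' b = \<theta> b"
      using less.hyps[of B' \<theta>] B' by metis
    then show ?thesis using less.prems(1)[of \<theta>'] B'(2,6) by (metis subsetD)
  qed
qed

text \<open>The trivial character of N extends to the group generated by N and x with value zeta_m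
  at x, where m > 1 is the order of x modulo N; from there it is extended to H.\<close>

lemma char_separates:
  assumes x: "x \<in> H" "x \<notin> N"
  obtains \<theta> where "\<theta> \<in> linear_chars G H N" "\<theta> x \<noteq> 1"
proof -
  define \<chi> :: "'a \<Rightarrow> complex" where "\<chi> = (\<lambda>g. if g \<in> N then 1 else 0)"
  have \<chi>: "\<chi> \<in> linear_chars G N N"
    using subN by (auto simp: linear_chars_def \<chi>_def subgroup.m_closed)
  obtain m where m: "m > 0" "\<And>k::nat. x [^] k \<in> N \<longleftrightarrow> m dvd k"
    using power_in_subgroup_iff_dvd[OF finite_G subN H_carrier[OF x(1)]] by metis
  have "m \<noteq> 1" using m(2)[of 1] x H_carrier by auto
  then have "m > 1" using m(1) by simp
  have z: "zeta m ^ m = \<chi> (x [^] m)" using m by (simp add: zeta_pow_self \<chi>_def)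
  obtain B' \<theta> where B': "subgroup B' G" "N \<subseteq> B'" "x \<in> B'" "B' \<subseteq> H" "\<theta> \<in> linear_chars G B' N"
     "\<theta> x = zeta m"
    using extend_char_step[OF subN order_refl N_H \<chi> x(1) m(2) z] by metis
  obtain \<theta>' where "\<theta>' \<in> linear_chars G H N" "\<And>b. b \<in> B' \<Longrightarrow> \<theta>' b = \<theta> b"
    using extend_char[OF B'(1,2,4,5)] by metis
  moreover have "zeta m \<noteq> 1" using zeta_pow_neq_1[of 1 m] \<open>m > 1\<close> by simp
  ultimately show ?thesis using that B' by metis
qed

text \<open>Column orthogonality: a character \<theta> with \<theta>(g) \<noteq> 1 permutes all
  characters by multiplication, so the sum equals \<theta>(g) times itself.\<close>

lemma sum_chars:
  assumes g: "g \<in> H"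
  shows "(\<Sum>\<chi>\<in>linear_chars G H N. \<chi> g) = (if g \<in> N then of_nat (card (linear_chars G H N)) else 0)"
proof (cases "g \<in> N")
  case True
  then show ?thesis by (simp add: linear_charsD(2)[of _ G H N])
next
  case False
  then obtain \<theta> where \<theta>: "\<theta> \<in> linear_chars G H N" "\<theta> g \<noteq> 1" using char_separates g by blast
  let ?C = "linear_chars G H N"
  have "bij_betw (\<lambda>\<chi> x. \<theta> x * \<chi> x) ?C ?C"
  proof (rule bij_betwI[where g = "\<lambda>\<chi> x. inverse (\<theta> x) * \<chi> x"])
    show "(\<lambda>\<chi> x. \<theta> x * \<chi> x) \<in> ?C \<rightarrow> ?C" using \<theta> char_mult by blast
    show "(\<lambda>\<chi> x. inverse (\<theta> x) * \<chi> x) \<in> ?C \<rightarrow> ?C" using char_mult[OF char_inverse[OF \<theta>(1)]] by blast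
    show "(\<lambda>x. inverse (\<theta> x) * (\<theta> x * \<chi> x)) = \<chi>" if "\<chi> \<in> ?C" for \<chi>
      using char_nonzero[OF \<theta>(1)] linear_charsD(3)[OF that] by (intro ext) (metis mult.assoc left_inverse mult_1 mult_zero_right)
    show "(\<lambda>x. \<theta> x * (inverse (\<theta> x) * \<chi> x)) = \<chi>" if "\<chi> \<in> ?C" for \<chi>
      using char_nonzero[OF \<theta>(1)] linear_charsD(3)[OF that] by (intro ext) (metis mult.assoc right_inverse mult_1 mult_zero_right)
  qed
  then have "(\<Sum>\<chi>\<in>?C. \<chi> g) = (\<Sum>\<chi>\<in>?C. \<theta> g * \<chi> g)"
    using sum.reindex_bij_betw[of _ ?C ?C "\<lambda>\<chi>. \<chi> g", symmetric] by simp
  also have "\<dots> = \<theta> g * (\<Sum>\<chi>\<in>?C. \<chi> g)" by (rule sum_distrib_left[symmetric])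
  finally have "(\<Sum>\<chi>\<in>?C. \<chi> g) = \<theta> g * (\<Sum>\<chi>\<in>?C. \<chi> g)" .
  then show ?thesis using \<theta>(2) False by simp
qed

lemma sum_char:
  assumes \<chi>: "\<chi> \<in> linear_chars G H N"
  shows "(\<Sum>h\<in>H. \<chi> h) = (if \<forall>h\<in>H. \<chi> h = 1 then of_nat (card H) else 0)"
proof (cases "\<forall>h\<in>H. \<chi> h = 1")
  case False
  then obtain g where g: "g \<in> H" "\<chi> g \<noteq> 1" by blast
  have "bij_betw (\<lambda>h. g \<otimes> h) H H"
    using g subH H_carrier
    by (intro bij_betwI[where g = "\<lambda>h. inv g \<otimes> h"])
       (auto simp: subgroup.m_closed subgroup.m_inv_closed m_assoc[symmetric])
  then have "(\<Sum>h\<in>H. \<chi> h) = (\<Sum>h\<in>H. \<chi> (g \<otimes> h))"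
    by (intro sum.reindex_bij_betw[symmetric])
  also have "\<dots> = \<chi> g * (\<Sum>h\<in>H. \<chi> h)" using g \<chi> by (simp add: linear_charsD sum_distrib_left)
  finally show ?thesis using g False by auto
qed simp

text \<open>Evaluate the double sum of \<open>\<chi> (h [^] m)\<close> over all \<open>\<chi>\<close> and \<open>h\<close> in both orders.\<close>
lemma card_linear_chars_torsion:
  assumes "m > 0"
  shows "card {\<chi> \<in> linear_chars G H N. \<forall>h\<in>H. \<chi> h ^ m = 1} * card H
    = card (linear_chars G H N) * card {h \<in> H. h [^] m \<in> N}"
proof -
  let ?C = "linear_chars G H N"
  have "(\<Sum>\<chi>\<in>?C. \<Sum>h\<in>H. \<chi> h ^ m) = (\<Sum>\<chi>\<in>?C. if \<forall>h\<in>H. \<chi> h ^ m = 1 then of_nat (card H) else 0)"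
    using sum_char[OF char_power[OF _ assms]] by (intro sum.cong refl) simp
  also have "\<dots> = of_nat (card {\<chi> \<in> ?C. \<forall>h\<in>H. \<chi> h ^ m = 1} * card H)"
    by (subst sum.inter_filter[symmetric]) (simp_all add: finite_linear_chars)
  finally have 1: "(\<Sum>\<chi>\<in>?C. \<Sum>h\<in>H. \<chi> h ^ m) = of_nat (card {\<chi> \<in> ?C. \<forall>h\<in>H. \<chi> h ^ m = 1} * card H)" .
  have "(\<Sum>\<chi>\<in>?C. \<Sum>h\<in>H. \<chi> h ^ m) = (\<Sum>h\<in>H. \<Sum>\<chi>\<in>?C. \<chi> (h [^] m))"
    by (subst sum.swap) (intro sum.cong refl, simp add: char_pow)
  also have "\<dots> = (\<Sum>h\<in>H. if h [^] m \<in> N then of_nat (card ?C) else 0)"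
    using subgroup_nat_pow_closed[OF subH] by (intro sum.cong refl sum_chars) auto
  also have "\<dots> = of_nat (card ?C * card {h \<in> H. h [^] m \<in> N})"
    by (subst sum.inter_filter[symmetric]) (simp_all add: finite_H mult.commute)
  finally have "of_nat (card {\<chi> \<in> ?C. \<forall>h\<in>H. \<chi> h ^ m = 1} * card H)
      = (of_nat (card ?C * card {h \<in> H. h [^] m \<in> N}) :: complex)"
    by (simp only: 1[symmetric])
  then show ?thesis by (simp only: of_nat_eq_iff)
qed

text \<open>The torsion count for m = 1, where only the trivial character remains on one side and
  only N on the other.\<close>

lemma card_linear_chars: "card (linear_chars G H N) * card N = card H"
proof -
  let ?C = "linear_chars G H N"
  define \<epsilon> :: "'a \<Rightarrow> complex" where "\<epsilon> = (\<lambda>h. if h \<in> H then 1 else 0)"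
  have \<epsilon>: "\<epsilon> \<in> ?C" using subH N_H by (auto simp: linear_chars_def \<epsilon>_def subgroup.m_closed)
  have "{\<chi> \<in> ?C. \<forall>h\<in>H. \<chi> h ^ 1 = 1} = {\<epsilon>}"
  proof (intro equalityI subsetI)
    fix \<chi> assume "\<chi> \<in> {\<chi> \<in> ?C. \<forall>h\<in>H. \<chi> h ^ 1 = 1}"
    then have "\<chi> = \<epsilon>" by (intro ext) (auto simp: \<epsilon>_def linear_charsD)
    then show "\<chi> \<in> {\<epsilon>}" by simp
  qed (use \<epsilon> in \<open>auto simp: \<epsilon>_def\<close>)
  moreover have "{h \<in> H. h [^] (1::nat) \<in> N} = N" using N_H H_carrier by auto
  ultimately show ?thesis using card_linear_chars_torsion[of 1] by simp
qed

text \<open>Cancelling the number of characters leaves the duality of torsion counts, |{\<chi> :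
  \<chi>^m = 1}| = |{x in H/N : x^m = 1}|; the factor \<open>card N\<close> turns cosets into
  elements of H.\<close>

lemma card_linear_chars_torsion_mult:
  assumes "m > 0"
  shows "card {\<chi> \<in> linear_chars G H N. \<forall>h\<in>H. \<chi> h ^ m = 1} * card N = card {h \<in> H. h [^] m \<in> N}"
proof -
  let ?C = "linear_chars G H N"
  have "card ?C * card N \<noteq> 0" using card_linear_chars finite_H one_H by auto
  then have "card ?C > 0" by simp
  have "card ?C * (card {\<chi> \<in> ?C. \<forall>h\<in>H. \<chi> h ^ m = 1} * card N)
      = card {\<chi> \<in> ?C. \<forall>h\<in>H. \<chi> h ^ m = 1} * (card ?C * card N)" by (rule mult.left_commute)
  also have "\<dots> = card {\<chi> \<in> ?C. \<forall>h\<in>H. \<chi> h ^ m = 1} * card H" by (simp only: card_linear_chars)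
  also have "\<dots> = card ?C * card {h \<in> H. h [^] m \<in> N}" by (rule card_linear_chars_torsion[OF assms])
  finally show ?thesis by (simp only: nat_mult_eq_cancel1[OF \<open>card ?C > 0\<close>])
qed

end

section \<open>Induced representations over cyclotomic fields\<close>

definition cyclo_rep :: "('g, 'b) monoid_scheme \<Rightarrow> nat \<Rightarrow> nat \<Rightarrow> ('g \<Rightarrow> nat \<times> nat \<Rightarrow> complex) \<Rightarrow> bool" where
  "cyclo_rep G k m \<rho> \<longleftrightarrow> (\<forall>g\<in>carrier G. \<rho> g \<in> carrier (cyclo_matrix_ring k m)) \<and>
     (\<forall>g\<in>carrier G. \<forall>h\<in>carrier G. \<rho> (g \<otimes>\<^bsub>G\<^esub> h) = \<rho> g \<otimes>\<^bsub>cyclo_matrix_ring k m\<^esub> \<rho> h) \<and>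
     \<rho> \<one>\<^bsub>G\<^esub> = \<one>\<^bsub>cyclo_matrix_ring k m\<^esub>"

section \<open>Induction of linear characters and commutator identities\<close>

context group
begin

text \<open>Here \<open>t\<close> is a left transversal of M, and \<theta> is zero outside M. Each
  matrix is monomial, and its entries stay in the field containing the values of \<theta>.\<close>

lemma induced_rep:
  fixes \<theta> :: "'a \<Rightarrow> complex"
  assumes M: "subgroup M G" and hom: "\<And>g h. g \<in> M \<Longrightarrow> h \<in> M \<Longrightarrow> \<theta> (g \<otimes> h) = \<theta> g * \<theta> h"
    and zero: "\<And>g. g \<notin> M \<Longrightarrow> \<theta> g = 0" and one: "\<theta> \<one> = 1"
    and cyclo: "\<And>g. g \<in> M \<Longrightarrow> \<theta> g \<in> cyclotomic_field m"
    and t: "\<And>i. i < q \<Longrightarrow> t i \<in> carrier G"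
    and ex: "\<And>g. g \<in> carrier G \<Longrightarrow> \<exists>i<q. \<exists>h\<in>M. g = t i \<otimes> h"
    and uniq: "\<And>i j. i < q \<Longrightarrow> j < q \<Longrightarrow> inv (t i) \<otimes> t j \<in> M \<Longrightarrow> i = j"
  shows "cyclo_rep G q m (\<lambda>g (i, j). if i < q \<and> j < q then \<theta> (inv (t i) \<otimes> g \<otimes> t j) else 0)"
    (is "cyclo_rep G q m ?\<rho>")
proof -
  have Mc: "h \<in> carrier G" if "h \<in> M" for h using M that by (rule subgroup.mem_carrier)
  have mem: "g \<in> M" if "g \<otimes> h \<in> M" "h \<in> M" "g \<in> carrier G" for g h
  proof -
    have "(g \<otimes> h) \<otimes> inv h \<in> M"
      using subgroup.m_closed[OF M that(1) subgroup.m_inv_closed[OF M that(2)]] .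
    then show ?thesis using that Mc by (simp add: m_assoc)
  qed
  have mult: "\<theta> (g \<otimes> h) = \<theta> g * \<theta> h" if "h \<in> M" "g \<in> carrier G" for g h
  proof (cases "g \<in> M")
    case False
    then have "g \<otimes> h \<notin> M" using mem that by blast
    then show ?thesis using False by (simp add: zero)
  qed (use that hom in simp)
  have prod: "\<theta> (inv (t i) \<otimes> (g \<otimes> h) \<otimes> t j) = (\<Sum>k<q. \<theta> (inv (t i) \<otimes> g \<otimes> t k) * \<theta> (inv (t k) \<otimes> h \<otimes> t j))"
    if gh: "g \<in> carrier G" "h \<in> carrier G" and ij: "i < q" "j < q" for g h i j
  proof -
    \<comment> \<open>The coset of h t_j singles out the one index k that contributes to the matrix
      product.\<close>
    obtain k u where k: "k < q" "u \<in> M" "h \<otimes> t j = t k \<otimes> u"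
      using ex[of "h \<otimes> t j"] gh t[OF ij(2)] by auto
    have c: "t i \<in> carrier G" "t j \<in> carrier G" "t k \<in> carrier G" "u \<in> carrier G"
      using t ij k Mc by auto
    have u: "inv (t k) \<otimes> h \<otimes> t j = u" using c gh k(3) by (simp add: m_assoc[symmetric] inv_solve_left' m_assoc)
    have other: "\<theta> (inv (t l) \<otimes> h \<otimes> t j) = 0" if "l < q" "l \<noteq> k" for l
    proof (rule zero, rule notI)
      assume "inv (t l) \<otimes> h \<otimes> t j \<in> M"
      moreover have "inv (t l) \<otimes> h \<otimes> t j = (inv (t l) \<otimes> t k) \<otimes> u"
        using c gh k(3) t[OF that(1)] by (simp add: m_assoc)
      ultimately have "inv (t l) \<otimes> t k \<in> M" using mem[of "inv (t l) \<otimes> t k" u] k(2) c t[OF that(1)] by simp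
      then show False using uniq[of l k] that k(1) by simp
    qed
    have "(\<Sum>l<q. \<theta> (inv (t i) \<otimes> g \<otimes> t l) * \<theta> (inv (t l) \<otimes> h \<otimes> t j))
        = (\<Sum>l\<in>{k}. \<theta> (inv (t i) \<otimes> g \<otimes> t l) * \<theta> (inv (t l) \<otimes> h \<otimes> t j))"
      using k(1) other by (intro sum.mono_neutral_right) auto
    also have "\<dots> = \<theta> (inv (t i) \<otimes> g \<otimes> t k) * \<theta> u" using u by simp
    also have "\<dots> = \<theta> ((inv (t i) \<otimes> g \<otimes> t k) \<otimes> u)" using c gh k(2) by (intro mult[symmetric]) auto
    also have "(inv (t i) \<otimes> g \<otimes> t k) \<otimes> u = inv (t i) \<otimes> (g \<otimes> h) \<otimes> t j"
      using c gh k(3) by (simp add: m_assoc)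
    finally show ?thesis by simp
  qed
  have idm: "\<theta> (inv (t i) \<otimes> \<one> \<otimes> t j) = (if i = j then 1 else 0)" if "i < q" "j < q" for i j
    using that t one uniq zero[of "inv (t i) \<otimes> t j"] by auto
  have field: "\<theta> g \<in> cyclotomic_field m" for g
    using cyclo zero zero_in_cyclotomic_field by (cases "g \<in> M") auto
  show ?thesis
    unfolding cyclo_rep_def
  proof (intro conjI ballI)
    fix g h assume gh: "g \<in> carrier G" "h \<in> carrier G"
    show "?\<rho> g \<in> carrier (cyclo_matrix_ring q m)" by (auto simp: cyclo_matrix_ring_def field)
    show "?\<rho> (g \<otimes> h) = ?\<rho> g \<otimes>\<^bsub>cyclo_matrix_ring q m\<^esub> ?\<rho> h"
      using prod[OF gh] by (auto simp: cyclo_matrix_ring_def fun_eq_iff)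
  next
    show "?\<rho> \<one> = \<one>\<^bsub>cyclo_matrix_ring q m\<^esub>"
      using idm by (auto simp: cyclo_matrix_ring_def fun_eq_iff)
  qed
qed

lemma comm_closed: "g \<in> carrier G \<Longrightarrow> h \<in> carrier G \<Longrightarrow> comm G g h \<in> carrier G"
  by (simp add: comm_def)

lemma comm_inverse:
  assumes "g \<in> carrier G" "h \<in> carrier G"
  shows "comm G h g = inv (comm G g h)"
  using assms by (simp add: comm_def inv_mult_group m_assoc)

lemma comm_self: "g \<in> carrier G \<Longrightarrow> comm G g g = \<one>"
  by (simp add: comm_def m_assoc)

lemma comm_eq_one_iff:
  assumes "g \<in> carrier G" "h \<in> carrier G"
  shows "comm G g h = \<one> \<longleftrightarrow> g \<otimes> h = h \<otimes> g"
proof -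
  have "comm G g h = inv (h \<otimes> g) \<otimes> (g \<otimes> h)" using assms by (simp add: comm_def inv_mult_group m_assoc)
  then show ?thesis using assms by (metis inv_closed inv_equality inv_inv l_inv m_closed)
qed

lemma mult_comm:
  assumes "g \<in> carrier G" "h \<in> carrier G"
  shows "g \<otimes> h = h \<otimes> g \<otimes> comm G g h" and "inv h \<otimes> g \<otimes> h = g \<otimes> comm G g h"
  using assms by (simp_all add: comm_def m_assoc[symmetric]) (simp add: m_assoc)

lemma comm_mult_left:
  assumes c: "g \<in> carrier G" "g' \<in> carrier G" "h \<in> carrier G"
    and central: "comm G g h \<otimes> inv g' = inv g' \<otimes> comm G g h"
  shows "comm G (g \<otimes> g') h = comm G g h \<otimes> comm G g' h"
proof -
  have "comm G (g \<otimes> g') h = inv g' \<otimes> comm G g h \<otimes> (inv h \<otimes> g' \<otimes> h)"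
    using c by (simp add: comm_def inv_mult_group m_assoc)
       (simp add: m_assoc[symmetric])
  also have "\<dots> = comm G g h \<otimes> (inv g' \<otimes> (inv h \<otimes> g' \<otimes> h))"
    using c by (simp only: central[symmetric]) (simp add: m_assoc comm_closed)
  also have "inv g' \<otimes> (inv h \<otimes> g' \<otimes> h) = comm G g' h"
    using c by (simp add: comm_def m_assoc)
  finally show ?thesis .
qed

end

text \<open>The abstract form of a fully ramified character: (g, h) |-> \<psi>([g, h]) is an
  alternating pairing with radical H, the group G/H is generated by x and y, and the value at (x, y)
  has exact order q, so G/H is a product of two cyclic groups of order q. The normalisation
  \<psi>(y^q) = 1 keeps the induced representation over Q(zeta_m).\<close>

locale symplectic_pair = group G for G (structure) +
  fixes H :: "'a set" and \<psi> :: "'a \<Rightarrow> complex" and x y :: 'a and q m :: nat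
  assumes finite_G: "finite (carrier G)" and subH: "subgroup H G"
    and comm_H: "\<And>g h. g \<in> carrier G \<Longrightarrow> h \<in> carrier G \<Longrightarrow> comm G g h \<in> H"
    and comm_central: "\<And>g h k. g \<in> carrier G \<Longrightarrow> h \<in> carrier G \<Longrightarrow> k \<in> carrier G \<Longrightarrow>
          comm G g h \<otimes> k = k \<otimes> comm G g h"
    and \<psi>_mult: "\<And>g h. g \<in> H \<Longrightarrow> h \<in> H \<Longrightarrow> \<psi> (g \<otimes> h) = \<psi> g * \<psi> h"
    and \<psi>_one: "\<psi> \<one> = 1" and \<psi>_zero: "\<And>g. g \<notin> H \<Longrightarrow> \<psi> g = 0"
    and m_pos: "m > 0" and \<psi>_root: "\<And>h. h \<in> H \<Longrightarrow> \<psi> h ^ m = 1"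
    and radical: "\<And>g. g \<in> carrier G \<Longrightarrow> g \<in> H \<longleftrightarrow> (\<forall>h\<in>carrier G. \<psi> (comm G g h) = 1)"
    and x: "x \<in> carrier G" and y: "y \<in> carrier G"
    and yq: "y [^] q \<in> H" "\<psi> (y [^] q) = 1"
    and q_pos: "q > 0" and eps: "\<And>k. \<psi> (comm G x y) ^ k = 1 \<longleftrightarrow> q dvd k"
    and decomp: "\<And>g. g \<in> carrier G \<Longrightarrow> \<exists>(i::nat) (j::nat). \<exists>h\<in>H. g = x [^] i \<otimes> (y [^] j \<otimes> h)"
begin

text \<open>The commutator pairing; not the exponent \<beta> of the theorem.\<close>

definition \<beta> :: "'a \<Rightarrow> 'a \<Rightarrow> complex" where "\<beta> g h = \<psi> (comm G g h)"

lemma H_carrier: "h \<in> H \<Longrightarrow> h \<in> carrier G"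
  using subH by (rule subgroup.mem_carrier)

lemma \<beta>_mult_left:
  assumes "g \<in> carrier G" "g' \<in> carrier G" "h \<in> carrier G"
  shows "\<beta> (g \<otimes> g') h = \<beta> g h * \<beta> g' h"
  using assms by (simp add: \<beta>_def comm_mult_left comm_central \<psi>_mult comm_H)

lemma \<beta>_inverse:
  assumes "g \<in> carrier G" "h \<in> carrier G"
  shows "\<beta> g h * \<beta> h g = 1"
proof -
  have "comm G g h \<otimes> comm G h g = \<one>"
    using assms by (simp add: comm_inverse[of g h] comm_closed)
  then show ?thesis using assms by (simp add: \<beta>_def \<psi>_mult[symmetric] comm_H \<psi>_one)
qed

lemma \<beta>_nonzero: "g \<in> carrier G \<Longrightarrow> h \<in> carrier G \<Longrightarrow> \<beta> g h \<noteq> 0"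
  using \<beta>_inverse by fastforce

lemma \<beta>_mult_right:
  assumes "g \<in> carrier G" "h \<in> carrier G" "h' \<in> carrier G"
  shows "\<beta> g (h \<otimes> h') = \<beta> g h * \<beta> g h'"
proof -
  have "\<beta> g (h \<otimes> h') * \<beta> (h \<otimes> h') g = (\<beta> g h * \<beta> h g) * (\<beta> g h' * \<beta> h' g)"
    using assms by (simp add: \<beta>_inverse)
  also have "\<dots> = (\<beta> g h * \<beta> g h') * \<beta> (h \<otimes> h') g"
    using assms by (simp add: \<beta>_mult_left)
  finally show ?thesis using \<beta>_nonzero[of "h \<otimes> h'" g] assms by simp
qed

lemma \<beta>_pow_left:
  assumes "g \<in> carrier G" "h \<in> carrier G"
  shows "\<beta> (g [^] (k::nat)) h = \<beta> g h ^ k"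
proof (induction k)
  case 0
  have "comm G \<one> h = \<one>" using assms by (simp add: comm_def)
  then show ?case by (simp add: \<beta>_def \<psi>_one)
next
  case (Suc k)
  then show ?case using assms by (simp add: \<beta>_mult_left)
qed

lemma \<beta>_pow_right:
  assumes "g \<in> carrier G" "h \<in> carrier G"
  shows "\<beta> g (h [^] (k::nat)) = \<beta> g h ^ k"
proof (induction k)
  case 0
  have "comm G g \<one> = \<one>" using assms by (simp add: comm_def)
  then show ?case by (simp add: \<beta>_def \<psi>_one)
next
  case (Suc k)
  then show ?case using assms by (simp add: \<beta>_mult_right)
qed

lemma \<beta>_self: "g \<in> carrier G \<Longrightarrow> \<beta> g g = 1"
  by (simp add: \<beta>_def comm_self \<psi>_one)

lemma \<beta>_H_left: "g \<in> H \<Longrightarrow> h \<in> carrier G \<Longrightarrow> \<beta> g h = 1"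
  using radical[of g] H_carrier[of g] by (simp add: \<beta>_def)

lemma \<beta>_H_right: "g \<in> carrier G \<Longrightarrow> h \<in> H \<Longrightarrow> \<beta> g h = 1"
  using \<beta>_inverse[of g h] \<beta>_H_left H_carrier by simp

lemma H_if_orthogonal:
  assumes g: "g \<in> carrier G" and gx: "\<beta> g x = 1" and gy: "\<beta> g y = 1"
  shows "g \<in> H"
  unfolding radical[OF g]
proof
  fix h assume "h \<in> carrier G"
  then obtain i j :: nat and u where u: "u \<in> H" "h = x [^] i \<otimes> (y [^] j \<otimes> u)" using decomp by blast
  then have "\<beta> g h = 1"
    using g x y gx gy H_carrier by (simp add: \<beta>_mult_right \<beta>_pow_right \<beta>_H_right)
  then show "\<psi> (comm G g h) = 1" by (simp add: \<beta>_def)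
qed

lemma \<beta>_xy: "\<beta> x y ^ k = 1 \<longleftrightarrow> q dvd k"
  using eps by (simp add: \<beta>_def)

lemma xq: "x [^] q \<in> H"
  using x y \<beta>_xy[of q] by (intro H_if_orthogonal) (simp_all add: \<beta>_pow_left \<beta>_self)

lemma y_pow_H: "y [^] k \<in> H \<longleftrightarrow> q dvd k"
proof
  assume "y [^] k \<in> H"
  then have "\<beta> x y ^ k = 1" using \<beta>_H_right[of x "y [^] k"] x y by (simp add: \<beta>_pow_right)
  then show "q dvd k" by (simp add: \<beta>_xy)
next
  assume "q dvd k"
  then obtain t where "k = q * t" by blast
  then have "y [^] k = (y [^] q) [^] t" using y by (simp add: nat_pow_pow)
  then show "y [^] k \<in> H" using yq subgroup_nat_pow_closed[OF subH] by simp
qed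

lemma conj_H:
  assumes "b \<in> H"
  shows "y \<otimes> b \<otimes> inv y \<in> H" and "\<psi> (y \<otimes> b \<otimes> inv y) = \<psi> b"
proof -
  have b: "b \<in> carrier G" "inv b \<in> H" using assms H_carrier subH by (auto simp: subgroup.m_inv_closed)
  have eq: "y \<otimes> b \<otimes> inv y = comm G (inv y) (inv b) \<otimes> b"
    using b y by (simp add: comm_def m_assoc)
  have 1: "comm G (inv y) (inv b) \<in> H" using b y by (simp add: comm_H)
  have 2: "\<psi> (comm G (inv y) (inv b)) = 1" using \<beta>_H_right[of "inv y" "inv b"] b y by (simp add: \<beta>_def)
  show "y \<otimes> b \<otimes> inv y \<in> H" using eq 1 assms subH by (simp add: subgroup.m_closed)
  show "\<psi> (y \<otimes> b \<otimes> inv y) = \<psi> b" using eq 1 2 assms by (simp add: \<psi>_mult)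
qed

text \<open>The subgroup generated by \<open>H\<close> and \<open>y\<close> is maximal isotropic for \<open>\<beta>\<close>; the representation is induced
  from the extension of \<open>\<psi>\<close> to it that takes the value 1 at \<open>y\<close>.\<close>
lemma rep_exists:
  "\<exists>\<rho>. cyclo_rep G q m \<rho> \<and> (\<forall>g\<in>carrier G. (\<Sum>i<q. \<rho> g (i, i)) = of_nat q * \<psi> g)"
proof -
  obtain M \<theta> where M: "subgroup M G" "M = {b \<otimes> y [^] (k::nat) | b k. b \<in> H}"
    and \<theta>: "\<And>b k::nat. b \<in> H \<Longrightarrow> \<theta> (b \<otimes> y [^] k) = \<psi> b * 1 ^ k"
      "\<And>g h. g \<in> M \<Longrightarrow> h \<in> M \<Longrightarrow> \<theta> (g \<otimes> h) = \<theta> g * \<theta> h"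
      "\<And>g. g \<notin> M \<Longrightarrow> \<theta> g = 0"
  proof (rule extend_linear_character[OF finite_G subH y \<psi>_mult \<psi>_one conj_H y_pow_H])
    show "1 ^ q = \<psi> (y [^] q)" using yq by simp
  qed (assumption | (rule that; assumption))+
  have HM: "h \<in> M" and \<theta>H: "\<theta> h = \<psi> h" if "h \<in> H" for h
  proof -
    have "h = h \<otimes> y [^] (0::nat)" using that H_carrier by simp
    then show "h \<in> M" using that unfolding M(2) by blast
    show "\<theta> h = \<psi> h" using \<theta>(1)[OF that, of 0] that H_carrier by simp
  qed
  have yM: "y [^] k \<in> M" for k :: nat
  proof -
    have "y [^] k = \<one> \<otimes> y [^] k" using y by simp
    then show ?thesis using subgroup.one_closed[OF subH] unfolding M(2) by blast
  qed
  \<comment> \<open>\<open>M\<close> is the orthogonal complement of y: for g = x^i y^j u the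
    pairing with y sees only x, through \<beta>(x, y)^i, and q dividing i puts x^i into H.\<close>
  have M_iff: "g \<in> M \<longleftrightarrow> \<beta> g y = 1" if g: "g \<in> carrier G" for g
  proof
    assume "g \<in> M"
    then obtain b and k :: nat where "b \<in> H" "g = b \<otimes> y [^] k" unfolding M(2) by blast
    then show "\<beta> g y = 1" using y H_carrier by (simp add: \<beta>_mult_left \<beta>_pow_left \<beta>_self \<beta>_H_left)
  next
    assume a: "\<beta> g y = 1"
    obtain i j :: nat and u where u: "u \<in> H" "g = x [^] i \<otimes> (y [^] j \<otimes> u)" using decomp[OF g] by blast
    then have "\<beta> x y ^ i = 1"
      using a x y H_carrier by (simp add: \<beta>_mult_left \<beta>_pow_left \<beta>_self \<beta>_H_left)
    then obtain t where "i = q * t" using \<beta>_xy by blast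
    then have "x [^] i = (x [^] q) [^] t" using x by (simp add: nat_pow_pow)
    then have "x [^] i \<in> H" using xq subgroup_nat_pow_closed[OF subH] by simp
    then show "g \<in> M" using u HM yM M(1) by (simp add: subgroup.m_closed)
  qed
  \<comment> \<open>Distinct powers of x below q are separated modulo M by the pairing with y, so
    they form a transversal.\<close>
  define t where "t = (\<lambda>i::nat. x [^] i)"
  define \<rho> where "\<rho> = (\<lambda>g (i, j). if i < q \<and> j < q then \<theta> (inv (t i) \<otimes> g \<otimes> t j) else 0)"
  have tc: "t i \<in> carrier G" for i using x by (simp add: t_def)
  have rep: "cyclo_rep G q m \<rho>"
    unfolding \<rho>_def
  proof (rule induced_rep[OF M(1) \<theta>(2,3)])
    show "\<theta> \<one> = 1" using \<theta>H[of \<one>] subH \<psi>_one by (simp add: subgroup.one_closed)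
    show "\<theta> g \<in> cyclotomic_field m" if "g \<in> M" for g
    proof -
      obtain b and k :: nat where "b \<in> H" "g = b \<otimes> y [^] k" using \<open>g \<in> M\<close> unfolding M(2) by blast
      then show ?thesis using root_of_unity_in_cyclotomic_field[OF m_pos \<psi>_root] \<theta>(1) by simp
    qed
    show "t i \<in> carrier G" for i by (rule tc)
    show "\<exists>i<q. \<exists>h\<in>M. g = t i \<otimes> h" if g: "g \<in> carrier G" for g
    proof -
      obtain i j :: nat and u where u: "u \<in> H" "g = x [^] i \<otimes> (y [^] j \<otimes> u)" using decomp[OF g] by blast
      have "x [^] i = x [^] (i mod q + q * (i div q))" by simp
      also have "\<dots> = x [^] (i mod q) \<otimes> (x [^] q) [^] (i div q)"
        using x by (simp only: nat_pow_mult[symmetric] nat_pow_pow)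
      finally have "g = t (i mod q) \<otimes> ((x [^] q) [^] (i div q) \<otimes> (y [^] j \<otimes> u))"
        using u x y H_carrier by (simp add: m_assoc t_def)
      moreover have "(x [^] q) [^] (i div q) \<otimes> (y [^] j \<otimes> u) \<in> M"
        using xq subgroup_nat_pow_closed[OF subH] HM u yM M(1) by (simp add: subgroup.m_closed)
      moreover have "i mod q < q" using q_pos by simp
      ultimately show ?thesis by blast
    qed
    have lt: "False" if "i < j" "j < q" "\<beta> x y ^ i = \<beta> x y ^ j" for i j
    proof -
      have "\<beta> x y ^ j = \<beta> x y ^ (i + (j - i))" using that by simp
      then have "\<beta> x y ^ j = \<beta> x y ^ i * \<beta> x y ^ (j - i)" by (simp only: power_add)
      then have "\<beta> x y ^ (j - i) = 1" using that \<beta>_nonzero[OF x y] by simp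
      then show False using that \<beta>_xy by (auto dest: dvd_imp_le)
    qed
    show "i = j" if ij: "i < q" "j < q" "inv (t i) \<otimes> t j \<in> M" for i j
    proof -
      have "\<beta> (t i \<otimes> (inv (t i) \<otimes> t j)) y = \<beta> (t i) y * \<beta> (inv (t i) \<otimes> t j) y"
        using tc y by (intro \<beta>_mult_left) auto
      moreover have "\<beta> (inv (t i) \<otimes> t j) y = 1" using ij(3) M_iff tc by simp
      moreover have "t i \<otimes> (inv (t i) \<otimes> t j) = t j" using tc by (simp add: m_assoc[symmetric])
      ultimately have "\<beta> x y ^ i = \<beta> x y ^ j" using x y by (simp add: t_def \<beta>_pow_left)
      then show ?thesis using lt[of i j] lt[of j i] ij by (cases i j rule: linorder_cases) auto
    qed
  qed
  have trace: "(\<Sum>i<q. \<rho> g (i, i)) = of_nat q * \<psi> g" if g: "g \<in> carrier G" for g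
  proof -
    \<comment> \<open>Conjugating g by x^i multiplies it by [g, x^i], so the diagonal entries form a
      geometric progression with ratio \<beta>(g, x).\<close>
    have "\<rho> g (i, i) = \<theta> g * \<beta> g x ^ i" if "i < q" for i
    proof -
      have c: "comm G g (t i) \<in> H" using g tc by (simp add: comm_H)
      have "inv (t i) \<otimes> g \<otimes> t i = g \<otimes> comm G g (t i)" using mult_comm(2)[OF g tc] .
      moreover have "\<theta> (g \<otimes> comm G g (t i)) = \<theta> g * \<theta> (comm G g (t i))"
      proof (cases "g \<in> M")
        case False
        have "g \<otimes> comm G g (t i) \<notin> M"
        proof
          assume "g \<otimes> comm G g (t i) \<in> M"
          then have "(g \<otimes> comm G g (t i)) \<otimes> inv (comm G g (t i)) \<in> M"
            using HM[OF c] M(1) by (simp add: subgroup.m_closed subgroup.m_inv_closed)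
          then show False using False g tc c H_carrier by (simp add: m_assoc)
        qed
        then show ?thesis using False \<theta>(3) by simp
      qed (use \<theta>(2) HM[OF c] in simp)
      moreover have "\<theta> (comm G g (t i)) = \<beta> g x ^ i"
        using \<theta>H[OF c] \<beta>_pow_right[OF g x, of i] by (simp add: \<beta>_def t_def)
      ultimately show ?thesis using that by (simp add: \<rho>_def)
    qed
    then have eq: "(\<Sum>i<q. \<rho> g (i, i)) = \<theta> g * (\<Sum>i<q. \<beta> g x ^ i)" by (simp add: sum_distrib_left)
    consider "g \<in> H" | "g \<notin> M" | "g \<in> M" "g \<notin> H" by blast
    then show ?thesis
    proof cases
      case 1
      then show ?thesis using eq \<theta>H \<beta>_H_left x by simp
    next
      case 2
      then show ?thesis using eq \<theta>(3) HM \<psi>_zero by auto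
    next
      \<comment> \<open>An element of M outside H is orthogonal to y, hence not to x, and the full
        sum of powers of a nontrivial q-th root of unity vanishes.\<close>
      case 3
      then have "\<beta> g y = 1" using M_iff g by simp
      then have "\<beta> g x \<noteq> 1" using H_if_orthogonal g 3 by blast
      moreover have "\<beta> g x ^ q = 1" using \<beta>_pow_right[OF g x, of q] \<beta>_H_right[OF g xq] by simp
      ultimately have "(\<Sum>i<q. \<beta> g x ^ i) = 0" by (intro sum_powers_root_of_unity)
      then show ?thesis using eq \<psi>_zero 3 by simp
    qed
  qed
  show ?thesis using rep trace by blast
qed

end

section \<open>Decomposing the group algebra by a faithful family\<close>

definition linear_extension :: "('g, 'b) monoid_scheme \<Rightarrow> ('g \<Rightarrow> nat \<times> nat \<Rightarrow> complex) \<Rightarrow> ('g \<Rightarrow> rat) \<Rightarrow> nat \<times> nat \<Rightarrow> complex" where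
  "linear_extension G \<rho> f = (\<lambda>ij. \<Sum>g\<in>carrier G. of_rat (f g) * \<rho> g ij)"

lemma sum_fun_apply: "(\<Sum>x\<in>A. f x) y = (\<Sum>x\<in>A. f x y)"
  for f :: "'a \<Rightarrow> 'b \<Rightarrow> 'c :: comm_monoid_add"
  by (induction A rule: infinite_finite_induct) auto

lemma (in group) linear_extension_ring_hom:
  assumes fin: "finite (carrier G)" and rep: "cyclo_rep G k m \<rho>"
  shows "linear_extension G \<rho> \<in> ring_hom (group_algebra_Q G) (cyclo_matrix_ring k m)"
proof (rule ring_hom_memI)
  let ?R = "group_algebra_Q G" and ?S = "cyclo_matrix_ring k m"
  have \<rho>: "\<rho> g \<in> carrier ?S" "\<And>h. h \<in> carrier G \<Longrightarrow> \<rho> (g \<otimes> h) = \<rho> g \<otimes>\<^bsub>?S\<^esub> \<rho> h" if "g \<in> carrier G" for g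
    using rep that by (auto simp: cyclo_rep_def)
  have \<rho>_ij: "\<rho> g (i, j) = 0" if "g \<in> carrier G" "\<not> (i < k \<and> j < k)" for g i j
    using \<rho>(1)[OF that(1)] that(2) by (auto simp: cyclo_matrix_ring_def)
  fix f h assume f: "f \<in> carrier ?R"
  show "linear_extension G \<rho> f \<in> carrier ?S"
    using \<rho>(1) \<rho>_ij
    by (auto simp: cyclo_matrix_ring_def linear_extension_def intro!: cyclotomic_field_sum cyclotomic_field_scale sum.neutral)
  assume h: "h \<in> carrier ?R"
  show "linear_extension G \<rho> (f \<oplus>\<^bsub>?R\<^esub> h) = linear_extension G \<rho> f \<oplus>\<^bsub>?S\<^esub> linear_extension G \<rho> h"
    by (auto simp: group_algebra_Q_def cyclo_matrix_ring_def linear_extension_def fun_eq_iff of_rat_add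
        distrib_right sum.distrib)
  show "linear_extension G \<rho> (f \<otimes>\<^bsub>?R\<^esub> h) = linear_extension G \<rho> f \<otimes>\<^bsub>?S\<^esub> linear_extension G \<rho> h"
  proof (rule ext, clarify)
    fix i j
    show "linear_extension G \<rho> (f \<otimes>\<^bsub>?R\<^esub> h) (i, j) = (linear_extension G \<rho> f \<otimes>\<^bsub>?S\<^esub> linear_extension G \<rho> h) (i, j)"
    proof (cases "i < k \<and> j < k")
      case True
      have prod: "(\<Sum>l<k. \<rho> y (i, l) * \<rho> z (l, j)) = \<rho> (y \<otimes> z) (i, j)" if "y \<in> carrier G" "z \<in> carrier G" for y z
        using \<rho>(2)[OF that] True by (simp add: cyclo_matrix_ring_def)
      have "(linear_extension G \<rho> f \<otimes>\<^bsub>?S\<^esub> linear_extension G \<rho> h) (i, j)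
          = (\<Sum>l<k. (\<Sum>y\<in>carrier G. of_rat (f y) * \<rho> y (i, l)) * (\<Sum>z\<in>carrier G. of_rat (h z) * \<rho> z (l, j)))"
        using True by (simp add: cyclo_matrix_ring_def linear_extension_def)
      also have "\<dots> = (\<Sum>l<k. \<Sum>y\<in>carrier G. \<Sum>z\<in>carrier G. of_rat (f y) * of_rat (h z) * (\<rho> y (i, l) * \<rho> z (l, j)))"
        by (simp add: sum_product mult_ac)
      also have "\<dots> = (\<Sum>y\<in>carrier G. \<Sum>z\<in>carrier G. \<Sum>l<k. of_rat (f y) * of_rat (h z) * (\<rho> y (i, l) * \<rho> z (l, j)))"
        by (subst sum.swap, intro sum.cong refl, rule sum.swap)
      also have "\<dots> = (\<Sum>y\<in>carrier G. \<Sum>z\<in>carrier G. of_rat (f y) * of_rat (h z) * \<rho> (y \<otimes> z) (i, j))"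
        by (intro sum.cong refl) (simp only: sum_distrib_left[symmetric] prod)
      \<comment> \<open>The substitution z = y^-1 x produces the convolution of
        \<open>group_algebra_Q\<close>.\<close>
      also have "\<dots> = (\<Sum>y\<in>carrier G. \<Sum>x\<in>carrier G. of_rat (f y) * of_rat (h (inv y \<otimes> x)) * \<rho> x (i, j))"
      proof (rule sum.cong[OF refl])
        fix y assume y: "y \<in> carrier G"
        have "bij_betw (\<lambda>x. inv y \<otimes> x) (carrier G) (carrier G)"
          using y by (intro bij_betwI[where g = "\<lambda>z. y \<otimes> z"]) (auto simp: m_assoc[symmetric])
        then have "(\<Sum>x\<in>carrier G. of_rat (f y) * of_rat (h (inv y \<otimes> x)) * \<rho> (y \<otimes> (inv y \<otimes> x)) (i, j))
            = (\<Sum>z\<in>carrier G. of_rat (f y) * of_rat (h z) * \<rho> (y \<otimes> z) (i, j))"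
          by (rule sum.reindex_bij_betw)
        moreover have "y \<otimes> (inv y \<otimes> x) = x" if "x \<in> carrier G" for x
          using y that by (simp add: m_assoc[symmetric])
        ultimately show "(\<Sum>z\<in>carrier G. of_rat (f y) * of_rat (h z) * \<rho> (y \<otimes> z) (i, j))
            = (\<Sum>x\<in>carrier G. of_rat (f y) * of_rat (h (inv y \<otimes> x)) * \<rho> x (i, j))"
          by simp
      qed
      also have "\<dots> = (\<Sum>x\<in>carrier G. \<Sum>y\<in>carrier G. of_rat (f y) * of_rat (h (inv y \<otimes> x)) * \<rho> x (i, j))"
        by (rule sum.swap)
      also have "\<dots> = linear_extension G \<rho> (f \<otimes>\<^bsub>?R\<^esub> h) (i, j)"
        by (simp add: linear_extension_def group_algebra_Q_def of_rat_sum of_rat_mult sum_distrib_right)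
      finally show ?thesis by simp
    next
      case False
      then have "linear_extension G \<rho> (f \<otimes>\<^bsub>?R\<^esub> h) (i, j) = 0"
        unfolding linear_extension_def using \<rho>_ij by (intro sum.neutral) simp
      moreover have "(linear_extension G \<rho> f \<otimes>\<^bsub>?S\<^esub> linear_extension G \<rho> h) (i, j) = 0"
        using False by (auto simp: cyclo_matrix_ring_def)
      ultimately show ?thesis by simp
    qed
  qed
next
  show "linear_extension G \<rho> \<one>\<^bsub>group_algebra_Q G\<^esub> = \<one>\<^bsub>cyclo_matrix_ring k m\<^esub>"
  proof -
    have "linear_extension G \<rho> \<one>\<^bsub>group_algebra_Q G\<^esub> ij = \<rho> \<one> ij" for ij
      using fin by (simp add: linear_extension_def group_algebra_Q_def if_distrib[of of_rat]
          if_distrib[of "\<lambda>x. x * _"] cong: if_cong)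
    then have "linear_extension G \<rho> \<one>\<^bsub>group_algebra_Q G\<^esub> = \<rho> \<one>" by (rule ext)
    then show ?thesis using rep by (simp add: cyclo_rep_def)
  qed
qed

lemma ring_hom_RDirProd_list_Cons:
  assumes "f \<in> ring_hom R S" "h \<in> ring_hom R (RDirProd_list Rs)"
  shows "(\<lambda>x. f x # h x) \<in> ring_hom R (RDirProd_list (S # Rs))"
proof -
  have "(\<lambda>x. (f x, h x)) \<in> ring_hom R (RDirProd S (RDirProd_list Rs))"
    using assms by (auto simp: ring_hom_def RDirProd_def DirProd_def monoid.defs)
  from ring_hom_trans[OF this RDirProd_list_hom1] show ?thesis by (simp add: comp_def)
qed

lemma wedderburn_sum_carrier_iff:
  "as \<in> carrier (wedderburn_sum L) \<longleftrightarrow> length as = length L \<and>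
    (\<forall>n<length L. as ! n \<in> carrier (cyclo_matrix_ring (fst (L ! n)) (snd (L ! n))))"
proof
  assume "as \<in> carrier (wedderburn_sum L)"
  from RDirProd_list_carrier_mem[OF this[unfolded wedderburn_sum_def]]
  show "length as = length L \<and> (\<forall>n<length L. as ! n \<in> carrier (cyclo_matrix_ring (fst (L ! n)) (snd (L ! n))))"
    by (auto simp: case_prod_unfold)
next
  assume "length as = length L \<and> (\<forall>n<length L. as ! n \<in> carrier (cyclo_matrix_ring (fst (L ! n)) (snd (L ! n))))"
  then show "as \<in> carrier (wedderburn_sum L)"
    unfolding wedderburn_sum_def by (intro RDirProd_list_carrier_memI) (auto simp: case_prod_unfold)
qed

lemma (in group) linear_extensions_ring_hom:
  assumes fin: "finite (carrier G)" and rep: "\<And>k m \<rho>. (k, m, \<rho>) \<in> set D \<Longrightarrow> cyclo_rep G k m \<rho>"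
  shows "(\<lambda>f. map (\<lambda>(k, m, \<rho>). linear_extension G \<rho> f) D)
    \<in> ring_hom (group_algebra_Q G) (wedderburn_sum (map (\<lambda>(k, m, \<rho>). (k, m)) D))"
  using rep
proof (induction D)
  case Nil
  then show ?case by (auto simp: wedderburn_sum_def ring_hom_def monoid.defs)
next
  case (Cons d D)
  obtain k m \<rho> where d: "d = (k, m, \<rho>)" by (cases d)
  have "linear_extension G \<rho> \<in> ring_hom (group_algebra_Q G) (cyclo_matrix_ring k m)"
    using Cons.prems d by (intro linear_extension_ring_hom[OF fin]) simp
  moreover have "(\<lambda>f. map (\<lambda>(k, m, \<rho>). linear_extension G \<rho> f) D)
    \<in> ring_hom (group_algebra_Q G) (wedderburn_sum (map (\<lambda>(k, m, \<rho>). (k, m)) D))"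
    using Cons by simp
  ultimately show ?case
    using ring_hom_RDirProd_list_Cons by (simp add: d wedderburn_sum_def)
qed

lemma vector_space_rat_functions:
  "vector_space (\<lambda>(c::rat) (v :: 'a \<Rightarrow> complex) x. of_rat c * v x)"
  by unfold_locales (auto simp: fun_eq_iff algebra_simps of_rat_add of_rat_mult)

text \<open>By the exchange bound: a vector of span B outside span S would extend S to an
  independent set with more elements than B.\<close>

lemma (in vector_space) span_superset_of_card:
  assumes "finite B" "independent S" "S \<subseteq> span B" "card B \<le> card S"
  shows "span B \<subseteq> span S"
proof
  fix v assume v: "v \<in> span B"
  show "v \<in> span S"
  proof (rule ccontr)
    assume n: "v \<notin> span S"
    then have "v \<notin> S" using span_base by blast
    have "finite S" using independent_span_bound[OF assms(1-3)] by simp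
    have "independent (insert v S)" using n assms(2) by (rule independent_insertI)
    then have "card (insert v S) \<le> card B"
      using independent_span_bound[OF assms(1), of "insert v S"] v assms(3) by simp
    then show False using assms(4) \<open>v \<notin> S\<close> \<open>finite S\<close> by simp
  qed
qed

text \<open>A dimension count over Q: \<open>faithful\<close> makes the |G| images of group elements
  independent, while \<open>span\<close> and \<open>dim\<close> give at most |G| spanning vectors
  for the target. The inequality in \<open>dim\<close> suffices, as the opposite one comes from
  injectivity.\<close>

theorem (in group) group_algebra_iso_wedderburn_sum:
  fixes D :: "(nat \<times> nat \<times> ('a \<Rightarrow> nat \<times> nat \<Rightarrow> complex)) list"
  assumes fin: "finite (carrier G)"
    and rep: "\<And>k m \<rho>. (k, m, \<rho>) \<in> set D \<Longrightarrow> cyclo_rep G k m \<rho>"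
    and span: "\<And>k m \<rho> x. (k, m, \<rho>) \<in> set D \<Longrightarrow> x \<in> cyclotomic_field m \<Longrightarrow>
        \<exists>q::nat\<Rightarrow>rat. x = (\<Sum>j<totient m. of_rat (q j) * zeta m ^ j)"
    and dim: "(\<Sum>(k, m, \<rho>)\<leftarrow>D. k ^ 2 * totient m) \<le> order G"
    and faithful: "\<And>f :: 'a \<Rightarrow> rat. (\<And>k m \<rho> ij. (k, m, \<rho>) \<in> set D \<Longrightarrow> linear_extension G \<rho> f ij = 0) \<Longrightarrow>
        (\<And>g. g \<in> carrier G \<Longrightarrow> f g = 0)"
  shows "group_algebra_Q G \<simeq> wedderburn_sum (map (\<lambda>(k, m, \<rho>). (k, m)) D)"
proof -
  let ?L = "map (\<lambda>(k, m, \<rho>). (k, m)) D"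
  let ?R = "group_algebra_Q G" and ?S = "wedderburn_sum ?L"
  define \<phi> where "\<phi> = (\<lambda>f. map (\<lambda>(k, m, \<rho>). linear_extension G \<rho> f) D)"
  have hom: "\<phi> \<in> ring_hom ?R ?S" unfolding \<phi>_def by (rule linear_extensions_ring_hom[OF fin rep])
  define K M \<Psi> where "K = (\<lambda>n. fst (D ! n))" and "M = (\<lambda>n. fst (snd (D ! n)))" and "\<Psi> = (\<lambda>n. snd (snd (D ! n)))"
  have Dn: "(K n, M n, \<Psi> n) \<in> set D" if "n < length D" for n
    using nth_mem[OF that] by (simp add: K_def M_def \<Psi>_def)
  have \<phi>n: "\<phi> f ! n = linear_extension G (\<Psi> n) f" if "n < length D" for f n
    using that by (simp add: \<phi>_def \<Psi>_def case_prod_unfold)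
  have faithful': "f g = 0" if "\<And>n ij. n < length D \<Longrightarrow> linear_extension G (\<Psi> n) f ij = 0" "g \<in> carrier G"
    for f :: "'a \<Rightarrow> rat" and g
  proof (rule faithful[OF _ that(2)])
    fix k m \<rho> ij assume "(k, m, \<rho>) \<in> set D"
    then obtain n where "n < length D" "D ! n = (k, m, \<rho>)" by (auto simp: in_set_conv_nth)
    then show "linear_extension G \<rho> f ij = 0" using that(1)[of n ij] by (simp add: \<Psi>_def)
  qed
  have inj: "inj_on \<phi> (carrier ?R)"
  proof (rule inj_onI)
    fix f h assume fh: "f \<in> carrier ?R" "h \<in> carrier ?R" "\<phi> f = \<phi> h"
    have "linear_extension G (\<Psi> n) (\<lambda>g. f g - h g) ij = 0" if "n < length D" for n ij
    proof -
      have "linear_extension G (\<Psi> n) f ij = linear_extension G (\<Psi> n) h ij"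
        using arg_cong[OF fh(3), of "\<lambda>l. l ! n"] \<phi>n[OF that] by simp
      then show ?thesis by (simp add: linear_extension_def of_rat_diff left_diff_distrib sum_subtractf)
    qed
    from faithful'[OF this] have "f g = h g" if "g \<in> carrier G" for g using that by simp
    moreover have "f g = h g" if "g \<notin> carrier G" for g using that fh by (simp add: group_algebra_Q_def)
    ultimately show "f = h" by blast
  qed
  have surj: "L \<in> \<phi> ` carrier ?R" if L: "L \<in> carrier ?S" for L
  proof -
    interpret V: vector_space "\<lambda>(c::rat) (v :: nat \<times> nat \<times> nat \<Rightarrow> complex) x. of_rat c * v x"
      by (rule vector_space_rat_functions)
    define P where "P = (SIGMA n:{..<length D}. {..<K n} \<times> {..<K n})"
    define sgl :: "nat \<times> nat \<times> nat \<Rightarrow> complex \<Rightarrow> nat \<times> nat \<times> nat \<Rightarrow> complex"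
      where "sgl = (\<lambda>p z p'. if p' = p then z else 0)"
    \<comment> \<open>The rational spanning set: powers zeta^t with t below the totient, placed at a
      single position (i, j) of a single component n.\<close>
    define B where "B = (\<Union>n\<in>{..<length D}. (\<lambda>((i, j), t). sgl (n, i, j) (zeta (M n) ^ t)) ` (({..<K n} \<times> {..<K n}) \<times> {..<totient (M n)}))"
    have finB: "finite B" unfolding B_def by auto
    have "card B \<le> (\<Sum>n<length D. K n ^ 2 * totient (M n))"
    proof -
      have "card B \<le> (\<Sum>n<length D. card ((\<lambda>((i, j), t). sgl (n, i, j) (zeta (M n) ^ t)) ` (({..<K n} \<times> {..<K n}) \<times> {..<totient (M n)})))"
        unfolding B_def by (rule card_UN_le) simp
      also have "\<dots> \<le> (\<Sum>n<length D. K n ^ 2 * totient (M n))"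
      proof (rule sum_mono)
        fix n
        have "card ((\<lambda>((i, j), t). sgl (n, i, j) (zeta (M n) ^ t)) ` (({..<K n} \<times> {..<K n}) \<times> {..<totient (M n)}))
            \<le> card (({..<K n} \<times> {..<K n}) \<times> {..<totient (M n)})" by (rule card_image_le) simp
        then show "card ((\<lambda>((i, j), t). sgl (n, i, j) (zeta (M n) ^ t)) ` (({..<K n} \<times> {..<K n}) \<times> {..<totient (M n)}))
            \<le> K n ^ 2 * totient (M n)" by (simp add: card_cartesian_product power2_eq_square)
      qed
      finally show ?thesis .
    qed
    also have "\<dots> = (\<Sum>(k, m, \<rho>)\<leftarrow>D. k ^ 2 * totient m)"
      by (simp add: sum_list_sum_nth K_def M_def case_prod_unfold atLeast0LessThan)
    finally have cardB: "card B \<le> card (carrier G)" using dim by (simp add: order_def)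
    \<comment> \<open>Flattens a list of matrices into one function on triples (component, row,
      column), so that the whole product of rings lives inside one rational vector space.\<close>
    define enc :: "(nat \<times> nat \<Rightarrow> complex) list \<Rightarrow> nat \<times> nat \<times> nat \<Rightarrow> complex"
      where "enc = (\<lambda>l (n, i, j). if n < length D then (l ! n) (i, j) else 0)"
    have enc_span: "enc l \<in> V.span B" if l: "l \<in> carrier ?S" for l
    proof -
      have l': "l ! n \<in> carrier (cyclo_matrix_ring (K n) (M n))" if "n < length D" for n
        using l that by (auto simp: wedderburn_sum_carrier_iff K_def M_def case_prod_unfold)
      have enc_P: "enc l p = (\<Sum>p'\<in>P. if p = p' then enc l p' else 0)" for p
      proof (cases "p \<in> P")
        case False
        obtain n i j where p: "p = (n, i, j)" by (cases p)
        have "enc l p = 0"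
          using False l'[of n] by (auto simp: enc_def p P_def cyclo_matrix_ring_def)
        then show ?thesis using False by (simp add: P_def)
      qed (simp add: P_def)
      have "enc l = (\<Sum>p\<in>P. sgl p (enc l p))"
        unfolding fun_eq_iff sum_fun_apply sgl_def by (intro allI enc_P)
      also have "\<dots> \<in> V.span B"
      proof (rule V.span_sum)
        fix p assume p: "p \<in> P"
        obtain n i j where pe: "p = (n, i, j)" by (cases p)
        then have n: "n < length D" "i < K n" "j < K n" using p by (auto simp: P_def)
        have "enc l p \<in> cyclotomic_field (M n)"
          using l'[OF n(1)] n by (auto simp: enc_def pe cyclo_matrix_ring_def)
        then obtain c where c: "enc l p = (\<Sum>t<totient (M n). of_rat (c t) * zeta (M n) ^ t)"
          using span[OF Dn[OF n(1)]] by blast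
        have "sgl p (enc l p) = (\<Sum>t<totient (M n). (\<lambda>x. of_rat (c t) * sgl p (zeta (M n) ^ t) x))"
          unfolding c by (intro ext) (simp add: sum_fun_apply sgl_def)
        also have "\<dots> \<in> V.span B"
        proof (rule V.span_sum, rule V.span_scale, rule V.span_base)
          fix t assume "t \<in> {..<totient (M n)}"
          then show "sgl p (zeta (M n) ^ t) \<in> B"
            unfolding B_def pe using n by (intro UN_I[of n] image_eqI[of _ _ "((i, j), t)"]) auto
        qed
        finally show "sgl p (enc l p) \<in> V.span B" .
      qed
      finally show ?thesis .
    qed
    define \<delta> :: "'a \<Rightarrow> 'a \<Rightarrow> rat" where "\<delta> = (\<lambda>g x. if x = g then 1 else 0)"
    define w where "w = (\<lambda>g. enc (\<phi> (\<delta> g)))"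
    have w: "w g (n, i, j) = (if n < length D then \<Psi> n g (i, j) else 0)" if "g \<in> carrier G" for g n i j
      using that fin by (simp add: w_def enc_def \<phi>n linear_extension_def \<delta>_def if_distrib[of of_rat]
          if_distrib[of "\<lambda>x. x * _"] cong: if_cong)
    have comb: "(\<Sum>g\<in>carrier G. of_rat (c g) * w g (n, i, j)) = linear_extension G (\<Psi> n) c (i, j)" if "n < length D" for c n i j
      using that by (simp add: w linear_extension_def)
    \<comment> \<open>Injectivity makes the image a set of |G| vectors and lets sums over it be
      reindexed by G. It is faithfulness applied to the difference of two indicator
      functions.\<close>
    have w_inj: "inj_on w (carrier G)"
    proof (rule inj_onI)
      fix g h assume gh: "g \<in> carrier G" "h \<in> carrier G" "w g = w h"
      define c where "c = (\<lambda>x. \<delta> g x - \<delta> h x)"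
      have "c g = 0"
      proof (rule faithful'[OF _ gh(1)])
        fix n and ij :: "nat \<times> nat" assume n: "n < length D"
        obtain i j where ij: "ij = (i, j)" by (cases ij)
        have "linear_extension G (\<Psi> n) c ij = w g (n, i, j) - w h (n, i, j)"
          using gh(1,2) fin n
          by (simp add: w linear_extension_def c_def \<delta>_def of_rat_diff left_diff_distrib sum_subtractf ij
              if_distrib[of of_rat] if_distrib[of "\<lambda>x. x * _"] cong: if_cong)
        then show "linear_extension G (\<Psi> n) c ij = 0" using gh(3) by simp
      qed
      then show "g = h" by (simp add: c_def \<delta>_def split: if_splits)
    qed
    have indep: "V.independent (w ` carrier G)"
    proof (rule V.independent_if_scalars_zero)
      show "finite (w ` carrier G)" using fin by simp
      fix c v assume c: "(\<Sum>v\<in>w ` carrier G. (\<lambda>x. of_rat (c v) * v x)) = 0" and "v \<in> w ` carrier G"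
      then obtain g where g: "g \<in> carrier G" "v = w g" by blast
      have "(c \<circ> w) g = 0"
      proof (rule faithful'[OF _ g(1)])
        fix n and ij :: "nat \<times> nat" assume n: "n < length D"
        obtain i j where ij: "ij = (i, j)" by (cases ij)
        have "(\<Sum>v\<in>w ` carrier G. (\<lambda>x. of_rat (c v) * v x)) (n, i, j) = 0" using c by simp
        then have "(\<Sum>g\<in>carrier G. of_rat (c (w g)) * w g (n, i, j)) = 0"
          by (simp add: sum_fun_apply sum.reindex[OF w_inj])
        then show "linear_extension G (\<Psi> n) (c \<circ> w) ij = 0" using comb[OF n, of "c \<circ> w" i j] ij by simp
      qed
      then show "c v = 0" using g by simp
    qed
    have "w ` carrier G \<subseteq> V.span B"
    proof clarify
      fix g assume "g \<in> carrier G"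
      then have "\<delta> g \<in> carrier ?R" by (auto simp: \<delta>_def group_algebra_Q_def)
      then have "\<phi> (\<delta> g) \<in> carrier ?S" by (rule ring_hom_closed[OF hom])
      then show "w g \<in> V.span B" unfolding w_def by (rule enc_span)
    qed
    then have "V.span B \<subseteq> V.span (w ` carrier G)"
      using cardB by (intro V.span_superset_of_card finB indep) (simp_all add: card_image w_inj)
    then have "enc L \<in> V.span (w ` carrier G)" using enc_span[OF L] by blast
    then obtain u where u: "enc L = (\<Sum>v\<in>w ` carrier G. (\<lambda>x. of_rat (u v) * v x))"
      using fin by (auto simp: V.span_finite)
    define f where "f = (\<lambda>g. if g \<in> carrier G then u (w g) else 0)"
    have "f \<in> carrier ?R" by (simp add: f_def group_algebra_Q_def)
    moreover have "L = \<phi> f"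
    proof (rule nth_equalityI)
      show len: "length L = length (\<phi> f)" using L by (simp add: wedderburn_sum_carrier_iff \<phi>_def)
      fix n assume "n < length L"
      then have n: "n < length D" using len by (simp add: \<phi>_def)
      have "(L ! n) (i, j) = linear_extension G (\<Psi> n) f (i, j)" for i j
      proof -
        have "(L ! n) (i, j) = enc L (n, i, j)" using n by (simp add: enc_def)
        also have "\<dots> = (\<Sum>g\<in>carrier G. of_rat (u (w g)) * w g (n, i, j))"
          unfolding u by (simp add: sum_fun_apply sum.reindex[OF w_inj])
        also have "\<dots> = (\<Sum>g\<in>carrier G. of_rat (f g) * w g (n, i, j))" by (simp add: f_def)
        also have "\<dots> = linear_extension G (\<Psi> n) f (i, j)" by (rule comb[OF n])
        finally show ?thesis .
      qed
      then show "L ! n = \<phi> f ! n" by (simp add: \<phi>n[OF n] fun_eq_iff)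
    qed
    ultimately show ?thesis by blast
  qed
  have "\<phi> ` carrier ?R = carrier ?S" using surj ring_hom_closed[OF hom] by blast
  then have "bij_betw \<phi> (carrier ?R) (carrier ?S)" using inj by (simp add: bij_betw_def)
  then have "\<phi> \<in> ring_iso ?R ?S" using hom by (simp add: ring_iso_def)
  then show ?thesis by (auto simp: is_ring_iso_def)
qed

section \<open>Counting characters and cyclic subgroups\<close>

lemma card_eq_card_image_times:
  assumes "finite Y" "\<And>x. x \<in> Y \<Longrightarrow> card {y \<in> Y. f y = f x} = s"
  shows "card Y = card (f ` Y) * s"
proof -
  have "card Y = (\<Sum>c\<in>f ` Y. card {y \<in> Y. f y = c})"
    using sum.image_gen[OF assms(1), of "\<lambda>_. 1::nat" f] by simp
  also have "\<dots> = (\<Sum>c\<in>f ` Y. s)" using assms(2) by (intro sum.cong) auto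
  finally show ?thesis by simp
qed

lemma totative_cong:
  assumes "m > 0" "coprime e m"
  obtains t where "t \<in> totatives m" "[e = t] (mod m)"
proof (cases "m = 1")
  \<comment> \<open>The totatives of 1 are {1}, while the residue e mod 1 is 0, so the general
    choice of t would fail here.\<close>
  case True
  then show ?thesis using that[of 1] by (simp add: in_totatives_iff cong_def)
next
  case False
  have "coprime (e mod m) m" using assms by (simp add: coprime_mod_left_iff)
  moreover from this have "e mod m > 0" using False by (cases "e mod m = 0") auto
  moreover have "e mod m \<le> m" using assms(1) by (simp add: less_imp_le)
  ultimately show ?thesis using that[of "e mod m"] by (simp add: in_totatives_iff cong_def)
qed

text \<open>By Bezout z^d = 1 for d = gcd(k, p^l), which is a power of p; if it were a proper
  divisor of p^l, already p^(l-1) would be an exponent for z. The guard l > 0 admits the case z =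
  1.\<close>

lemma prime_power_root_of_unity_order:
  fixes z :: complex
  assumes p: "Factorial_Ring.prime p" and z: "z ^ (p ^ l) = 1" "l > 0 \<Longrightarrow> z ^ (p ^ (l - 1)) \<noteq> 1"
  shows "z ^ k = 1 \<longleftrightarrow> p ^ l dvd k"
proof
  assume k: "z ^ k = 1"
  define d where "d = gcd k (p ^ l)"
  have "z ^ d = 1"
  proof (cases "k = 0")
    case True
    then show ?thesis using z(1) by (simp add: d_def)
  next
    case False
    then obtain u v where uv: "k * u = p ^ l * v + d" using bezout_nat[of k "p ^ l"] by (auto simp: d_def)
    have "1 = (z ^ k) ^ u" using k by simp
    also have "\<dots> = z ^ (p ^ l * v + d)" by (simp only: power_mult[symmetric] uv)
    also have "\<dots> = (z ^ (p ^ l)) ^ v * z ^ d" by (simp only: power_add power_mult)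
    also have "\<dots> = z ^ d" using z(1) by simp
    finally show ?thesis by simp
  qed
  obtain i where i: "i \<le> l" "d = p ^ i" using divides_primepow_nat[OF p, of d l] by (auto simp: d_def)
  have "i = l"
  proof (rule ccontr)
    assume "i \<noteq> l"
    then have "l > 0" "i \<le> l - 1" using i by auto
    then obtain e where "p ^ (l - 1) = p ^ i * e" using le_imp_power_dvd by blast
    then have "z ^ (p ^ (l - 1)) = 1" using \<open>z ^ d = 1\<close> i by (simp add: power_mult)
    then show False using z(2) \<open>l > 0\<close> by blast
  qed
  then have "p ^ l = gcd k (p ^ l)" using i by (simp add: d_def)
  then show "p ^ l dvd k" by (metis gcd_dvd1)
next
  assume "p ^ l dvd k"
  then show "z ^ k = 1" using z(1) by (auto simp: power_mult)
qed

section \<open>Elements of given order and cyclic subgroups\<close>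

context group
begin

lemma pow_mod_ord:
  assumes "x \<in> carrier G"
  shows "x [^] (k mod ord x) = x [^] (k::nat)"
proof -
  have "x [^] k = x [^] (ord x * (k div ord x) + k mod ord x)" by simp
  also have "\<dots> = (x [^] ord x) [^] (k div ord x) \<otimes> x [^] (k mod ord x)"
    using assms by (simp only: nat_pow_mult[symmetric] nat_pow_pow)
  finally show ?thesis using assms by simp
qed

text \<open>The fibre of x |-> <x> over a cyclic subgroup of order k consists of its generators x^r
  with r prime to k.\<close>

lemma card_elements_of_order:
  assumes fin: "finite (carrier G)" and k: "k > 0"
  shows "card {x \<in> carrier G. ord x = k} = num_cyclic_subgroups G k * totient k"
proof -
  let ?Y = "{x \<in> carrier G. ord x = k}" and ?f = "\<lambda>x. generate G {x}"
  have "card {y \<in> ?Y. ?f y = ?f x} = totient k" if x: "x \<in> ?Y" for x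
  proof -
    have xc: "x \<in> carrier G" "ord x = k" using x by auto
    have "{y \<in> ?Y. ?f y = ?f x} = (\<lambda>r. x [^] r) ` totatives k"
    proof (intro equalityI subsetI)
      fix y assume y: "y \<in> {y \<in> ?Y. ?f y = ?f x}"
      then have yc: "y \<in> carrier G" "ord y = k" and "y \<in> ?f x"
        using generate.incl[of y "{y}" G] by auto
      then obtain e :: nat where e: "y = x [^] e"
        using generate_pow_on_finite_carrier[OF fin xc(1)] by blast
      then have "coprime e k" using yc xc pow_ord_eq_ord_iff[OF fin xc(1), of e] by simp
      then obtain t where t: "t \<in> totatives k" "[e = t] (mod k)" using totative_cong[OF k] by blast
      have "x [^] e = x [^] t"
        using t(2) pow_mod_ord[OF xc(1), of e] pow_mod_ord[OF xc(1), of t] xc(2) by (simp add: cong_def)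
      then show "y \<in> (\<lambda>r. x [^] r) ` totatives k" using e t(1) by blast
    next
      fix y assume "y \<in> (\<lambda>r. x [^] r) ` totatives k"
      then obtain r where r: "r \<in> totatives k" "y = x [^] r" by blast
      then have y: "y \<in> carrier G" "ord y = k"
        using xc pow_ord_eq_ord_iff[OF fin xc(1), of r] by (auto simp: in_totatives_iff)
      have "y \<in> ?f x" using r generate_pow_on_finite_carrier[OF fin xc(1)] by blast
      then have "?f y \<subseteq> ?f x"
        using xc by (intro generate_subgroup_incl generate_is_subgroup) auto
      moreover have "card (?f y) = card (?f x)" using y xc generate_pow_card by metis
      moreover have "finite (?f x)"
        using fin xc by (meson empty_subsetI finite_subset generate_incl insert_subset)
      ultimately have "?f y = ?f x" by (intro card_subset_eq)
      then show "y \<in> {y \<in> ?Y. ?f y = ?f x}" using y by simp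
    qed
    moreover have "inj_on (\<lambda>r. x [^] r) (totatives k)"
      using ord_inj'[OF xc(1)] by (rule inj_on_subset) (auto simp: xc in_totatives_iff)
    ultimately show ?thesis by (simp add: card_image totient_def)
  qed
  then have "card ?Y = card (?f ` ?Y) * totient k"
    using fin by (intro card_eq_card_image_times) auto
  also have "?f ` ?Y = {K. (\<exists>x\<in>carrier G. K = generate G {x}) \<and> card K = k}"
    using generate_pow_card by auto
  finally show ?thesis by (simp add: num_cyclic_subgroups_def)
qed

lemma card_elements_of_prime_power_order:
  assumes fin: "finite (carrier G)" and p: "Factorial_Ring.prime p"
  shows "card {x \<in> carrier G. ord x = p ^ l} =
    card {x \<in> carrier G. x [^] (p ^ l) = \<one>} - (if l = 0 then 0 else card {x \<in> carrier G. x [^] (p ^ (l - 1)) = \<one>})"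
proof (cases l)
  case 0
  have "ord x = 1 \<longleftrightarrow> x [^] (1::nat) = \<one>" if "x \<in> carrier G" for x
    using pow_eq_id[OF that, of 1] by simp
  then have "{x \<in> carrier G. ord x = p ^ l} = {x \<in> carrier G. x [^] (p ^ l) = \<one>}"
    using 0 by auto
  then show ?thesis using 0 by simp
next
  case (Suc k)
  have "ord x = p ^ Suc k \<longleftrightarrow> x [^] (p ^ Suc k) = \<one> \<and> \<not> x [^] (p ^ k) = \<one>" if "x \<in> carrier G" for x
  proof -
    have "p > 1" using p by (rule prime_gt_1_nat)
    have "ord x = p ^ Suc k \<longleftrightarrow> ord x dvd p ^ Suc k \<and> \<not> ord x dvd p ^ k"
    proof
      assume "ord x = p ^ Suc k"
      then show "ord x dvd p ^ Suc k \<and> \<not> ord x dvd p ^ k"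
        using \<open>p > 1\<close> by (simp add: power_dvd_imp_le dvd_power_iff_le del: power_Suc)
    next
      assume a: "ord x dvd p ^ Suc k \<and> \<not> ord x dvd p ^ k"
      then obtain i where i: "i \<le> Suc k" "ord x = p ^ i" using divides_primepow_nat[OF p] by blast
      then have "\<not> i \<le> k" using a le_imp_power_dvd[of i k p] by auto
      then show "ord x = p ^ Suc k" using i by (simp add: le_Suc_eq)
    qed
    then show ?thesis using pow_eq_id[OF that] by simp
  qed
  then have "{x \<in> carrier G. ord x = p ^ l} =
      {x \<in> carrier G. x [^] (p ^ Suc k) = \<one>} - {x \<in> carrier G. x [^] (p ^ k) = \<one>}"
    using Suc by auto
  moreover have "{x \<in> carrier G. x [^] (p ^ k) = \<one>} \<subseteq> {x \<in> carrier G. x [^] (p ^ Suc k) = \<one>}"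
    using pow_eq_id by (auto intro: dvd_mult)
  ultimately show ?thesis using fin Suc by (simp add: card_Diff_subset)
qed

end

text \<open>Each coset in the m-torsion of the quotient is made up of \<open>card H\<close> elements
  whose m-th power lies in H.\<close>

lemma (in normal) card_FactGroup_torsion:
  assumes fin: "finite (carrier G)"
  shows "card {Y \<in> carrier (G Mod H). Y [^]\<^bsub>G Mod H\<^esub> (m::nat) = \<one>\<^bsub>G Mod H\<^esub>} * card H
    = card {x \<in> carrier G. x [^] m \<in> H}"
proof -
  let ?Y = "{x \<in> carrier G. x [^] m \<in> H}"
  have pow: "(H #> x) [^]\<^bsub>G Mod H\<^esub> m = \<one>\<^bsub>G Mod H\<^esub> \<longleftrightarrow> x [^] m \<in> H" if "x \<in> carrier G" for x
  proof -
    have "(H #> x) [^]\<^bsub>G Mod H\<^esub> m = H #> (x [^] m)" by (rule FactGroup_pow[OF that])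
    then show ?thesis
      using coset_join1[of H "x [^] m"] coset_join2[of "x [^] m" H] is_subgroup subset that by auto
  qed
  have "card {y \<in> ?Y. H #> y = H #> x} = card H" if x: "x \<in> ?Y" for x
  proof -
    have xc: "x \<in> carrier G" using x by simp
    have "{y \<in> ?Y. H #> y = H #> x} = H #> x"
    proof (intro equalityI subsetI)
      fix y assume "y \<in> {y \<in> ?Y. H #> y = H #> x}"
      then show "y \<in> H #> x" using rcos_self[OF _ is_subgroup] by blast
    next
      fix y assume y: "y \<in> H #> x"
      then have yc: "y \<in> carrier G" using xc subset r_coset_subset_G by blast
      moreover have eq: "H #> y = H #> x" using repr_independence[OF y xc is_subgroup] by simp
      moreover have "y [^] m \<in> H" using pow[OF yc] pow[OF xc] x eq by simp
      ultimately show "y \<in> {y \<in> ?Y. H #> y = H #> x}" by simp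
    qed
    moreover have "H #> x \<in> rcosets H" using xc subset by (rule rcosetsI[rotated])
    ultimately show ?thesis using card_rcosets_equal[OF _ subset] by simp
  qed
  then have "card ?Y = card ((\<lambda>x. H #> x) ` ?Y) * card H"
    using fin by (intro card_eq_card_image_times) auto
  also have "(\<lambda>x. H #> x) ` ?Y = {Y \<in> carrier (G Mod H). Y [^]\<^bsub>G Mod H\<^esub> m = \<one>\<^bsub>G Mod H\<^esub>}"
    using pow by (auto simp: carrier_FactGroup)
  finally show ?thesis by simp
qed

section \<open>Characters of exact prime-power order and their Galois classes\<close>

context abelian_section
begin

definition torsion_chars :: "nat \<Rightarrow> ('a \<Rightarrow> complex) set" where
  "torsion_chars m = {\<chi> \<in> linear_chars G H N. \<forall>h\<in>H. \<chi> h ^ m = 1}"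

definition chars_of_order :: "nat \<Rightarrow> nat \<Rightarrow> ('a \<Rightarrow> complex) set" where
  "chars_of_order p l = {\<chi> \<in> torsion_chars (p ^ l). \<forall>k<l. \<chi> \<notin> torsion_chars (p ^ k)}"

lemma torsion_chars_mono:
  assumes "m dvd n"
  shows "torsion_chars m \<subseteq> torsion_chars n"
proof -
  obtain k where "n = m * k" using assms by blast
  then show ?thesis by (auto simp: torsion_chars_def power_mult)
qed

lemma finite_torsion_chars: "finite (torsion_chars m)"
  unfolding torsion_chars_def using finite_linear_chars by simp

lemma card_chars_of_order:
  "card (chars_of_order p l) = card (torsion_chars (p ^ l)) - (if l = 0 then 0 else card (torsion_chars (p ^ (l - 1))))"
proof (cases l)
  case (Suc k)
  have "\<chi> \<notin> torsion_chars (p ^ k) \<longleftrightarrow> (\<forall>i<l. \<chi> \<notin> torsion_chars (p ^ i))" for \<chi>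
    using torsion_chars_mono[OF le_imp_power_dvd[of _ k p]] Suc by (auto simp: less_Suc_eq_le)
  then have "chars_of_order p l = torsion_chars (p ^ l) - torsion_chars (p ^ k)"
    by (auto simp: chars_of_order_def)
  moreover have "torsion_chars (p ^ k) \<subseteq> torsion_chars (p ^ l)"
    using Suc by (intro torsion_chars_mono le_imp_power_dvd) simp
  ultimately show ?thesis using Suc by (simp add: card_Diff_subset finite_torsion_chars)
qed (simp add: chars_of_order_def)

lemma normal_in_generated:
  assumes H: "H = carrier (subgroup_generated G S)"
  shows "N \<lhd> subgroup_generated G S"
proof -
  interpret H: group "subgroup_generated G S" by simp
  have "subgroup N (subgroup_generated G S)" using subN N_H H by (simp add: subgroup_subgroup_generated_iff)
  moreover have "x \<otimes> h \<otimes> inv x \<in> N" if "x \<in> H" "h \<in> N" for x h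
    using conj_H(1)[OF that(1,2) subN order_refl N_H] .
  ultimately show ?thesis unfolding H.normal_inv_iff using H by auto
qed

text \<open>The passage from characters to cyclic subgroups: a finite abelian group and its dual
  have equally many elements killed by each p^i, hence equally many of order p^l, and these come
  totient(p^l) to a cyclic subgroup.\<close>

lemma card_chars_of_order_eq:
  assumes H: "H = carrier (subgroup_generated G S)" and p: "Factorial_Ring.prime p"
  shows "card (chars_of_order p l) = num_cyclic_subgroups (subgroup_generated G S Mod N) (p ^ l) * totient (p ^ l)"
proof -
  let ?H = "subgroup_generated G S"
  interpret H: group ?H by simp
  interpret N: normal N ?H by (rule normal_in_generated[OF H])
  interpret Q: group "?H Mod N" by (rule N.factorgroup_is_group)
  have finH: "finite (carrier ?H)" using finite_H H by simp
  have finQ: "finite (carrier (?H Mod N))" using finH by (simp add: carrier_FactGroup)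
  have p0: "p > 0" using p by (rule prime_gt_0_nat)
  have cN: "card N \<noteq> 0" using finite_N one_N by auto
  have "card (torsion_chars (p ^ i)) = card {Y \<in> carrier (?H Mod N). Y [^]\<^bsub>?H Mod N\<^esub> (p ^ i) = \<one>\<^bsub>?H Mod N\<^esub>}" for i
  proof -
    have "card (torsion_chars (p ^ i)) * card N = card {h \<in> H. h [^] (p ^ i) \<in> N}"
      unfolding torsion_chars_def using card_linear_chars_torsion_mult[of "p ^ i"] p0 by simp
    also have "\<dots> = card {Y \<in> carrier (?H Mod N). Y [^]\<^bsub>?H Mod N\<^esub> (p ^ i) = \<one>\<^bsub>?H Mod N\<^esub>} * card N"
      using N.card_FactGroup_torsion[OF finH, of "p ^ i"] H by (simp add: pow_subgroup_generated)
    finally show ?thesis using cN by (auto simp only: mult_cancel2)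
  qed
  then have "card (chars_of_order p l) = card {Y \<in> carrier (?H Mod N). Q.ord Y = p ^ l}"
    unfolding card_chars_of_order Q.card_elements_of_prime_power_order[OF finQ p] by simp
  then show ?thesis using Q.card_elements_of_order[OF finQ, of "p ^ l"] p0 by simp
qed

text \<open>\<open>R\<close> picks one character from each orbit of \<chi> |-> \<chi>^r, that is
  from each Galois class. All classes have size totient(p^l), because some value of \<chi> is a
  primitive p^l-th root of unity. The condition r > 0 preserves the extension by zero, as 0^0 =
  1.\<close>

lemma chars_of_order_representatives:
  assumes p: "Factorial_Ring.prime p" and Y: "Y \<subseteq> chars_of_order p l"
    and closed: "\<And>\<chi> r. \<chi> \<in> Y \<Longrightarrow> r > 0 \<Longrightarrow> coprime r (p ^ l) \<Longrightarrow> (\<lambda>h. \<chi> h ^ r) \<in> Y"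
  obtains R where "R \<subseteq> Y" "card R * totient (p ^ l) = card Y"
    "\<And>\<chi>. \<chi> \<in> Y \<Longrightarrow> \<exists>\<theta>\<in>R. \<exists>r. coprime r (p ^ l) \<and> r > 0 \<and> \<chi> = (\<lambda>h. \<theta> h ^ r)"
proof -
  let ?m = "p ^ l"
  have m0: "?m > 0" using p by (simp add: prime_gt_0_nat)
  define cls where "cls = (\<lambda>\<chi> :: 'a \<Rightarrow> complex. (\<lambda>r h. \<chi> h ^ r) ` totatives ?m)"
  have "Y \<subseteq> torsion_chars ?m" using Y by (auto simp: chars_of_order_def)
  then have finX: "finite Y" using finite_torsion_chars by (rule finite_subset)
  have primitive: "\<exists>h\<in>H. \<forall>k. \<chi> h ^ k = 1 \<longleftrightarrow> ?m dvd k" if "\<chi> \<in> Y" for \<chi>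
  proof -
    have \<chi>: "\<chi> \<in> torsion_chars ?m" "\<And>k. k < l \<Longrightarrow> \<chi> \<notin> torsion_chars (p ^ k)"
      using that Y by (auto simp: chars_of_order_def)
    have root: "\<chi> h ^ ?m = 1" if "h \<in> H" for h using \<chi>(1) that by (simp add: torsion_chars_def)
    obtain h where h: "h \<in> H" "l > 0 \<Longrightarrow> \<chi> h ^ (p ^ (l - 1)) \<noteq> 1"
    proof (cases l)
      case 0
      then show ?thesis using that one_H by blast
    next
      case (Suc k)
      then show ?thesis using that \<chi>(2)[of k] \<chi>(1) by (auto simp: torsion_chars_def)
    qed
    have "\<chi> h ^ k = 1 \<longleftrightarrow> ?m dvd k" for k
      by (rule prime_power_root_of_unity_order[OF p root[OF h(1)] h(2)])
    then show ?thesis using h(1) by blast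
  qed
  have red: "\<exists>t\<in>totatives ?m. (\<lambda>h. \<chi> h ^ e) = (\<lambda>h. \<chi> h ^ t)" if \<chi>: "\<chi> \<in> Y" "coprime e ?m" "e > 0" for \<chi> e
  proof -
    obtain t where t: "t \<in> totatives ?m" "[e = t] (mod ?m)" using totative_cong[OF m0 \<chi>(2)] by blast
    have "\<chi> h ^ e = \<chi> h ^ t" for h
    proof (cases "h \<in> H")
      case True
      then have one: "\<chi> h ^ ?m = 1" using \<chi>(1) Y by (auto simp: chars_of_order_def torsion_chars_def)
      have "\<chi> h ^ k = \<chi> h ^ (k mod ?m)" for k
      proof -
        have "\<chi> h ^ (?m * (k div ?m) + k mod ?m) = (\<chi> h ^ ?m) ^ (k div ?m) * \<chi> h ^ (k mod ?m)"
          by (simp only: power_add power_mult)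
        then show ?thesis using one by simp
      qed
      then show ?thesis using t(2) by (metis cong_def)
    next
      case False
      then have "\<chi> h = 0" using \<chi>(1) Y by (auto simp: chars_of_order_def torsion_chars_def linear_chars_def)
      then show ?thesis using \<chi>(3) t(1) by (auto simp: power_0_left in_totatives_iff)
    qed
    then show ?thesis using t(1) by blast
  qed
  have card_cls: "card (cls \<chi>) = totient ?m" if \<chi>: "\<chi> \<in> Y" for \<chi>
  proof -
    obtain h where h: "h \<in> H" "\<And>k. \<chi> h ^ k = 1 \<longleftrightarrow> ?m dvd k" using primitive[OF \<chi>] by blast
    have nz: "\<chi> h \<noteq> 0" using h(2)[of ?m] m0 by (auto simp: power_0_left)
    have lt: False if "r < s" "r \<in> totatives ?m" "s \<in> totatives ?m" "\<chi> h ^ r = \<chi> h ^ s" for r s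
    proof -
      have "\<chi> h ^ s = \<chi> h ^ (r + (s - r))" using that(1) by simp
      then have "\<chi> h ^ s = \<chi> h ^ r * \<chi> h ^ (s - r)" by (simp only: power_add)
      then have "\<chi> h ^ (s - r) = 1" using that(4) nz by simp
      then have "?m dvd s - r" using h(2) by simp
      then show False using that by (auto simp: in_totatives_iff dest!: dvd_imp_le)
    qed
    have "inj_on (\<lambda>r h. \<chi> h ^ r) (totatives ?m)"
    proof (rule inj_onI)
      fix r s assume rs: "r \<in> totatives ?m" "s \<in> totatives ?m" "(\<lambda>h. \<chi> h ^ r) = (\<lambda>h. \<chi> h ^ s)"
      then have "\<chi> h ^ r = \<chi> h ^ s" by meson
      then show "r = s" using lt[of r s] lt[of s r] rs by (cases r s rule: linorder_cases) auto
    qed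
    then show ?thesis unfolding cls_def by (simp add: card_image totient_def)
  qed
  have cls_self: "\<chi> \<in> cls \<chi>" if "\<chi> \<in> Y" for \<chi>
    using red[OF that, of 1] by (auto simp: cls_def)
  have cls_X: "cls \<chi> \<subseteq> Y" if "\<chi> \<in> Y" for \<chi>
    using closed[OF that] by (auto simp: cls_def in_totatives_iff)
  \<comment> \<open>One inclusion and equal sizes are enough, and for the inclusion exponents are
    multiplied; no inverse modulo p^l has to be found.\<close>
  have cls_eq: "cls \<theta> = cls \<chi>" if \<chi>: "\<chi> \<in> Y" "\<theta> \<in> cls \<chi>" for \<chi> \<theta>
  proof (rule card_subset_eq)
    show "finite (cls \<chi>)" by (simp add: cls_def)
    have "\<theta> \<in> Y" using cls_X \<chi> by blast
    then show "card (cls \<theta>) = card (cls \<chi>)" using card_cls \<chi>(1) by simp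
    obtain s where s: "s \<in> totatives ?m" "\<theta> = (\<lambda>h. \<chi> h ^ s)" using \<chi>(2) by (auto simp: cls_def)
    show "cls \<theta> \<subseteq> cls \<chi>"
    proof
      fix \<eta> assume "\<eta> \<in> cls \<theta>"
      then obtain r where r: "r \<in> totatives ?m" "\<eta> = (\<lambda>h. \<chi> h ^ (s * r))"
        by (auto simp: cls_def s(2) power_mult)
      then show "\<eta> \<in> cls \<chi>" using red[OF \<chi>(1), of "s * r"] s(1)
        by (auto simp: cls_def in_totatives_iff)
    qed
  qed
  have "card {\<theta> \<in> Y. cls \<theta> = cls \<chi>} = totient ?m" if "\<chi> \<in> Y" for \<chi>
  proof -
    have "{\<theta> \<in> Y. cls \<theta> = cls \<chi>} = cls \<chi>"
      using cls_self cls_X[OF that] cls_eq[OF that] by blast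
    then show ?thesis using card_cls[OF that] by simp
  qed
  then have cardX: "card Y = card (cls ` Y) * totient ?m"
    by (intro card_eq_card_image_times finX) auto
  define R where "R = (\<lambda>C. SOME \<theta>. \<theta> \<in> Y \<and> cls \<theta> = C) ` (cls ` Y)"
  have some: "(SOME \<theta>. \<theta> \<in> Y \<and> cls \<theta> = C) \<in> Y \<and> cls (SOME \<theta>. \<theta> \<in> Y \<and> cls \<theta> = C) = C"
    if "C \<in> cls ` Y" for C
    using someI_ex[of "\<lambda>\<theta>. \<theta> \<in> Y \<and> cls \<theta> = C"] that by blast
  have "inj_on (\<lambda>C. SOME \<theta>. \<theta> \<in> Y \<and> cls \<theta> = C) (cls ` Y)"
    by (rule inj_on_inverseI[where g = cls]) (use some in blast)
  then have "card R = card (cls ` Y)" unfolding R_def by (rule card_image)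
  show ?thesis
  proof (rule that)
    show "R \<subseteq> Y" using some unfolding R_def by blast
    show "card R * totient ?m = card Y" using cardX \<open>card R = _\<close> by simp
    fix \<chi> assume \<chi>: "\<chi> \<in> Y"
    define \<theta> where "\<theta> = (SOME \<theta>. \<theta> \<in> Y \<and> cls \<theta> = cls \<chi>)"
    have "\<theta> \<in> R" using \<chi> unfolding R_def \<theta>_def by blast
    moreover have "cls \<theta> = cls \<chi>" using some[of "cls \<chi>"] \<chi> unfolding \<theta>_def by blast
    then have "\<chi> \<in> cls \<theta>" using cls_self[OF \<chi>] by simp
    then obtain r where "r \<in> totatives ?m" "\<chi> = (\<lambda>h. \<theta> h ^ r)" unfolding cls_def by blast
    then have "\<exists>r. coprime r ?m \<and> r > 0 \<and> \<chi> = (\<lambda>h. \<theta> h ^ r)"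
      unfolding in_totatives_iff by blast
    ultimately show "\<exists>\<theta>\<in>R. \<exists>r. coprime r ?m \<and> r > 0 \<and> \<chi> = (\<lambda>h. \<theta> h ^ r)" by blast
  qed
qed

end

text \<open>Gives the definite description its meaning: the gcd of the exponent with the group order
  p^n again kills every element, so minimality makes the exponent a power of p.\<close>

lemma (in group) grp_exponent_prime_power:
  assumes fin: "finite (carrier G)" and p: "Factorial_Ring.prime p" and ord: "order G = p ^ n"
  defines "e \<equiv> THE e. grp_exponent G = p ^ e"
  assumes x: "x \<in> carrier G"
  shows "x [^] (p ^ e) = \<one>"
proof -
  let ?P = "\<lambda>k::nat. 0 < k \<and> (\<forall>x\<in>carrier G. x [^] k = \<one>)"
  have p1: "p > 1" using p by (rule prime_gt_1_nat)
  have Pn: "?P (p ^ n)" using pow_order_eq_1 ord p1 by simp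
  define k where "k = grp_exponent G"
  have k: "?P k" unfolding k_def grp_exponent_def using Pn by (rule LeastI)
  have "?P (gcd k (p ^ n))" using k Pn by (auto simp: pow_eq_id)
  then have "k \<le> gcd k (p ^ n)" unfolding k_def grp_exponent_def by (rule Least_le)
  moreover have "gcd k (p ^ n) \<le> k" using k by (intro dvd_imp_le) auto
  ultimately have "gcd k (p ^ n) = k" by simp
  then have "k dvd p ^ n" by (metis gcd_dvd2)
  then obtain i where i: "k = p ^ i" using divides_primepow_nat[OF p] by blast
  have "e = i" unfolding e_def using i p1 by (intro the_equality) (auto simp: k_def power_inject_exp)
  then show ?thesis using k x i by simp
qed

section \<open>Two-generator groups of class two\<close>

context group
begin

lemma comm_mult_left_central:
  assumes "g \<in> carrier G" "g' \<in> carrier G" "h \<in> carrier G"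
    and "\<And>k. k \<in> carrier G \<Longrightarrow> comm G g h \<otimes> k = k \<otimes> comm G g h"
  shows "comm G (g \<otimes> g') h = comm G g h \<otimes> comm G g' h"
  using assms by (intro comm_mult_left) auto

lemma comm_pow_left:
  assumes g: "g \<in> carrier G" "h \<in> carrier G"
    and central: "\<And>k. k \<in> carrier G \<Longrightarrow> comm G g h \<otimes> k = k \<otimes> comm G g h"
  shows "comm G (g [^] (n::nat)) h = comm G g h [^] n"
proof (induction n)
  case 0
  show ?case using g by (simp add: comm_def)
next
  case (Suc n)
  have "comm G (g [^] Suc n) h = comm G (g \<otimes> g [^] n) h" using g by (simp only: nat_pow_Suc2)
  also have "\<dots> = comm G g h \<otimes> comm G (g [^] n) h"
    using g central by (intro comm_mult_left_central) auto
  also have "\<dots> = comm G g h [^] Suc n" using Suc g comm_closed by (simp only: nat_pow_Suc2)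
  finally show ?case .
qed

lemma central_pow:
  assumes "d \<in> carrier G" "k \<in> carrier G" "d \<otimes> k = k \<otimes> d"
  shows "d [^] (n::nat) \<otimes> k = k \<otimes> d [^] n"
  using assms
proof (induction n)
  case (Suc n)
  have "d [^] Suc n \<otimes> k = d [^] n \<otimes> (d \<otimes> k)" using Suc.prems(1,2) by (simp add: m_assoc)
  also have "d \<otimes> k = k \<otimes> d" by (rule Suc.prems(3))
  also have "d [^] n \<otimes> (k \<otimes> d) = (d [^] n \<otimes> k) \<otimes> d" using Suc.prems(1,2) by (simp add: m_assoc)
  also have "d [^] n \<otimes> k = k \<otimes> d [^] n" by (rule Suc.IH[OF Suc.prems])
  also have "(k \<otimes> d [^] n) \<otimes> d = k \<otimes> d [^] Suc n" using Suc.prems(1,2) by (simp add: m_assoc)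
  finally show ?case .
qed simp

lemma central_inv:
  assumes "d \<in> carrier G" "k \<in> carrier G" "d \<otimes> k = k \<otimes> d"
  shows "inv d \<otimes> k = k \<otimes> inv d"
  using assms by (metis inv_closed inv_solve_left inv_solve_right m_assoc m_closed)

text \<open>Moving g past h^n costs [h, g]^n, and C(n, 2) + n = C(n + 1, 2). This binomial
  coefficient is the source of the condition that p is odd.\<close>

lemma pow_mult_class2:
  assumes g: "g \<in> carrier G" "h \<in> carrier G"
    and central: "\<And>k. k \<in> carrier G \<Longrightarrow> comm G h g \<otimes> k = k \<otimes> comm G h g"
  shows "(g \<otimes> h) [^] (n::nat) = g [^] n \<otimes> h [^] n \<otimes> comm G h g [^] (n choose 2)"
proof (induction n)
  case (Suc n)
  let ?d = "comm G h g"
  have d: "?d \<in> carrier G" using g by (simp add: comm_closed)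
  have dc: "?d [^] k \<otimes> x = x \<otimes> ?d [^] k" if "x \<in> carrier G" for x and k :: nat
    using central_pow[OF d that central[OF that]] .
  have hg: "h [^] n \<otimes> g = g \<otimes> h [^] n \<otimes> ?d [^] n"
    using mult_comm(1)[of "h [^] n" g] comm_pow_left[OF g(2,1) central] g by simp
  have "(g \<otimes> h) [^] Suc n = g [^] n \<otimes> h [^] n \<otimes> ?d [^] (n choose 2) \<otimes> (g \<otimes> h)"
    using Suc by simp
  also have "\<dots> = g [^] n \<otimes> (h [^] n \<otimes> g) \<otimes> h \<otimes> ?d [^] (n choose 2)"
    using g d dc[of "g \<otimes> h"] by (simp add: m_assoc)
  also have "\<dots> = g [^] n \<otimes> (g \<otimes> h [^] n \<otimes> (?d [^] n \<otimes> h)) \<otimes> ?d [^] (n choose 2)"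
    using g d by (simp add: hg m_assoc)
  also have "\<dots> = (g [^] n \<otimes> g) \<otimes> (h [^] n \<otimes> h) \<otimes> (?d [^] n \<otimes> ?d [^] (n choose 2))"
    using g d dc[of h n] by (simp add: m_assoc)
  also have "\<dots> = g [^] Suc n \<otimes> h [^] Suc n \<otimes> ?d [^] (Suc n choose 2)"
    using d by (simp add: nat_pow_mult numeral_2_eq_2)
  finally show ?case .
qed (simp add: numeral_2_eq_2)

text \<open>The products x^i y^j h are closed under multiplication, since the commutators created by
  reordering and the conjugates of h fall into H; so they form a subgroup containing both
  generators. It is used with \<open>Z\<close> for normal forms and with \<open>H \<delta>\<close>
  for \<open>symplectic_pair\<close>.\<close>

lemma decomposition_two_generators:
  assumes fin: "finite (carrier G)" and H: "subgroup H G"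
    and normal: "\<And>h g. h \<in> H \<Longrightarrow> g \<in> carrier G \<Longrightarrow> inv g \<otimes> h \<otimes> g \<in> H"
    and x: "x \<in> carrier G" and y: "y \<in> carrier G"
    and comm: "\<And>i j. comm G (y [^] (j::nat)) (x [^] (i::nat)) \<in> H"
    and gen: "generate G {x, y} = carrier G" and g: "g \<in> carrier G"
  shows "\<exists>(i::nat) (j::nat). \<exists>h\<in>H. g = x [^] i \<otimes> (y [^] j \<otimes> h)"
proof -
  define T where "T = {x [^] i \<otimes> (y [^] j \<otimes> h) | (i::nat) (j::nat) h. h \<in> H}"
  have Hc: "h \<in> carrier G" if "h \<in> H" for h using H that by (rule subgroup.mem_carrier)
  have one: "\<one> \<in> H" using H by (rule subgroup.one_closed)
  have T: "subgroup T G"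
  proof (rule finite_closed_subgroup[OF fin])
    show "T \<subseteq> carrier G" using x y Hc by (auto simp: T_def)
    have "\<one> = x [^] (0::nat) \<otimes> (y [^] (0::nat) \<otimes> \<one>)" by simp
    then show "\<one> \<in> T" using one unfolding T_def by blast
    fix s t assume "s \<in> T" "t \<in> T"
    then obtain i j i' j' :: nat and h h' where h: "h \<in> H" "h' \<in> H"
      and st: "s = x [^] i \<otimes> (y [^] j \<otimes> h)" "t = x [^] i' \<otimes> (y [^] j' \<otimes> h')"
      unfolding T_def by blast
    let ?u = "comm G (y [^] j) (x [^] i')" and ?v = "inv (x [^] i') \<otimes> h \<otimes> x [^] i'"
    have uv: "?u \<in> H" "?v \<in> H" using comm normal h x by auto
    then have "inv (y [^] j') \<otimes> (?u \<otimes> ?v) \<otimes> y [^] j' \<in> H" using normal y H by (simp add: subgroup.m_closed)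
    then have w: "inv (y [^] j') \<otimes> (?u \<otimes> ?v) \<otimes> y [^] j' \<otimes> h' \<in> H" (is "?w \<in> H") using h H by (simp add: subgroup.m_closed)
    have c: "?u \<in> carrier G" "?v \<in> carrier G" using uv Hc by auto
    have 1: "(y [^] j \<otimes> h) \<otimes> x [^] i' = x [^] i' \<otimes> (y [^] j \<otimes> (?u \<otimes> ?v))"
    proof -
      have "(y [^] j \<otimes> h) \<otimes> x [^] i' = (y [^] j \<otimes> x [^] i') \<otimes> ?v"
        using x y Hc[OF h(1)] by (simp add: m_assoc[symmetric]) (simp add: m_assoc)
      also have "y [^] j \<otimes> x [^] i' = x [^] i' \<otimes> y [^] j \<otimes> ?u" using x y by (intro mult_comm(1)) auto
      finally show ?thesis using x y c by (simp add: m_assoc)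
    qed
    have "s \<otimes> t = x [^] i \<otimes> ((y [^] j \<otimes> h) \<otimes> x [^] i') \<otimes> (y [^] j' \<otimes> h')"
      unfolding st using x y Hc h by (simp add: m_assoc)
    also have "\<dots> = (x [^] i \<otimes> x [^] i') \<otimes> (y [^] j \<otimes> ((?u \<otimes> ?v) \<otimes> y [^] j') \<otimes> h')"
      unfolding 1 using x y c Hc h by (simp add: m_assoc)
    also have "(?u \<otimes> ?v) \<otimes> y [^] j' = y [^] j' \<otimes> (inv (y [^] j') \<otimes> (?u \<otimes> ?v) \<otimes> y [^] j')"
      using y c by (simp add: m_assoc[symmetric])
    also have "(x [^] i \<otimes> x [^] i') \<otimes> (y [^] j \<otimes> (y [^] j' \<otimes> (inv (y [^] j') \<otimes> (?u \<otimes> ?v) \<otimes> y [^] j')) \<otimes> h')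
        = x [^] (i + i') \<otimes> (y [^] (j + j') \<otimes> ?w)"
      using x y c Hc h by (simp add: nat_pow_mult[symmetric] m_assoc)
    finally show "s \<otimes> t \<in> T" using w unfolding T_def by blast
  qed
  have "x = x [^] (1::nat) \<otimes> (y [^] (0::nat) \<otimes> \<one>)" "y = x [^] (0::nat) \<otimes> (y [^] (1::nat) \<otimes> \<one>)"
    using x y by simp_all
  then have "x \<in> T" "y \<in> T" using one unfolding T_def by blast+
  then have "generate G {x, y} \<subseteq> T" using T by (intro generate_subgroup_incl) auto
  then show ?thesis using g gen unfolding T_def by blast
qed

end

locale two_generator_class_two = group G for G (structure) +
  fixes a b :: 'a and p \<alpha> \<beta> \<gamma> \<rho> \<sigma> :: nat
  assumes p: "Factorial_Ring.prime p" and odd_p: "odd p"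
    and \<alpha>\<beta>: "\<beta> \<le> \<alpha>" and \<beta>\<gamma>: "\<gamma> \<le> \<beta>"
    and a: "a \<in> carrier G" and b: "b \<in> carrier G"
    and gen: "generate G {a, b} = carrier G"
    and c_pow: "comm G a b [^] (p ^ \<gamma>) = \<one>"
    and comm_ca: "comm G (comm G a b) a = \<one>" and comm_cb: "comm G (comm G a b) b = \<one>"
    and a_pow: "a [^] (p ^ \<alpha>) = comm G a b [^] (p ^ \<rho>)"
    and b_pow: "b [^] (p ^ \<beta>) = comm G a b [^] (p ^ \<sigma>)"
    and order_G: "order G = p ^ (\<alpha> + \<beta> + \<gamma>)"
begin

abbreviation c where "c \<equiv> comm G a b"

lemma c: "c \<in> carrier G"
  using a b by (rule comm_closed)

lemma p_gt_1: "p > 1"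
  using p by (rule prime_gt_1_nat)

lemma finite_G: "finite (carrier G)"
  using order_G p_gt_1 order_gt_0_iff_finite by simp

lemma c_central:
  assumes "g \<in> carrier G"
  shows "c \<otimes> g = g \<otimes> c"
proof -
  have "g \<in> generate G {a, b}" using assms gen by simp
  then show ?thesis
  proof (induction rule: generate.induct)
    case one
    then show ?case using c by simp
  next
    case (incl h)
    then show ?case using comm_ca comm_cb comm_eq_one_iff c a b by auto
  next
    case (inv h)
    then have h: "h \<in> carrier G" "c \<otimes> h = h \<otimes> c" using comm_ca comm_cb comm_eq_one_iff c a b by auto
    then show ?case using central_inv[of h c] c by simp
  next
    case (eng h1 h2)
    then have h: "h1 \<in> carrier G" "h2 \<in> carrier G" using gen by auto
    have "c \<otimes> (h1 \<otimes> h2) = (c \<otimes> h1) \<otimes> h2" using h c by (simp add: m_assoc)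
    also have "c \<otimes> h1 = h1 \<otimes> c" by (rule eng.IH(1))
    also have "(h1 \<otimes> c) \<otimes> h2 = h1 \<otimes> (c \<otimes> h2)" using h c by (simp add: m_assoc)
    also have "c \<otimes> h2 = h2 \<otimes> c" by (rule eng.IH(2))
    finally show ?case using h c by (simp add: m_assoc)
  qed
qed

lemma c_pow_central: "g \<in> carrier G \<Longrightarrow> c [^] (k::nat) \<otimes> g = g \<otimes> c [^] k"
  by (intro central_pow c c_central)

definition Z where "Z = {c [^] (k::nat) | k. True}"

lemma Z_eq: "Z = generate G {c}"
  using generate_pow_on_finite_carrier[OF finite_G c] by (simp add: Z_def)

lemma Z_subgroup: "subgroup Z G"
  unfolding Z_eq using c by (intro generate_is_subgroup) simp

lemma Z_central: "z \<in> Z \<Longrightarrow> g \<in> carrier G \<Longrightarrow> z \<otimes> g = g \<otimes> z"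
  using c_pow_central by (auto simp: Z_def)

lemma Z_carrier: "z \<in> Z \<Longrightarrow> z \<in> carrier G"
  using Z_subgroup by (rule subgroup.mem_carrier)

lemma c_pow_Z: "c [^] (k::nat) \<in> Z"
  by (auto simp: Z_def)

lemma comm_ba: "comm G b a = inv c"
  using a b by (rule comm_inverse)

lemma inv_c_Z: "inv c \<in> Z"
  using c_pow_Z[of 1] Z_subgroup c by (simp add: subgroup.m_inv_closed)

lemma comm_pow_ba: "comm G (b [^] (j::nat)) (a [^] (i::nat)) \<in> Z"
proof -
  have cc: "inv c \<otimes> k = k \<otimes> inv c" if "k \<in> carrier G" for k using Z_central[OF inv_c_Z that] .
  have 1: "comm G (b [^] j) a = inv c [^] j"
    using comm_pow_left[OF b a] cc by (simp add: comm_ba)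
  have jZ: "inv c [^] j \<in> Z" using inv_c_Z by (intro subgroup_nat_pow_closed[OF Z_subgroup])
  then have "comm G a (b [^] j) \<in> Z"
    using comm_inverse[of "b [^] j" a] a b 1 Z_subgroup by (simp add: subgroup.m_inv_closed)
  moreover from this have "comm G (a [^] i) (b [^] j) = comm G a (b [^] j) [^] i"
    using a b Z_central by (intro comm_pow_left) auto
  ultimately have "comm G (a [^] i) (b [^] j) \<in> Z" by (simp add: subgroup_nat_pow_closed[OF Z_subgroup])
  then show ?thesis
    using comm_inverse[of "a [^] i" "b [^] j"] a b Z_subgroup by (simp add: subgroup.m_inv_closed)
qed

lemma elements: 
  assumes "g \<in> carrier G"
  obtains i j k :: nat where "g = a [^] i \<otimes> (b [^] j \<otimes> c [^] k)"
proof -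
  have "\<exists>(i::nat) (j::nat). \<exists>h\<in>Z. g = a [^] i \<otimes> (b [^] j \<otimes> h)"
  proof (rule decomposition_two_generators[OF finite_G Z_subgroup _ a b comm_pow_ba gen assms])
    show "inv g \<otimes> h \<otimes> g \<in> Z" if "h \<in> Z" "g \<in> carrier G" for h g
      using that Z_central[OF that] Z_carrier[OF that(1)] by (simp add: m_assoc) (simp add: m_assoc[symmetric])
  qed
  then show ?thesis using that by (auto simp: Z_def)
qed

text \<open>The commutator is multiplicative in its left argument once the values are central, so g
  is reduced to a and b by its normal form; antisymmetry does the same for h.\<close>

lemma comm_Z:
  assumes g: "g \<in> carrier G" and h: "h \<in> carrier G"
  shows "comm G g h \<in> Z"
proof -
  have gen_left: "comm G g h \<in> Z" if "comm G a h \<in> Z" "comm G b h \<in> Z" "g \<in> carrier G" "h \<in> carrier G" for g h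
  proof -
    obtain i j k :: nat where gijk: "g = a [^] i \<otimes> (b [^] j \<otimes> c [^] k)" using elements \<open>g \<in> carrier G\<close> by blast
    have 1: "comm G (a [^] i) h = comm G a h [^] i" "comm G (b [^] j) h = comm G b h [^] j"
      using that a b Z_central by (auto intro!: comm_pow_left)
    then have 2: "comm G (a [^] i) h \<in> Z" "comm G (b [^] j) h \<in> Z"
      using that by (auto simp: subgroup_nat_pow_closed[OF Z_subgroup])
    have 3: "comm G (c [^] k) h = \<one>" using c that c_pow_central by (simp add: comm_eq_one_iff)
    have "comm G g h = comm G (a [^] i) h \<otimes> (comm G (b [^] j) h \<otimes> comm G (c [^] k) h)"
      unfolding gijk using a b c that 2 Z_central by (simp add: comm_mult_left_central)
    then show ?thesis using 2 3 Z_subgroup by (simp add: subgroup.m_closed Z_carrier)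
  qed
  have sym: "comm G g h \<in> Z" if "comm G h g \<in> Z" "g \<in> carrier G" "h \<in> carrier G" for g h
    using that comm_inverse[of h g] Z_subgroup by (simp add: subgroup.m_inv_closed)
  have oneZ: "\<one> \<in> Z" using Z_subgroup by (rule subgroup.one_closed)
  have "comm G a a \<in> Z" "comm G b a \<in> Z" "comm G a b \<in> Z" "comm G b b \<in> Z"
    using a b oneZ c_pow_Z[of 1] c inv_c_Z comm_ba by (simp_all add: comm_self)
  then have "comm G h a \<in> Z" "comm G h b \<in> Z" using gen_left a b h by auto
  then show ?thesis using gen_left sym a b g h by blast
qed

lemma comm_mult_left_G:
  assumes "g \<in> carrier G" "g' \<in> carrier G" "h \<in> carrier G"
  shows "comm G (g \<otimes> g') h = comm G g h \<otimes> comm G g' h"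
  using assms comm_Z Z_central by (intro comm_mult_left_central) auto

lemma comm_pow_left_G:
  assumes "g \<in> carrier G" "h \<in> carrier G"
  shows "comm G (g [^] (n::nat)) h = comm G g h [^] n"
  using assms comm_Z Z_central by (intro comm_pow_left) auto

lemma pow_mult_G:
  assumes "g \<in> carrier G" "h \<in> carrier G"
  shows "(g \<otimes> h) [^] (n::nat) = g [^] n \<otimes> h [^] n \<otimes> comm G h g [^] (n choose 2)"
  using assms comm_Z Z_central by (intro pow_mult_class2) auto

text \<open>Reducing the exponents of a and b by their relations carries powers of c into the last
  factor, which is why k' depends on i and j as well as on k.\<close>

lemma normal_form:
  "\<exists>k'<p ^ \<gamma>. a [^] (i::nat) \<otimes> (b [^] (j::nat) \<otimes> c [^] (k::nat))
     = a [^] (i mod p ^ \<alpha>) \<otimes> (b [^] (j mod p ^ \<beta>) \<otimes> c [^] k')"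
proof -
  have am: "a [^] i = a [^] (i mod p ^ \<alpha>) \<otimes> c [^] (p ^ \<rho> * (i div p ^ \<alpha>))"
  proof -
    have "a [^] i = a [^] (i mod p ^ \<alpha> + p ^ \<alpha> * (i div p ^ \<alpha>))" by simp
    also have "\<dots> = a [^] (i mod p ^ \<alpha>) \<otimes> (a [^] (p ^ \<alpha>)) [^] (i div p ^ \<alpha>)"
      using a by (simp only: nat_pow_mult[symmetric] nat_pow_pow)
    finally show ?thesis using c by (simp add: a_pow nat_pow_pow)
  qed
  have bm: "b [^] j = b [^] (j mod p ^ \<beta>) \<otimes> c [^] (p ^ \<sigma> * (j div p ^ \<beta>))"
  proof -
    have "b [^] j = b [^] (j mod p ^ \<beta> + p ^ \<beta> * (j div p ^ \<beta>))" by simp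
    also have "\<dots> = b [^] (j mod p ^ \<beta>) \<otimes> (b [^] (p ^ \<beta>)) [^] (j div p ^ \<beta>)"
      using b by (simp only: nat_pow_mult[symmetric] nat_pow_pow)
    finally show ?thesis using c by (simp add: b_pow nat_pow_pow)
  qed
  define t where "t = p ^ \<rho> * (i div p ^ \<alpha>) + (p ^ \<sigma> * (j div p ^ \<beta>) + k)"
  have "c [^] t = c [^] (p ^ \<gamma> * (t div p ^ \<gamma>) + t mod p ^ \<gamma>)" by simp
  also have "\<dots> = (c [^] (p ^ \<gamma>)) [^] (t div p ^ \<gamma>) \<otimes> c [^] (t mod p ^ \<gamma>)"
    using c by (simp only: nat_pow_mult[symmetric] nat_pow_pow)
  also have "\<dots> = c [^] (t mod p ^ \<gamma>)" using c by (simp add: c_pow)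
  finally have ct: "c [^] t = c [^] (t mod p ^ \<gamma>)" .
  have "a [^] i \<otimes> (b [^] j \<otimes> c [^] k)
      = a [^] (i mod p ^ \<alpha>) \<otimes> (c [^] (p ^ \<rho> * (i div p ^ \<alpha>)) \<otimes> (b [^] (j mod p ^ \<beta>) \<otimes> (c [^] (p ^ \<sigma> * (j div p ^ \<beta>)) \<otimes> c [^] k)))"
    using a b c by (subst am, subst bm) (simp add: m_assoc)
  also have "c [^] (p ^ \<rho> * (i div p ^ \<alpha>)) \<otimes> (b [^] (j mod p ^ \<beta>) \<otimes> (c [^] (p ^ \<sigma> * (j div p ^ \<beta>)) \<otimes> c [^] k))
      = b [^] (j mod p ^ \<beta>) \<otimes> (c [^] (p ^ \<rho> * (i div p ^ \<alpha>)) \<otimes> (c [^] (p ^ \<sigma> * (j div p ^ \<beta>)) \<otimes> c [^] k))"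
    using b c c_pow_central[of "b [^] (j mod p ^ \<beta>)"] by (simp add: m_assoc[symmetric])
  also have "c [^] (p ^ \<rho> * (i div p ^ \<alpha>)) \<otimes> (c [^] (p ^ \<sigma> * (j div p ^ \<beta>)) \<otimes> c [^] k) = c [^] t"
    using c by (simp add: nat_pow_mult t_def)
  finally have "a [^] i \<otimes> (b [^] j \<otimes> c [^] k) = a [^] (i mod p ^ \<alpha>) \<otimes> (b [^] (j mod p ^ \<beta>) \<otimes> c [^] (t mod p ^ \<gamma>))"
    by (simp only: ct)
  moreover have "t mod p ^ \<gamma> < p ^ \<gamma>" using p_gt_1 by simp
  ultimately show ?thesis by blast
qed

definition nf where "nf = (\<lambda>(i, j, k). a [^] (i::nat) \<otimes> (b [^] (j::nat) \<otimes> c [^] (k::nat)))"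

abbreviation nf_indices where "nf_indices \<equiv> {..<p ^ \<alpha>} \<times> {..<p ^ \<beta>} \<times> {..<p ^ \<gamma>}"

text \<open>The normal forms reach every element, and there are as many of them as
  \<open>order_G\<close> prescribes, so they are distinct. Through this the order of G determines
  the order of c and the quotient G/<c>.\<close>

lemma nf_bij: "bij_betw nf nf_indices (carrier G)"
proof -
  have surj: "nf ` nf_indices = carrier G"
  proof (intro equalityI subsetI)
    fix g assume "g \<in> carrier G"
    then obtain i j k where "g = a [^] (i::nat) \<otimes> (b [^] (j::nat) \<otimes> c [^] (k::nat))" using elements by blast
    moreover obtain k' where "k' < p ^ \<gamma>" "a [^] i \<otimes> (b [^] j \<otimes> c [^] k)
        = a [^] (i mod p ^ \<alpha>) \<otimes> (b [^] (j mod p ^ \<beta>) \<otimes> c [^] k')" using normal_form by blast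
    ultimately have "g = nf (i mod p ^ \<alpha>, j mod p ^ \<beta>, k')" "(i mod p ^ \<alpha>, j mod p ^ \<beta>, k') \<in> nf_indices"
      using p_gt_1 by (auto simp: nf_def)
    then show "g \<in> nf ` nf_indices" by blast
  qed (use a b c in \<open>auto simp: nf_def\<close>)
  moreover have "card nf_indices = card (carrier G)"
    using order_G by (simp add: order_def power_add)
  ultimately have "inj_on nf nf_indices"
    by (intro eq_card_imp_inj_on) auto
  then show ?thesis using surj by (simp add: bij_betw_def)
qed

text \<open>Only the first two exponents are compared, because carries from a and b end in the power
  of c; they are the coordinates in G/<c>.\<close>

lemma nf_cong:
  assumes "a [^] (i::nat) \<otimes> (b [^] (j::nat) \<otimes> c [^] (k::nat)) = a [^] (i'::nat) \<otimes> (b [^] (j'::nat) \<otimes> c [^] (k'::nat))"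
  shows "[i = i'] (mod p ^ \<alpha>)" and "[j = j'] (mod p ^ \<beta>)"
proof -
  obtain t where t: "t < p ^ \<gamma>" "a [^] i \<otimes> (b [^] j \<otimes> c [^] k)
     = a [^] (i mod p ^ \<alpha>) \<otimes> (b [^] (j mod p ^ \<beta>) \<otimes> c [^] t)" using normal_form by blast
  obtain t' where t': "t' < p ^ \<gamma>" "a [^] i' \<otimes> (b [^] j' \<otimes> c [^] k')
     = a [^] (i' mod p ^ \<alpha>) \<otimes> (b [^] (j' mod p ^ \<beta>) \<otimes> c [^] t')" using normal_form by blast
  have "nf (i mod p ^ \<alpha>, j mod p ^ \<beta>, t) = nf (i' mod p ^ \<alpha>, j' mod p ^ \<beta>, t')"
    using t t' assms by (simp add: nf_def)
  then have "(i mod p ^ \<alpha>, j mod p ^ \<beta>, t) = (i' mod p ^ \<alpha>, j' mod p ^ \<beta>, t')"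
    by (rule inj_onD[OF bij_betw_imp_inj_on[OF nf_bij]]) (use t(1) t'(1) p_gt_1 in auto)
  then show "[i = i'] (mod p ^ \<alpha>)" "[j = j'] (mod p ^ \<beta>)" by (simp_all add: cong_def)
qed

lemma ord_c: "ord c = p ^ \<gamma>"
proof -
  have "ord c dvd p ^ \<gamma>" using pow_eq_id[OF c] c_pow by simp
  then have "ord c \<le> p ^ \<gamma>" using p_gt_1 by (intro dvd_imp_le) auto
  moreover have "\<not> ord c < p ^ \<gamma>"
  proof
    assume lt: "ord c < p ^ \<gamma>"
    have "nf (0, 0, ord c) = nf (0, 0, 0)" using c by (simp add: nf_def)
    then have "(0 :: nat, 0 :: nat, ord c) = (0, 0, 0)"
      by (rule inj_onD[OF bij_betw_imp_inj_on[OF nf_bij]]) (use lt p_gt_1 in auto)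
    then show False using ord_ge_1[OF finite_G c] by simp
  qed
  ultimately show ?thesis by simp
qed

lemma c_pow_eq_one_iff: "c [^] (k::nat) = \<one> \<longleftrightarrow> p ^ \<gamma> dvd k"
  using pow_eq_id[OF c] ord_c by simp

end

section \<open>The subgroups \<open>N \<delta>\<close> and \<open>H \<delta>\<close>, and the
  characters of level \<delta>\<close>

context two_generator_class_two
begin

definition N where "N \<delta> = generate G {c [^] (p ^ \<delta>)}"

text \<open>The preimage of the centre of \<open>G / N \<delta>\<close>; this description makes the radical condition
  immediate, and \<open>H_eq_generated\<close> recovers the generators of the paper.\<close>
definition H where "H \<delta> = {g \<in> carrier G. \<forall>h\<in>carrier G. comm G g h \<in> N \<delta>}"

lemma N_eq: "N \<delta> = {c [^] (p ^ \<delta> * k) | k. True}"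
  using generate_pow_on_finite_carrier[OF finite_G, of "c [^] (p ^ \<delta>)"] c by (simp add: N_def nat_pow_pow)

lemma N_subgroup: "subgroup (N \<delta>) G"
  unfolding N_def using c by (intro generate_is_subgroup) simp

lemma N_subset_Z: "N \<delta> \<subseteq> Z"
  by (auto simp: N_eq Z_def)

lemma c_pow_N_iff:
  assumes "\<delta> \<le> \<gamma>"
  shows "c [^] (k::nat) \<in> N \<delta> \<longleftrightarrow> p ^ \<delta> dvd k"
proof
  assume "c [^] k \<in> N \<delta>"
  then obtain t where t: "c [^] k = c [^] (p ^ \<delta> * t)" by (auto simp: N_eq)
  \<comment> \<open>A natural number standing for the exponent -p^\<delta> t: the two add up to a
    multiple of the order p^\<gamma> of c.\<close>
  let ?u = "(p ^ \<gamma> - 1) * (p ^ \<delta> * t)"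
  have "c [^] (k + ?u) = c [^] (p ^ \<delta> * t) \<otimes> c [^] ?u" using c by (simp add: nat_pow_mult[symmetric] t)
  also have "\<dots> = c [^] (p ^ \<delta> * t + ?u)" using c by (simp add: nat_pow_mult)
  also have "p ^ \<delta> * t + ?u = p ^ \<gamma> * (p ^ \<delta> * t)"
  proof -
    have "p ^ \<gamma> = Suc (p ^ \<gamma> - 1)" using p_gt_1 by simp
    then show ?thesis by (metis mult_Suc)
  qed
  also have "c [^] (p ^ \<gamma> * (p ^ \<delta> * t)) = \<one>" by (simp add: c_pow_eq_one_iff)
  finally have "p ^ \<gamma> dvd k + ?u" by (simp add: c_pow_eq_one_iff)
  then have "p ^ \<delta> dvd k + ?u" using assms le_imp_power_dvd dvd_trans by blast
  moreover have "p ^ \<delta> dvd ?u" by (simp add: dvd_mult)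
  ultimately show "p ^ \<delta> dvd k" using dvd_add_left_iff by blast
next
  assume "p ^ \<delta> dvd k"
  then show "c [^] k \<in> N \<delta>" by (auto simp: N_eq)
qed

lemma N_antimono: "\<delta>' \<le> \<delta> \<Longrightarrow> N \<delta> \<subseteq> N \<delta>'"
proof
  fix g assume "\<delta>' \<le> \<delta>" "g \<in> N \<delta>"
  then obtain k e where "g = c [^] (p ^ \<delta> * k)" "p ^ \<delta> = p ^ \<delta>' * e"
    using le_imp_power_dvd[of \<delta>' \<delta> p] by (auto simp: N_eq)
  then have "g = c [^] (p ^ \<delta>' * (e * k))" by (simp add: mult.assoc)
  then show "g \<in> N \<delta>'" unfolding N_eq by blast
qed

lemma N_0: "N 0 = Z"
  using c by (simp add: N_def Z_eq)

lemma N_\<gamma>: "N \<gamma> = {\<one>}"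
  using c by (auto simp: N_eq c_pow_eq_one_iff intro!: exI[of _ 0])

lemma H_subgroup: "subgroup (H \<delta>) G"
proof (rule finite_closed_subgroup[OF finite_G])
  show "\<one> \<in> H \<delta>" using N_subgroup subgroup.one_closed by (auto simp: H_def comm_def)
  show "x \<otimes> y \<in> H \<delta>" if "x \<in> H \<delta>" "y \<in> H \<delta>" for x y
    using that N_subgroup by (auto simp: H_def comm_mult_left_G subgroup.m_closed)
qed (auto simp: H_def)

lemma H_carrier: "g \<in> H \<delta> \<Longrightarrow> g \<in> carrier G"
  by (simp add: H_def)

lemma Z_subset_H: "Z \<subseteq> H \<delta>"
proof
  fix z assume z: "z \<in> Z"
  then have "comm G z h = \<one>" if "h \<in> carrier G" for h
    using that Z_central Z_carrier comm_eq_one_iff by blast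
  then show "z \<in> H \<delta>" using z Z_carrier subgroup.one_closed[OF N_subgroup] by (simp add: H_def)
qed

lemma pow_in_H:
  assumes "g \<in> carrier G"
  shows "g [^] (p ^ \<delta>) \<in> H \<delta>"
proof -
  have "comm G (g [^] (p ^ \<delta>)) h \<in> N \<delta>" if h: "h \<in> carrier G" for h
  proof -
    obtain k :: nat where "comm G g h = c [^] k" using comm_Z[OF assms h] by (auto simp: Z_def)
    then have "comm G (g [^] (p ^ \<delta>)) h = c [^] (p ^ \<delta> * k)"
      using assms h c by (simp add: comm_pow_left_G nat_pow_pow mult.commute)
    then show ?thesis by (auto simp: N_eq)
  qed
  then show ?thesis using assms by (simp add: H_def)
qed

lemma comm_nf_a: "comm G (a [^] (i::nat) \<otimes> (b [^] (j::nat) \<otimes> c [^] (k::nat))) a = inv c [^] j"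
  and comm_nf_b: "comm G (a [^] (i::nat) \<otimes> (b [^] (j::nat) \<otimes> c [^] (k::nat))) b = c [^] i"
proof -
  have ck: "comm G (c [^] k) h = \<one>" if "h \<in> carrier G" for h
    using that c c_pow_central by (simp add: comm_eq_one_iff)
  show "comm G (a [^] i \<otimes> (b [^] j \<otimes> c [^] k)) a = inv c [^] j"
    using a b c ck[OF a] by (simp add: comm_mult_left_G comm_pow_left_G comm_self comm_ba)
  show "comm G (a [^] i \<otimes> (b [^] j \<otimes> c [^] k)) b = c [^] i"
    using a b c ck[OF b] by (simp add: comm_mult_left_G comm_pow_left_G comm_self)
qed

text \<open>Modulo \<open>N \<delta>\<close> the commutator with b detects i and the commutator with
  a detects j.\<close>

lemma nf_in_H_iff:
  assumes "\<delta> \<le> \<gamma>"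
  shows "a [^] (i::nat) \<otimes> (b [^] (j::nat) \<otimes> c [^] (k::nat)) \<in> H \<delta> \<longleftrightarrow> p ^ \<delta> dvd i \<and> p ^ \<delta> dvd j"
proof
  assume h: "a [^] i \<otimes> (b [^] j \<otimes> c [^] k) \<in> H \<delta>"
  have "c [^] i \<in> N \<delta>" using h b comm_nf_b[of i j k] by (auto simp: H_def)
  moreover have "inv c [^] j \<in> N \<delta>" using h a comm_nf_a[of i j k] by (auto simp: H_def)
  then have "inv (inv c [^] j) \<in> N \<delta>" using N_subgroup by (intro subgroup.m_inv_closed)
  then have "c [^] j \<in> N \<delta>" using c by (simp add: nat_pow_inv[symmetric])
  ultimately show "p ^ \<delta> dvd i \<and> p ^ \<delta> dvd j" using c_pow_N_iff[OF assms] by blast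
next
  assume "p ^ \<delta> dvd i \<and> p ^ \<delta> dvd j"
  then obtain s t where st: "i = p ^ \<delta> * s" "j = p ^ \<delta> * t" by blast
  have "a [^] i \<in> H \<delta>" using subgroup_nat_pow_closed[OF H_subgroup pow_in_H[OF a], of \<delta> s] a st by (simp add: nat_pow_pow)
  moreover have "b [^] j \<in> H \<delta>" using subgroup_nat_pow_closed[OF H_subgroup pow_in_H[OF b], of \<delta> t] b st by (simp add: nat_pow_pow)
  moreover have "c [^] k \<in> H \<delta>" using c_pow_Z Z_subset_H by blast
  ultimately show "a [^] i \<otimes> (b [^] j \<otimes> c [^] k) \<in> H \<delta>" using H_subgroup by (simp add: subgroup.m_closed)
qed

lemma H_eq_generated:
  assumes "\<delta> \<le> \<gamma>"
  shows "H \<delta> = carrier (subgroup_generated G {a [^] (p ^ \<delta>), b [^] (p ^ \<delta>), c})"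
proof -
  let ?S = "{a [^] (p ^ \<delta>), b [^] (p ^ \<delta>), c}"
  have S: "carrier (subgroup_generated G ?S) = generate G ?S"
    using a b c by (simp add: carrier_subgroup_generated)
  have sub: "subgroup (generate G ?S) G" using a b c by (intro generate_is_subgroup) auto
  have "c \<in> H \<delta>" using c_pow_Z[of 1] c Z_subset_H by auto
  then have "generate G ?S \<subseteq> H \<delta>"
    using pow_in_H a b by (intro generate_subgroup_incl H_subgroup) auto
  moreover have "H \<delta> \<subseteq> generate G ?S"
  proof
    fix g assume g: "g \<in> H \<delta>"
    then obtain i j k :: nat where e: "g = a [^] i \<otimes> (b [^] j \<otimes> c [^] k)" using elements H_carrier by metis
    then obtain s t where st: "i = p ^ \<delta> * s" "j = p ^ \<delta> * t" using g nf_in_H_iff[OF assms] by blast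
    have "a [^] (p ^ \<delta>) \<in> generate G ?S" "b [^] (p ^ \<delta>) \<in> generate G ?S" "c \<in> generate G ?S"
      by (rule generate.incl, simp)+
    from this[THEN subgroup_nat_pow_closed[OF sub]]
    have "(a [^] (p ^ \<delta>)) [^] s \<in> generate G ?S" "(b [^] (p ^ \<delta>)) [^] t \<in> generate G ?S" "c [^] k \<in> generate G ?S"
      by simp_all
    then show "g \<in> generate G ?S"
      unfolding e st using sub a b by (simp add: subgroup.m_closed nat_pow_pow)
  qed
  ultimately show ?thesis using S by blast
qed

text \<open>Used with \<delta>' = \<delta> and with \<delta>' = \<delta> - 1. The groups
  \<open>N\<close> shrink as the index grows, so the commutators of \<open>H \<delta>\<close> lie in
  both.\<close>

lemma H_N_section:
  assumes "\<delta>' \<le> \<delta>"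
  shows "abelian_section G (H \<delta>) (N \<delta>')"
proof (intro abelian_section.intro abelian_section_axioms.intro is_group)
  show "finite (carrier G)" by (rule finite_G)
  show "subgroup (H \<delta>) G" "subgroup (N \<delta>') G" by (rule H_subgroup N_subgroup)+
  show "N \<delta>' \<subseteq> H \<delta>" using N_subset_Z Z_subset_H by blast
  fix x y assume xy: "x \<in> H \<delta>" "y \<in> H \<delta>"
  \<comment> \<open>The locale uses x y x^-1 y^-1, which is \<open>comm\<close> at the
    inverses.\<close>
  then have "inv x \<in> H \<delta>" using H_subgroup by (simp add: subgroup.m_inv_closed)
  then have "comm G (inv x) (inv y) \<in> N \<delta>" using H_carrier[OF xy(2)] by (simp add: H_def)
  moreover have "comm G (inv x) (inv y) = x \<otimes> y \<otimes> inv x \<otimes> inv y" using xy H_carrier by (simp add: comm_def)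
  ultimately show "x \<otimes> y \<otimes> inv x \<otimes> inv y \<in> N \<delta>'" using N_antimono[OF assms] by auto
qed

lemma card_N:
  assumes "\<delta> \<le> \<gamma>"
  shows "card (N \<delta>) = p ^ (\<gamma> - \<delta>)"
proof -
  have "p ^ \<delta> dvd p ^ \<gamma>" using assms by (rule le_imp_power_dvd)
  then have "gcd (p ^ \<gamma>) (p ^ \<delta>) = p ^ \<delta>" by (simp add: gcd_nat.absorb2)
  then have "ord (c [^] (p ^ \<delta>)) = p ^ (\<gamma> - \<delta>)"
    using ord_pow_gen[OF c, of "p ^ \<delta>"] ord_c p_gt_1 assms by (simp add: power_diff)
  then show ?thesis using generate_pow_card[of "c [^] (p ^ \<delta>)"] c by (simp add: N_def)
qed

text \<open>\<open>H \<delta>\<close> consists of the normal forms whose exponents of a and b are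
  multiples of p^\<delta>, so its index is p^(2\<delta>).\<close>

lemma card_H:
  assumes d: "\<delta> \<le> \<gamma>"
  shows "p ^ (2 * \<delta>) * card (H \<delta>) = p ^ (\<alpha> + \<beta> + \<gamma>)"
proof -
  let ?I = "{..<p ^ (\<alpha> - \<delta>)} \<times> {..<p ^ (\<beta> - \<delta>)} \<times> {..<p ^ \<gamma>}"
  have da: "\<delta> \<le> \<alpha>" "\<delta> \<le> \<beta>" using d \<alpha>\<beta> \<beta>\<gamma> by auto
  have pa: "p ^ \<alpha> = p ^ \<delta> * p ^ (\<alpha> - \<delta>)" "p ^ \<beta> = p ^ \<delta> * p ^ (\<beta> - \<delta>)"
    using da by (simp_all add: power_add[symmetric])
  have p0: "p ^ \<delta> > 0" using p_gt_1 by simp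
  define f where "f = (\<lambda>(i, j, k). (p ^ \<delta> * i, p ^ \<delta> * j, k :: nat))"
  have lt: "p ^ \<delta> * i < p ^ \<alpha> \<longleftrightarrow> i < p ^ (\<alpha> - \<delta>)" "p ^ \<delta> * i < p ^ \<beta> \<longleftrightarrow> i < p ^ (\<beta> - \<delta>)" for i
    unfolding pa using p0 by (simp_all only: nat_mult_less_cancel1)
  have f_ran: "f ` ?I \<subseteq> nf_indices" by (auto simp: f_def lt)
  have "inj_on f ?I" using p0 by (auto simp: f_def inj_on_def)
  moreover have "inj_on nf (f ` ?I)" using f_ran bij_betw_imp_inj_on[OF nf_bij] by (rule inj_on_subset[rotated])
  ultimately have inj: "inj_on (nf \<circ> f) ?I" by (rule comp_inj_on)
  have "(nf \<circ> f) ` ?I = H \<delta>"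
  proof (intro equalityI subsetI)
    fix g assume "g \<in> (nf \<circ> f) ` ?I"
    then show "g \<in> H \<delta>" using nf_in_H_iff[OF d] by (auto simp: nf_def f_def)
  next
    fix g assume g: "g \<in> H \<delta>"
    then obtain i j k where ijk: "(i, j, k) \<in> nf_indices" "g = nf (i, j, k)"
      using H_carrier bij_betw_imp_surj_on[OF nf_bij] by blast
    then have "p ^ \<delta> dvd i" "p ^ \<delta> dvd j" using g nf_in_H_iff[OF d] by (simp_all add: nf_def)
    then obtain s t where st: "i = p ^ \<delta> * s" "j = p ^ \<delta> * t" by blast
    then have "(s, t, k) \<in> ?I" using ijk(1) by (simp add: lt)
    moreover have "g = (nf \<circ> f) (s, t, k)" using ijk(2) st by (simp add: f_def)
    ultimately show "g \<in> (nf \<circ> f) ` ?I" by blast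
  qed
  then have "card (H \<delta>) = p ^ (\<alpha> - \<delta>) * (p ^ (\<beta> - \<delta>) * p ^ \<gamma>)"
    using card_image[OF inj] by simp
  moreover have "p ^ (2 * \<delta>) = p ^ \<delta> * p ^ \<delta>" by (simp add: mult_2 power_add)
  ultimately show ?thesis by (simp add: power_add pa mult_ac)
qed

text \<open>By \<open>level_char_c\<close>, these are the characters whose value at \<open>c\<close> has exact order \<open>p ^ \<delta>\<close>.\<close>
definition level_chars where
  "level_chars \<delta> = linear_chars G (H \<delta>) (N \<delta>) - (if \<delta> = 0 then {} else linear_chars G (H \<delta>) (N (\<delta> - 1)))"

lemma level_charD: "\<psi> \<in> level_chars \<delta> \<Longrightarrow> \<psi> \<in> linear_chars G (H \<delta>) (N \<delta>)"
  by (simp add: level_chars_def)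

lemma char_c_pow:
  assumes "\<psi> \<in> linear_chars G (H \<delta>) (N \<delta>)"
  shows "\<psi> (c [^] (k::nat)) = \<psi> c ^ k"
proof -
  interpret abelian_section G "H \<delta>" "N \<delta>" by (rule H_N_section) simp
  have "c \<in> H \<delta>" using c_pow_Z[of 1] c Z_subset_H by auto
  then show ?thesis using assms by (intro char_pow)
qed

lemma level_char_c:
  assumes \<psi>: "\<psi> \<in> level_chars \<delta>" and d: "\<delta> \<le> \<gamma>"
  shows "\<psi> c ^ k = 1 \<longleftrightarrow> p ^ \<delta> dvd k"
proof (rule prime_power_root_of_unity_order[OF p])
  note \<psi>' = level_charD[OF \<psi>]
  have "c [^] (p ^ \<delta>) \<in> N \<delta>" using c_pow_N_iff[OF d] by simp
  then show "\<psi> c ^ (p ^ \<delta>) = 1" using char_c_pow[OF \<psi>'] linear_charsD(2)[OF \<psi>'] by metis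
  show "\<psi> c ^ (p ^ (\<delta> - 1)) \<noteq> 1" if "\<delta> > 0"
  proof
    assume one: "\<psi> c ^ (p ^ (\<delta> - 1)) = 1"
    have "\<psi> g = 1" if g: "g \<in> N (\<delta> - 1)" for g
    proof -
      obtain k where "g = c [^] (p ^ (\<delta> - 1) * k)" using g by (auto simp: N_eq)
      then show ?thesis using char_c_pow[OF \<psi>'] one by (simp add: power_mult)
    qed
    then have "\<psi> \<in> linear_chars G (H \<delta>) (N (\<delta> - 1))" using \<psi>' by (simp add: linear_chars_def)
    then show False using \<psi> that by (simp add: level_chars_def)
  qed
qed

lemma finite_level_chars: "finite (level_chars \<delta>)"
proof -
  interpret abelian_section G "H \<delta>" "N \<delta>" by (rule H_N_section) simp
  show ?thesis unfolding level_chars_def using finite_linear_chars by simp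
qed

text \<open>The value does not depend on \<delta>, since p^(2\<delta>) |H \<delta>| = |G|. This is
  what makes the levels telescope: the characters removed at level \<delta>, those trivial on
  \<open>N (\<delta> - 1)\<close>, cancel the full sum of level \<delta> - 1.\<close>

lemma sum_linear_chars:
  assumes d: "\<delta> \<le> \<gamma>" and d': "\<delta>' \<le> \<delta>" "\<delta> \<le> Suc \<delta>'"
  shows "of_nat (p ^ (2 * \<delta>)) * (\<Sum>\<psi>\<in>linear_chars G (H \<delta>) (N \<delta>'). \<psi> g)
    = (if g \<in> N \<delta>' then of_nat (p ^ (\<alpha> + \<beta> + \<delta>')) else 0 :: complex)"
proof -
  interpret abelian_section G "H \<delta>" "N \<delta>'" by (rule H_N_section[OF d'(1)])
  show ?thesis
  proof (cases "g \<in> N \<delta>'")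
    case True
    then have "g \<in> H \<delta>" using N_H by blast
    have g': "\<delta>' \<le> \<gamma>" using d d' by simp
    have pg: "p ^ (\<gamma> - \<delta>') \<noteq> 0" using p_gt_1 by simp
    have "p ^ (2 * \<delta>) * card (linear_chars G (H \<delta>) (N \<delta>')) * p ^ (\<gamma> - \<delta>') = p ^ (\<alpha> + \<beta> + \<gamma>)"
      using card_linear_chars card_H[OF d] by (simp add: card_N[OF g'] mult.assoc)
    also have "\<alpha> + \<beta> + \<gamma> = (\<alpha> + \<beta> + \<delta>') + (\<gamma> - \<delta>')" using g' by simp
    also have "p ^ \<dots> = p ^ (\<alpha> + \<beta> + \<delta>') * p ^ (\<gamma> - \<delta>')" by (rule power_add)
    finally have "p ^ (2 * \<delta>) * card (linear_chars G (H \<delta>) (N \<delta>')) = p ^ (\<alpha> + \<beta> + \<delta>')"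
      using pg by (auto simp only: mult_cancel2)
    then show ?thesis using sum_chars[OF \<open>g \<in> H \<delta>\<close>] True by (simp only: of_nat_mult[symmetric] if_True)
  next
    case False
    then show ?thesis
      using sum_chars[of g] linear_charsD(3)[of _ G "H \<delta>" "N \<delta>'" g]
      by (cases "g \<in> H \<delta>") (simp_all add: sum.neutral)
  qed
qed

text \<open>The weight p^(2\<delta>) is the degree p^\<delta> times the factor p^\<delta> in the
  trace, so this is the decomposition of the regular character. Only \<open>T \<gamma>\<close>
  survives, and \<open>N \<gamma>\<close> is trivial.\<close>

lemma sum_level_chars:
  "(\<Sum>\<delta>\<le>\<gamma>. of_nat (p ^ (2 * \<delta>)) * (\<Sum>\<psi>\<in>level_chars \<delta>. \<psi> g)) = (if g = \<one> then of_nat (order G) else 0 :: complex)"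
proof -
  define T where "T = (\<lambda>\<delta>. if g \<in> N \<delta> then of_nat (p ^ (\<alpha> + \<beta> + \<delta>)) else 0 :: complex)"
  have step: "of_nat (p ^ (2 * \<delta>)) * (\<Sum>\<psi>\<in>level_chars \<delta>. \<psi> g) = T \<delta> - (if \<delta> = 0 then 0 else T (\<delta> - 1))"
    if d: "\<delta> \<le> \<gamma>" for \<delta>
  proof (cases "\<delta> = 0")
    case True
    then show ?thesis using sum_linear_chars[of 0 0 g] by (simp add: level_chars_def T_def)
  next
    case False
    interpret abelian_section G "H \<delta>" "N \<delta>" by (rule H_N_section) simp
    have "linear_chars G (H \<delta>) (N (\<delta> - 1)) \<subseteq> linear_chars G (H \<delta>) (N \<delta>)"
      using N_antimono[of "\<delta> - 1" \<delta>] by (auto simp: linear_chars_def)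
    then have "(\<Sum>\<psi>\<in>level_chars \<delta>. \<psi> g)
        = (\<Sum>\<psi>\<in>linear_chars G (H \<delta>) (N \<delta>). \<psi> g) - (\<Sum>\<psi>\<in>linear_chars G (H \<delta>) (N (\<delta> - 1)). \<psi> g)"
      using False finite_linear_chars by (simp add: level_chars_def sum_diff)
    then show ?thesis
      using False sum_linear_chars[OF d, of \<delta> g] sum_linear_chars[OF d, of "\<delta> - 1" g]
      by (simp add: T_def right_diff_distrib)
  qed
  have "(\<Sum>\<delta>\<le>n. T \<delta> - (if \<delta> = 0 then 0 else T (\<delta> - 1))) = T n" for n
    by (induction n) auto
  then have "(\<Sum>\<delta>\<le>\<gamma>. of_nat (p ^ (2 * \<delta>)) * (\<Sum>\<psi>\<in>level_chars \<delta>. \<psi> g)) = T \<gamma>"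
    using step by simp
  then show ?thesis by (simp add: T_def N_\<gamma> order_G)
qed

text \<open>Here the oddness of p enters: p^\<delta> - 1 is even. For p = 2 and \<delta> \<ge> 1 the
  divisibility fails.\<close>

lemma prime_power_dvd_choose_two: "p ^ \<delta> dvd p ^ \<delta> choose 2"
proof -
  have "even (p ^ \<delta> - 1)" using odd_p by simp
  then obtain e where "p ^ \<delta> - 1 = 2 * e" by blast
  then have "p ^ \<delta> choose 2 = p ^ \<delta> * e" by (simp add: choose_two)
  then show ?thesis by simp
qed

text \<open>Stated for an arbitrary pair of generators, to be applied to (a, b) and to (b, a).
  Replacing y by y x^f changes neither the commutator with x nor the group generated, and f is
  chosen to cancel \<psi>(y^(p^\<delta>)).\<close>

lemma level_rep_generators:
  assumes \<psi>: "\<psi> \<in> level_chars \<delta>" and d: "\<delta> \<le> \<gamma>" and l: "\<And>h. h \<in> H \<delta> \<Longrightarrow> \<psi> h ^ (p ^ l) = 1"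
    and x: "x \<in> carrier G" and y: "y \<in> carrier G" and xy: "generate G {x, y} = carrier G"
    and eps: "\<And>k. \<psi> (comm G x y) ^ k = 1 \<longleftrightarrow> p ^ \<delta> dvd k"
    and comparable: "\<psi> (y [^] (p ^ \<delta>)) = \<psi> (x [^] (p ^ \<delta>)) ^ e"
  shows "\<exists>\<rho>. cyclo_rep G (p ^ \<delta>) (p ^ l) \<rho> \<and> (\<forall>g\<in>carrier G. (\<Sum>i<p ^ \<delta>. \<rho> g (i, i)) = of_nat (p ^ \<delta>) * \<psi> g)"
proof -
  interpret abelian_section G "H \<delta>" "N \<delta>" by (rule H_N_section) simp
  note \<psi>' = level_charD[OF \<psi>]
  \<comment> \<open>Modulo \<open>p ^ l\<close> the exponent is \<open>- e\<close>, so \<open>\<psi>\<close> kills the \<open>p ^ \<delta>\<close>-th power of \<open>y'\<close>.\<close>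
  define f where "f = (p ^ l - 1) * e"
  define y' where "y' = y \<otimes> x [^] f"
  have y': "y' \<in> carrier G" using x y by (simp add: y'_def)
  have commH: "comm G g h \<in> H \<delta>" if "g \<in> carrier G" "h \<in> carrier G" for g h
    using comm_Z[OF that] Z_subset_H by blast
  have pl: "p ^ l = Suc (p ^ l - 1)" using p_gt_1 by simp
  have "comm G x y' = comm G x y"
  proof -
    have "comm G y' x = comm G y x" using x y by (simp add: y'_def comm_mult_left_G comm_pow_left_G comm_self comm_closed)
    then show ?thesis using comm_inverse[of y' x] comm_inverse[of y x] x y y' by simp
  qed
  have xyd: "x [^] (p ^ \<delta>) \<in> H \<delta>" "y [^] (p ^ \<delta>) \<in> H \<delta>" using x y pow_in_H by auto
  have y'q: "\<psi> (y' [^] (p ^ \<delta>)) = 1"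
  proof -
    \<comment> \<open>The correction term of the class-two power formula; its exponent is divisible
      by p^\<delta>, so it lies in \<open>N \<delta>\<close>, on which \<psi> is trivial.\<close>
    define w where "w = comm G (x [^] f) y [^] (p ^ \<delta> choose 2)"
    obtain k :: nat where k: "comm G (x [^] f) y = c [^] k" using comm_Z[of "x [^] f" y] x y by (auto simp: Z_def)
    have "w = c [^] (k * (p ^ \<delta> choose 2))" using c by (simp add: w_def k nat_pow_pow)
    then have "w \<in> N \<delta>" using c_pow_N_iff[OF d] prime_power_dvd_choose_two by (simp add: dvd_mult)
    then have w: "w \<in> H \<delta>" "\<psi> w = 1" using N_H linear_charsD(2)[OF \<psi>'] by auto
    have "y' [^] (p ^ \<delta>) = y [^] (p ^ \<delta>) \<otimes> (x [^] (p ^ \<delta>)) [^] f \<otimes> w"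
      unfolding y'_def using x y by (simp add: pow_mult_G w_def nat_pow_pow mult.commute)
    moreover have "(x [^] (p ^ \<delta>)) [^] f \<in> H \<delta>"
      by (rule subgroup_nat_pow_closed[OF H_subgroup xyd(1)])
    moreover have "\<psi> (u \<otimes> v \<otimes> w) = \<psi> u * \<psi> v * \<psi> w" if "u \<in> H \<delta>" "v \<in> H \<delta>" "w \<in> H \<delta>" for u v w
      using that by (simp add: linear_charsD(1)[OF \<psi>'] subgroup.m_closed[OF H_subgroup])
    moreover have "\<psi> ((x [^] (p ^ \<delta>)) [^] f) = \<psi> (x [^] (p ^ \<delta>)) ^ f" by (rule char_pow[OF \<psi>' xyd(1)])
    ultimately have "\<psi> (y' [^] (p ^ \<delta>)) = \<psi> (y [^] (p ^ \<delta>)) * \<psi> (x [^] (p ^ \<delta>)) ^ f"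
      using xyd w by (simp only: mult_1_right)
    also have "\<dots> = \<psi> (x [^] (p ^ \<delta>)) ^ (e + (p ^ l - 1) * e)" by (simp add: comparable power_add f_def)
    also have "e + (p ^ l - 1) * e = p ^ l * e" using pl by (metis mult_Suc)
    also have "\<psi> (x [^] (p ^ \<delta>)) ^ (p ^ l * e) = 1" using l[OF xyd(1)] by (simp add: power_mult)
    finally show ?thesis .
  qed
  have gen': "generate G {x, y'} = carrier G"
  proof
    show "generate G {x, y'} \<subseteq> carrier G" using x y' by (intro generate_incl) auto
    have sub: "subgroup (generate G {x, y'}) G" using x y' by (intro generate_is_subgroup) auto
    have xin: "x \<in> generate G {x, y'}" and y'in: "y' \<in> generate G {x, y'}" by (auto intro: generate.incl)
    have "y = y' \<otimes> inv (x [^] f)" using x y by (simp add: y'_def m_assoc)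
    also have "\<dots> \<in> generate G {x, y'}"
      using sub xin y'in by (intro subgroup.m_closed subgroup.m_inv_closed subgroup_nat_pow_closed) auto
    finally have "generate G {x, y} \<subseteq> generate G {x, y'}"
      using sub xin by (intro generate_subgroup_incl) auto
    then show "carrier G \<subseteq> generate G {x, y'}" using xy by simp
  qed
  interpret symplectic_pair G "H \<delta>" \<psi> x y' "p ^ \<delta>" "p ^ l"
  proof (intro symplectic_pair.intro symplectic_pair_axioms.intro is_group)
    show "comm G g h \<otimes> k = k \<otimes> comm G g h" if "g \<in> carrier G" "h \<in> carrier G" "k \<in> carrier G" for g h k
      using comm_Z[OF that(1,2)] Z_central that(3) by blast
    show "g \<in> H \<delta> \<longleftrightarrow> (\<forall>h\<in>carrier G. \<psi> (comm G g h) = 1)" if g: "g \<in> carrier G" for g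
    proof -
      have "comm G g h \<in> N \<delta> \<longleftrightarrow> \<psi> (comm G g h) = 1" if h: "h \<in> carrier G" for h
      proof -
        obtain k :: nat where "comm G g h = c [^] k" using comm_Z[OF g h] by (auto simp: Z_def)
        then show ?thesis using c_pow_N_iff[OF d] char_c_pow[OF \<psi>'] level_char_c[OF \<psi> d] by simp
      qed
      then show ?thesis using g by (simp add: H_def)
    qed
    show "\<exists>(i::nat) (j::nat). \<exists>h\<in>H \<delta>. g = x [^] i \<otimes> (y' [^] j \<otimes> h)" if "g \<in> carrier G" for g
    proof (rule decomposition_two_generators[OF finite_G H_subgroup _ x y' _ gen' that])
      show "inv g \<otimes> h \<otimes> g \<in> H \<delta>" if "h \<in> H \<delta>" "g \<in> carrier G" for h g
        using mult_comm(2)[OF H_carrier[OF that(1)] that(2)] commH[OF H_carrier[OF that(1)] that(2)] that(1)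
        by (simp add: subgroup.m_closed[OF H_subgroup])
      show "comm G (y' [^] j) (x [^] i) \<in> H \<delta>" for i j :: nat using commH x y' by simp
    qed
    show "\<psi> (comm G x y') ^ k = 1 \<longleftrightarrow> p ^ \<delta> dvd k" for k using eps \<open>comm G x y' = comm G x y\<close> by simp
    show "\<psi> \<one> = 1" using char_one[OF \<psi>'] .
    show "y' [^] (p ^ \<delta>) \<in> H \<delta>" using pow_in_H y' by blast
  qed (use finite_G H_subgroup commH linear_charsD[OF \<psi>'] p_gt_1 l x y' y'q in auto)
  show ?thesis by (rule rep_exists)
qed

text \<open>Whichever of the values of \<psi> at the p^\<delta>-th powers of a and b is a power of
  the other decides which generator is corrected.\<close>

lemma level_rep_exists:
  assumes \<psi>: "\<psi> \<in> level_chars \<delta>" and d: "\<delta> \<le> \<gamma>" and l: "\<And>h. h \<in> H \<delta> \<Longrightarrow> \<psi> h ^ (p ^ l) = 1"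
  shows "\<exists>\<rho>. cyclo_rep G (p ^ \<delta>) (p ^ l) \<rho> \<and> (\<forall>g\<in>carrier G. (\<Sum>i<p ^ \<delta>. \<rho> g (i, i)) = of_nat (p ^ \<delta>) * \<psi> g)"
proof -
  interpret abelian_section G "H \<delta>" "N \<delta>" by (rule H_N_section) simp
  note \<psi>' = level_charD[OF \<psi>]
  let ?u = "\<psi> (a [^] (p ^ \<delta>))" and ?v = "\<psi> (b [^] (p ^ \<delta>))"
  have "?u ^ (p ^ l) = 1" "?v ^ (p ^ l) = 1" using l pow_in_H a b by auto
  then consider e where "?v = ?u ^ e" | e where "?u = ?v ^ e"
    using prime_power_roots_of_unity_comparable[OF p] by blast
  then show ?thesis
  proof cases
    case 1
    then show ?thesis using level_rep_generators[OF \<psi> d l a b gen level_char_c[OF \<psi> d]] by blast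
  next
    \<comment> \<open>With the generators exchanged the pairing takes the value \<psi>(c)^-1, which
      has the same order.\<close>
    case 2
    have cH: "c \<in> H \<delta>" "inv c \<in> H \<delta>" using c_pow_Z[of 1] c Z_subset_H inv_c_Z by auto
    then have "\<psi> c * \<psi> (inv c) = 1" using linear_charsD(1)[OF \<psi>' cH] c char_one[OF \<psi>'] by simp
    then have inv: "\<psi> c ^ k * \<psi> (inv c) ^ k = 1" for k by (simp add: power_mult_distrib[symmetric])
    have "\<psi> (comm G b a) ^ k = 1 \<longleftrightarrow> p ^ \<delta> dvd k" for k
      unfolding comm_ba using inv[of k] level_char_c[OF \<psi> d, of k] by (metis mult_1 mult_1_right)
    moreover have "generate G {b, a} = carrier G" using gen by (simp add: insert_commute)
    ultimately show ?thesis using level_rep_generators[OF \<psi> d l b a _ _ 2] by blast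
  qed
qed

end

text \<open>The p^l-torsion of Z/p^n, which is generated by p^(n - min l n).\<close>

lemma card_multiples_dividing:
  fixes p :: nat
  assumes p: "p > 0"
  shows "card {i. i < p ^ n \<and> p ^ n dvd i * p ^ l} = p ^ min l n"
proof -
  define k where "k = n - min l n"
  have nk: "p ^ n = p ^ k * p ^ min l n" by (simp add: k_def power_add[symmetric])
  have dvd: "p ^ n dvd i * p ^ l \<longleftrightarrow> p ^ k dvd i" for i
  proof (cases "l \<le> n")
    case True
    then show ?thesis using p by (simp add: nk min_absorb1)
  next
    case False
    then have "k = 0" "p ^ n dvd p ^ l" by (simp_all add: k_def le_imp_power_dvd)
    then show ?thesis by (simp add: dvd_mult)
  qed
  have "{i. i < p ^ n \<and> p ^ n dvd i * p ^ l} = (\<lambda>j. p ^ k * j) ` {..<p ^ min l n}"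
    unfolding dvd using p by (auto simp: nk)
  moreover have "inj_on (\<lambda>j. p ^ k * j) {..<p ^ min l n}" using p by (simp add: inj_on_def)
  ultimately show ?thesis by (simp add: card_image)
qed

lemma root_of_unity_coprime_orders:
  fixes z :: complex
  assumes "z ^ r = 1" "z ^ m = 1" "coprime r m" "r > 0"
  shows "z = 1"
proof -
  obtain u v where uv: "r * u = m * v + 1" using bezout_nat[of r m] assms(3,4) by auto
  have "z ^ (m * v + 1) = (z ^ m) ^ v * z" by (simp add: power_add power_mult)
  then have "z ^ (r * u) = z" using assms(2) by (simp add: uv)
  then show ?thesis using assms(1) by (simp add: power_mult)
qed

context abelian_section
begin

lemma char_in_chars_of_order:
  assumes \<chi>: "\<chi> \<in> torsion_chars (p ^ M)"
  obtains l where "l \<le> M" "\<chi> \<in> chars_of_order p l"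
proof -
  define l where "l = (LEAST l. \<chi> \<in> torsion_chars (p ^ l))"
  have "\<chi> \<in> torsion_chars (p ^ l)" unfolding l_def using \<chi> by (rule LeastI)
  moreover have "\<chi> \<notin> torsion_chars (p ^ k)" if "k < l" for k using that unfolding l_def by (rule not_less_Least)
  ultimately have "\<chi> \<in> chars_of_order p l" by (simp add: chars_of_order_def)
  moreover have "l \<le> M" unfolding l_def using \<chi> by (rule Least_le)
  ultimately show ?thesis using that by blast
qed

lemma chars_of_order_disjoint:
  assumes "l \<noteq> l'"
  shows "chars_of_order p l \<inter> chars_of_order p l' = {}"
  using assms by (cases "l < l'") (auto simp: chars_of_order_def)

lemma chars_of_order_power:
  assumes \<chi>: "\<chi> \<in> chars_of_order p l" and r: "r > 0" "coprime r (p ^ l)"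
  shows "(\<lambda>h. \<chi> h ^ r) \<in> chars_of_order p l"
proof -
  have t: "\<chi> \<in> torsion_chars (p ^ l)" using \<chi> by (simp add: chars_of_order_def)
  then have lin: "\<chi> \<in> linear_chars G H N" and root: "\<And>h. h \<in> H \<Longrightarrow> \<chi> h ^ (p ^ l) = 1"
    by (auto simp: torsion_chars_def)
  have "(\<chi> h ^ r) ^ (p ^ l) = (\<chi> h ^ (p ^ l)) ^ r" for h by (simp only: power_mult[symmetric] mult.commute)
  then have "(\<lambda>h. \<chi> h ^ r) \<in> torsion_chars (p ^ l)"
    using char_power[OF lin r(1)] root by (simp add: torsion_chars_def)
  moreover have "(\<lambda>h. \<chi> h ^ r) \<notin> torsion_chars (p ^ k)" if k: "k < l" for k
  proof
    assume a: "(\<lambda>h. \<chi> h ^ r) \<in> torsion_chars (p ^ k)"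
    have "\<chi> h ^ (p ^ k) = 1" if h: "h \<in> H" for h
    proof (rule root_of_unity_coprime_orders[OF _ _ r(2,1)])
      have "(\<chi> h ^ (p ^ k)) ^ r = (\<chi> h ^ r) ^ (p ^ k)" by (simp only: power_mult[symmetric] mult.commute)
      then show "(\<chi> h ^ (p ^ k)) ^ r = 1" using a h by (simp add: torsion_chars_def)
      have "(\<chi> h ^ (p ^ k)) ^ (p ^ l) = (\<chi> h ^ (p ^ l)) ^ (p ^ k)" by (simp only: power_mult[symmetric] mult.commute)
      then show "(\<chi> h ^ (p ^ k)) ^ (p ^ l) = 1" using root[OF h] by simp
    qed
    then have "\<chi> \<in> torsion_chars (p ^ k)" using lin by (simp add: torsion_chars_def)
    then show False using \<chi> k by (simp add: chars_of_order_def)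
  qed
  ultimately show ?thesis by (simp add: chars_of_order_def)
qed

text \<open>Bounds the orders of characters by the exponent of H/N, so that the upper limit
  m_\<delta> in the theorem misses none.\<close>

lemma quotient_exponent_torsion:
  assumes H: "H = carrier (subgroup_generated G S)" and p: "Factorial_Ring.prime p" and card_H: "card H dvd p ^ n"
    and \<chi>: "\<chi> \<in> linear_chars G H N"
  shows "\<chi> \<in> torsion_chars (p ^ (THE e. grp_exponent (subgroup_generated G S Mod N) = p ^ e))"
proof -
  let ?H = "subgroup_generated G S"
  define e where "e = (THE e. grp_exponent (?H Mod N) = p ^ e)"
  interpret HS: group ?H by simp
  interpret NS: normal N ?H by (rule normal_in_generated[OF H])
  interpret Q: group "?H Mod N" by (rule NS.factorgroup_is_group)
  have finQ: "finite (carrier (?H Mod N))" using finite_H H by (simp add: carrier_FactGroup)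
  have "order (?H Mod N) dvd card H"
    using HS.lagrange[OF NS.is_subgroup] H by (metis FactGroup_def dvd_triv_left order_def partial_object.select_convs(1))
  then have "order (?H Mod N) dvd p ^ n" using card_H by (rule dvd_trans)
  then obtain i where i: "order (?H Mod N) = p ^ i" using divides_primepow_nat[OF p] by blast
  have "h [^] (p ^ e) \<in> N" if h: "h \<in> H" for h
  proof -
    have hc: "h \<in> carrier ?H" using h H by simp
    have "N #>\<^bsub>?H\<^esub> h \<in> carrier (?H Mod N)" using hc by (auto simp: carrier_FactGroup)
    then have "(N #>\<^bsub>?H\<^esub> h) [^]\<^bsub>?H Mod N\<^esub> (p ^ e) = N"
      using Q.grp_exponent_prime_power[OF finQ p i] by (simp add: e_def)
    then have "N #>\<^bsub>?H\<^esub> (h [^]\<^bsub>?H\<^esub> (p ^ e)) = N" using NS.FactGroup_pow[OF hc] by simp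
    then have "h [^]\<^bsub>?H\<^esub> (p ^ e) \<in> N"
      by (rule HS.coset_join1[OF _ HS.nat_pow_closed[OF hc] NS.is_subgroup])
    then show ?thesis by (simp add: pow_subgroup_generated)
  qed
  then have "\<chi> h ^ (p ^ e) = 1" if "h \<in> H" for h
    using char_pow[OF \<chi> that, of "p ^ e"] linear_charsD(2)[OF \<chi>] that by simp
  then show ?thesis using \<chi> by (simp add: torsion_chars_def e_def)
qed

end

section \<open>Counting the characters of given level and order\<close>

context two_generator_class_two
begin

text \<open>The power formula gives the exponents i m and j m for a and b, with all corrections in
  the power of c. Membership in Z is therefore decided in G/Z, a product of cyclic groups of orders
  p^\<alpha> and p^\<beta>.\<close>

lemma nf_pow_in_Z_iff:
  "(a [^] (i::nat) \<otimes> (b [^] (j::nat) \<otimes> c [^] (k::nat))) [^] (m::nat) \<in> Z \<longleftrightarrow> p ^ \<alpha> dvd i * m \<and> p ^ \<beta> dvd j * m"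
proof -
  obtain u :: nat where u: "comm G (b [^] j \<otimes> c [^] k) (a [^] i) = c [^] u"
    using comm_Z[of "b [^] j \<otimes> c [^] k" "a [^] i"] a b c by (auto simp: Z_def)
  have "comm G (c [^] k) (b [^] j) = \<one>" using b c c_pow_central by (simp add: comm_eq_one_iff)
  then have "(b [^] j \<otimes> c [^] k) [^] m = b [^] (j * m) \<otimes> c [^] (k * m)"
    using b c by (simp add: pow_mult_G nat_pow_pow)
  then have "(a [^] i \<otimes> (b [^] j \<otimes> c [^] k)) [^] m = a [^] (i * m) \<otimes> (b [^] (j * m) \<otimes> c [^] (k * m)) \<otimes> c [^] (u * (m choose 2))"
    using a b c by (simp add: pow_mult_G u nat_pow_pow)
  also have "\<dots> = a [^] (i * m) \<otimes> (b [^] (j * m) \<otimes> c [^] (k * m + u * (m choose 2)))"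
    using a b c by (simp add: m_assoc nat_pow_mult)
  finally have eq: "(a [^] i \<otimes> (b [^] j \<otimes> c [^] k)) [^] m
      = a [^] (i * m) \<otimes> (b [^] (j * m) \<otimes> c [^] (k * m + u * (m choose 2)))" .
  show ?thesis
  proof
    assume "(a [^] i \<otimes> (b [^] j \<otimes> c [^] k)) [^] m \<in> Z"
    then obtain s :: nat where "(a [^] i \<otimes> (b [^] j \<otimes> c [^] k)) [^] m = c [^] s" by (auto simp: Z_def)
    then have "a [^] (i * m) \<otimes> (b [^] (j * m) \<otimes> c [^] (k * m + u * (m choose 2))) = a [^] (0::nat) \<otimes> (b [^] (0::nat) \<otimes> c [^] s)"
      using eq c by simp
    from nf_cong[OF this] show "p ^ \<alpha> dvd i * m \<and> p ^ \<beta> dvd j * m" by (simp add: cong_0_iff)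
  next
    assume d: "p ^ \<alpha> dvd i * m \<and> p ^ \<beta> dvd j * m"
    obtain k' :: nat where "a [^] (i * m) \<otimes> (b [^] (j * m) \<otimes> c [^] (k * m + u * (m choose 2)))
      = a [^] ((i * m) mod p ^ \<alpha>) \<otimes> (b [^] ((j * m) mod p ^ \<beta>) \<otimes> c [^] k')"
      using normal_form[of "i * m" "j * m" "k * m + u * (m choose 2)"] by blast
    then have "(a [^] i \<otimes> (b [^] j \<otimes> c [^] k)) [^] m = c [^] k'" using eq d c by (simp add: dvd_eq_mod_eq_0)
    then show "(a [^] i \<otimes> (b [^] j \<otimes> c [^] k)) [^] m \<in> Z" using c_pow_Z by simp
  qed
qed

lemma H_0: "H 0 = carrier G"
  using comm_Z by (auto simp: H_def N_0)

text \<open>By duality this is the size of the p^l-torsion in the abelianisation of G.\<close>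

lemma card_torsion_chars_level_0:
  "card (abelian_section.torsion_chars G (H 0) (N 0) (p ^ l)) = p ^ (min l \<alpha> + min l \<beta>)"
proof -
  interpret abelian_section G "H 0" "N 0" by (rule H_N_section) simp
  let ?I = "{i \<in> {..<p ^ \<alpha>}. p ^ \<alpha> dvd i * p ^ l} \<times> {j \<in> {..<p ^ \<beta>}. p ^ \<beta> dvd j * p ^ l} \<times> {..<p ^ \<gamma>}"
  have "{h \<in> H 0. h [^] (p ^ l) \<in> N 0} = nf ` ?I"
  proof (intro equalityI subsetI)
    fix h assume h: "h \<in> {h \<in> H 0. h [^] (p ^ l) \<in> N 0}"
    then obtain i j k where ijk: "(i, j, k) \<in> nf_indices" "h = nf (i, j, k)"
      using H_0 bij_betw_imp_surj_on[OF nf_bij] by blast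
    then have "p ^ \<alpha> dvd i * p ^ l \<and> p ^ \<beta> dvd j * p ^ l" using h nf_pow_in_Z_iff[of i j k] by (simp add: nf_def N_0)
    then have "(i, j, k) \<in> ?I" using ijk by simp
    then show "h \<in> nf ` ?I" using ijk(2) by blast
  next
    fix h assume "h \<in> nf ` ?I"
    then obtain i j k where "(i, j, k) \<in> ?I" "h = nf (i, j, k)" by blast
    then show "h \<in> {h \<in> H 0. h [^] (p ^ l) \<in> N 0}"
      using nf_pow_in_Z_iff[of i j k "p ^ l"] a b c by (simp add: nf_def N_0 H_0)
  qed
  moreover have "inj_on nf ?I" using bij_betw_imp_inj_on[OF nf_bij] by (rule inj_on_subset) auto
  ultimately have "card {h \<in> H 0. h [^] (p ^ l) \<in> N 0} = p ^ min l \<alpha> * (p ^ min l \<beta> * p ^ \<gamma>)"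
    using p_gt_1 by (simp add: card_image card_cartesian_product card_multiples_dividing)
  then have "card (torsion_chars (p ^ l)) * p ^ \<gamma> = p ^ (min l \<alpha> + min l \<beta>) * p ^ \<gamma>"
    using card_linear_chars_torsion_mult[of "p ^ l"] p_gt_1
    by (simp add: torsion_chars_def card_N power_add mult.assoc)
  moreover have "p ^ \<gamma> \<noteq> 0" using p_gt_1 by simp
  ultimately show ?thesis by (auto simp only: mult_cancel2)
qed

definition level_order_chars where
  "level_order_chars \<delta> l = level_chars \<delta> \<inter> abelian_section.chars_of_order G (H \<delta>) (N \<delta>) p l"

definition Q where "Q \<delta> = subgroup_generated G {a [^] (p ^ \<delta>), b [^] (p ^ \<delta>), c} Mod N \<delta>"

definition Q' where "Q' \<delta> = subgroup_generated G {a [^] (p ^ \<delta>), b [^] (p ^ \<delta>), c} Mod N (\<delta> - 1)"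

text \<open>The characters trivial on \<open>N (\<delta> - 1)\<close> are among those trivial on
  \<open>N \<delta>\<close> and keep their order, so the set difference becomes a difference of
  counts and the subtraction of natural numbers truncates nothing.\<close>

lemma card_level_order_chars:
  assumes d: "0 < \<delta>" "\<delta> \<le> \<gamma>"
  shows "card (level_order_chars \<delta> l)
    = (num_cyclic_subgroups (Q \<delta>) (p ^ l) - num_cyclic_subgroups (Q' \<delta>) (p ^ l)) * totient (p ^ l)"
proof -
  obtain e where e: "\<delta> = Suc e" using d(1) by (cases \<delta>) auto
  interpret S: abelian_section G "H \<delta>" "N \<delta>" by (rule H_N_section) simp
  interpret S': abelian_section G "H \<delta>" "N e" by (rule H_N_section) (simp add: e)
  have lin: "linear_chars G (H \<delta>) (N e) \<subseteq> linear_chars G (H \<delta>) (N \<delta>)"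
    using N_antimono[of e \<delta>] e by (auto simp: linear_chars_def)
  have "S'.torsion_chars m = S.torsion_chars m \<inter> linear_chars G (H \<delta>) (N e)" for m
    using lin by (auto simp: S.torsion_chars_def S'.torsion_chars_def)
  then have E: "S'.chars_of_order p l = S.chars_of_order p l \<inter> linear_chars G (H \<delta>) (N e)"
    by (auto simp: S.chars_of_order_def S'.chars_of_order_def)
  have "S.chars_of_order p l \<subseteq> linear_chars G (H \<delta>) (N \<delta>)"
    by (auto simp: S.chars_of_order_def S.torsion_chars_def)
  then have "level_order_chars \<delta> l = S.chars_of_order p l - S'.chars_of_order p l"
    using e E by (auto simp: level_order_chars_def level_chars_def)
  moreover have "finite (S'.chars_of_order p l)"
    using S'.finite_torsion_chars[of "p ^ l"] by (auto simp: S'.chars_of_order_def)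
  ultimately have "card (level_order_chars \<delta> l) = card (S.chars_of_order p l) - card (S'.chars_of_order p l)"
    using E by (simp add: card_Diff_subset)
  then show ?thesis
    using S.card_chars_of_order_eq[OF H_eq_generated[OF d(2)] p] S'.card_chars_of_order_eq[OF H_eq_generated[OF d(2)] p]
    by (simp add: Q_def Q'_def e diff_mult_distrib)
qed

lemma card_level_order_chars_0:
  "card (level_order_chars 0 l) = p ^ (min l \<alpha> + min l \<beta>) - (if l = 0 then 0 else p ^ (min (l - 1) \<alpha> + min (l - 1) \<beta>))"
proof -
  interpret S: abelian_section G "H 0" "N 0" by (rule H_N_section) simp
  have "level_order_chars 0 l = S.chars_of_order p l"
    by (auto simp: level_order_chars_def level_chars_def S.chars_of_order_def S.torsion_chars_def)
  then show ?thesis by (simp add: S.card_chars_of_order card_torsion_chars_level_0)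
qed

text \<open>Raising a character to a power prime to its order cannot make it trivial on
  \<open>N (\<delta> - 1)\<close>, so the level is preserved and whole Galois classes lie inside
  \<open>level_order_chars\<close>.\<close>

lemma level_order_chars_representatives:
  "\<exists>R\<subseteq>level_order_chars \<delta> l. card R * totient (p ^ l) = card (level_order_chars \<delta> l) \<and>
    (\<forall>\<chi>\<in>level_order_chars \<delta> l. \<exists>\<theta>\<in>R. \<exists>r. coprime r (p ^ l) \<and> r > 0 \<and> \<chi> = (\<lambda>h. \<theta> h ^ r))"
proof -
  interpret S: abelian_section G "H \<delta>" "N \<delta>" by (rule H_N_section) simp
  have closed: "(\<lambda>h. \<chi> h ^ r) \<in> level_order_chars \<delta> l"
    if \<chi>: "\<chi> \<in> level_order_chars \<delta> l" and r: "r > 0" "coprime r (p ^ l)" for \<chi> r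
  proof -
    have o: "(\<lambda>h. \<chi> h ^ r) \<in> S.chars_of_order p l"
      using \<chi> r by (intro S.chars_of_order_power) (simp_all add: level_order_chars_def)
    then have lin: "(\<lambda>h. \<chi> h ^ r) \<in> linear_chars G (H \<delta>) (N \<delta>)"
      by (simp add: S.chars_of_order_def S.torsion_chars_def)
    have \<chi>': "\<chi> \<in> S.torsion_chars (p ^ l)" "\<chi> \<in> level_chars \<delta>"
      using \<chi> by (simp_all add: level_order_chars_def S.chars_of_order_def)
    have "(\<lambda>h. \<chi> h ^ r) \<notin> linear_chars G (H \<delta>) (N (\<delta> - 1))" if d: "\<delta> > 0"
    proof
      assume "(\<lambda>h. \<chi> h ^ r) \<in> linear_chars G (H \<delta>) (N (\<delta> - 1))"
      then have "\<chi> h ^ r = 1" if "h \<in> N (\<delta> - 1)" for h using that by (rule linear_charsD(2))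
      moreover have "\<chi> h ^ (p ^ l) = 1" if "h \<in> N (\<delta> - 1)" for h
        using that \<chi>'(1) subsetD[OF Z_subset_H subsetD[OF N_subset_Z that]] by (simp add: S.torsion_chars_def)
      ultimately have "\<chi> h = 1" if "h \<in> N (\<delta> - 1)" for h
        using root_of_unity_coprime_orders[OF _ _ r(2,1)] that by blast
      then have "\<chi> \<in> linear_chars G (H \<delta>) (N (\<delta> - 1))"
        using level_charD[OF \<chi>'(2)] by (simp add: linear_chars_def)
      then show False using \<chi>'(2) d by (simp add: level_chars_def)
    qed
    then show ?thesis using o lin by (simp add: level_order_chars_def level_chars_def)
  qed
  have sub: "level_order_chars \<delta> l \<subseteq> S.chars_of_order p l" by (auto simp: level_order_chars_def)
  obtain R where "R \<subseteq> level_order_chars \<delta> l" "card R * totient (p ^ l) = card (level_order_chars \<delta> l)"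
    "\<And>\<chi>. \<chi> \<in> level_order_chars \<delta> l \<Longrightarrow> \<exists>\<theta>\<in>R. \<exists>r. coprime r (p ^ l) \<and> r > 0 \<and> \<chi> = (\<lambda>h. \<theta> h ^ r)"
    by (rule S.chars_of_order_representatives[OF p sub closed]) (assumption | (rule that; assumption))+
  then show ?thesis by blast
qed

text \<open>The decomposition of the regular character, evaluated at the identity.\<close>

lemma sum_card_level_chars: "(\<Sum>\<delta>\<le>\<gamma>. p ^ (2 * \<delta>) * card (level_chars \<delta>)) = order G"
proof -
  have one: "\<psi> \<one> = 1" if "\<psi> \<in> level_chars \<delta>" for \<psi> \<delta>
    using linear_charsD(2)[OF level_charD[OF that]] subgroup.one_closed[OF N_subgroup] by blast
  have "(of_nat (\<Sum>\<delta>\<le>\<gamma>. p ^ (2 * \<delta>) * card (level_chars \<delta>)) :: complex)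
      = (\<Sum>\<delta>\<le>\<gamma>. of_nat (p ^ (2 * \<delta>)) * (\<Sum>\<psi>\<in>level_chars \<delta>. \<psi> \<one>))"
    by (simp add: one)
  also have "\<dots> = of_nat (order G)" using sum_level_chars[of \<one>] by simp
  finally show ?thesis by (simp only: of_nat_eq_iff)
qed

text \<open>Supplies the inequality \<open>dim\<close>: for fixed \<delta> the sets for different l
  are disjoint parts of \<open>level_chars \<delta>\<close>, so any finite set of index pairs stays
  within |G|.\<close>

lemma sum_card_level_order_chars:
  assumes J: "finite J" "\<And>\<delta> l. (\<delta>, l) \<in> J \<Longrightarrow> \<delta> \<le> \<gamma>"
  shows "(\<Sum>(\<delta>, l)\<in>J. p ^ (2 * \<delta>) * card (level_order_chars \<delta> l)) \<le> order G"
proof -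
  define L where "L = snd ` J"
  have finL: "finite L" using J(1) by (simp add: L_def)
  have le: "(\<Sum>l\<in>L. card (level_order_chars \<delta> l)) \<le> card (level_chars \<delta>)" for \<delta>
  proof -
    interpret S: abelian_section G "H \<delta>" "N \<delta>" by (rule H_N_section) simp
    have "level_order_chars \<delta> l \<inter> level_order_chars \<delta> l' = {}" if "l \<noteq> l'" for l l'
      using S.chars_of_order_disjoint[OF that, of p] by (auto simp: level_order_chars_def)
    moreover have "finite (level_order_chars \<delta> l)" for l
      using finite_level_chars by (simp add: level_order_chars_def)
    ultimately have "(\<Sum>l\<in>L. card (level_order_chars \<delta> l)) = card (\<Union>l\<in>L. level_order_chars \<delta> l)"
      using finL by (intro card_UN_disjoint[symmetric]) auto
    also have "\<dots> \<le> card (level_chars \<delta>)"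
      by (intro card_mono finite_level_chars) (auto simp: level_order_chars_def)
    finally show ?thesis .
  qed
  have "(\<Sum>(\<delta>, l)\<in>J. p ^ (2 * \<delta>) * card (level_order_chars \<delta> l))
      \<le> (\<Sum>(\<delta>, l)\<in>{..\<gamma>} \<times> L. p ^ (2 * \<delta>) * card (level_order_chars \<delta> l))"
    using J finL by (intro sum_mono2) (force simp: L_def)+
  also have "\<dots> = (\<Sum>\<delta>\<le>\<gamma>. p ^ (2 * \<delta>) * (\<Sum>l\<in>L. card (level_order_chars \<delta> l)))"
    by (simp add: sum.cartesian_product[symmetric] sum_distrib_left)
  also have "\<dots> \<le> (\<Sum>\<delta>\<le>\<gamma>. p ^ (2 * \<delta>) * card (level_chars \<delta>))"
    using le by (intro sum_mono mult_left_mono) auto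
  finally show ?thesis by (simp only: sum_card_level_chars)
qed

text \<open>The index ranges of the theorem meet every character. At level 0 the bound is \<alpha>,
  as \<beta> \<le> \<alpha>; at positive level l = 0 is impossible, because a character trivial on
  all of \<open>H \<delta>\<close> is trivial on \<open>N (\<delta> - 1)\<close>.\<close>

lemma level_char_order:
  assumes \<psi>: "\<psi> \<in> level_chars \<delta>" and d: "\<delta> \<le> \<gamma>"
  obtains l where "\<psi> \<in> level_order_chars \<delta> l" "\<delta> = 0 \<Longrightarrow> l \<le> \<alpha>"
    "\<delta> > 0 \<Longrightarrow> 1 \<le> l \<and> l \<le> (THE e. grp_exponent (Q \<delta>) = p ^ e)"
proof -
  interpret S: abelian_section G "H \<delta>" "N \<delta>" by (rule H_N_section) simp
  note \<psi>' = level_charD[OF \<psi>]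
  show ?thesis
  proof (cases "\<delta> = 0")
    case True
    have "\<psi> h ^ (p ^ \<alpha>) = 1" if h: "h \<in> H \<delta>" for h
    proof -
      obtain i j k where "h = a [^] (i::nat) \<otimes> (b [^] (j::nat) \<otimes> c [^] (k::nat))" using elements H_carrier h by metis
      moreover have "p ^ \<beta> dvd j * p ^ \<alpha>" using \<alpha>\<beta> by (intro dvd_mult le_imp_power_dvd)
      ultimately have "h [^] (p ^ \<alpha>) \<in> N \<delta>" using nf_pow_in_Z_iff[of i j k "p ^ \<alpha>"] True by (simp add: N_0)
      then show ?thesis using S.char_pow[OF \<psi>' h, of "p ^ \<alpha>"] linear_charsD(2)[OF \<psi>'] by simp
    qed
    then have "\<psi> \<in> S.torsion_chars (p ^ \<alpha>)" using \<psi>' by (simp add: S.torsion_chars_def)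
    then obtain l where "l \<le> \<alpha>" "\<psi> \<in> S.chars_of_order p l" by (rule S.char_in_chars_of_order)
    then show ?thesis using that[of l] \<psi> True by (simp add: level_order_chars_def)
  next
    case False
    have "card (H \<delta>) dvd p ^ (\<alpha> + \<beta> + \<gamma>)" using card_H[OF d] by (metis dvd_triv_right)
    from S.quotient_exponent_torsion[OF H_eq_generated[OF d] p this \<psi>']
    obtain l where l: "l \<le> (THE e. grp_exponent (Q \<delta>) = p ^ e)" "\<psi> \<in> S.chars_of_order p l"
      unfolding Q_def by (rule S.char_in_chars_of_order)
    have "l \<noteq> 0"
    proof
      assume "l = 0"
      then have "\<psi> h = 1" if "h \<in> H \<delta>" for h using l(2) that by (simp add: S.chars_of_order_def S.torsion_chars_def)
      moreover have "N (\<delta> - 1) \<subseteq> H \<delta>" using N_subset_Z Z_subset_H by blast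
      ultimately have "\<psi> \<in> linear_chars G (H \<delta>) (N (\<delta> - 1))" using \<psi>' by (auto simp: linear_chars_def)
      then show False using \<psi> False by (simp add: level_chars_def)
    qed
    then show ?thesis using that[of l] l \<psi> False by (simp add: level_order_chars_def)
  qed
qed

end

lemma distinct_concat_map_Pair:
  assumes "distinct xs" "\<And>x. distinct (f x)"
  shows "distinct (concat (map (\<lambda>x. map (Pair x) (f x)) xs))"
  using assms(1) by (induction xs) (auto simp: distinct_map inj_on_def assms(2))

text \<open>The left side is the trace of \<rho>(f) \<rho>(g), and \<rho>(f) = 0.\<close>

lemma (in group) cyclo_rep_translate_trace:
  assumes rep: "cyclo_rep G k m \<rho>" and g: "g \<in> carrier G"
    and zero: "\<And>ij. linear_extension G \<rho> f ij = 0"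
  shows "(\<Sum>x\<in>carrier G. of_rat (f x) * (\<Sum>i<k. \<rho> (x \<otimes> g) (i, i))) = 0"
proof -
  have "\<rho> (x \<otimes> g) (i, i) = (\<Sum>j<k. \<rho> x (i, j) * \<rho> g (j, i))" if "x \<in> carrier G" "i < k" for x i
    using rep that g by (simp add: cyclo_rep_def cyclo_matrix_ring_def)
  then have "(\<Sum>x\<in>carrier G. of_rat (f x) * (\<Sum>i<k. \<rho> (x \<otimes> g) (i, i)))
      = (\<Sum>x\<in>carrier G. \<Sum>i<k. \<Sum>j<k. of_rat (f x) * \<rho> x (i, j) * \<rho> g (j, i))"
    by (intro sum.cong) (simp_all add: sum_distrib_left mult.assoc)
  also have "\<dots> = (\<Sum>i<k. \<Sum>j<k. \<Sum>x\<in>carrier G. of_rat (f x) * \<rho> x (i, j) * \<rho> g (j, i))"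
    by (subst sum.swap, intro sum.cong refl, rule sum.swap)
  also have "\<dots> = (\<Sum>i<k. \<Sum>j<k. linear_extension G \<rho> f (i, j) * \<rho> g (j, i))"
    by (simp add: linear_extension_def sum_distrib_right)
  finally show ?thesis by (simp add: zero)
qed

section \<open>Faithfulness and assembly of the decomposition\<close>

context two_generator_class_two
begin

lemma level_order_char_root:
  assumes "\<psi> \<in> level_order_chars \<delta> l" "h \<in> H \<delta>"
  shows "\<psi> h ^ (p ^ l) = 1"
proof -
  interpret S: abelian_section G "H \<delta>" "N \<delta>" by (rule H_N_section) simp
  show ?thesis using assms by (simp add: level_order_chars_def S.chars_of_order_def S.torsion_chars_def)
qed

text \<open>Carries a relation from one character to its whole Galois class: the values of \<theta>
  are written as powers of zeta and the relation is conjugated.\<close>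

lemma level_order_char_relation_power:
  fixes f :: "'a \<Rightarrow> rat"
  assumes \<theta>: "\<theta> \<in> level_order_chars \<delta> l" and g: "g \<in> carrier G"
    and sum: "(\<Sum>x\<in>carrier G. of_rat (f x) * \<theta> (x \<otimes> g)) = 0"
    and r: "coprime r (p ^ l)" "r > 0"
  shows "(\<Sum>x\<in>carrier G. of_rat (f x) * \<theta> (x \<otimes> g) ^ r) = 0"
proof -
  have pl: "p ^ l > 0" using p_gt_1 by simp
  have \<theta>0: "\<theta> y = 0" if "y \<notin> H \<delta>" for y
    using linear_charsD(3)[OF level_charD] \<theta> that by (auto simp: level_order_chars_def)
  \<comment> \<open>Outside \<open>I\<close> the value of \<theta> is zero rather than a root of
    unity; those terms stay zero after raising to a power s > 0.\<close>
  define I where "I = {x \<in> carrier G. x \<otimes> g \<in> H \<delta>}"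
  have "\<forall>x. \<exists>k. x \<in> I \<longrightarrow> \<theta> (x \<otimes> g) = zeta (p ^ l) ^ k"
  proof
    fix x
    show "\<exists>k. x \<in> I \<longrightarrow> \<theta> (x \<otimes> g) = zeta (p ^ l) ^ k"
    proof (cases "x \<in> I")
      case True
      then have "\<theta> (x \<otimes> g) ^ (p ^ l) = 1" using level_order_char_root[OF \<theta>] by (simp add: I_def)
      then show ?thesis using root_of_unity_eq_zeta_pow[OF pl] by metis
    qed simp
  qed
  from choice[OF this] obtain e where e: "\<And>x. x \<in> I \<Longrightarrow> \<theta> (x \<otimes> g) = zeta (p ^ l) ^ e x" by blast
  have restrict: "(\<Sum>x\<in>carrier G. of_rat (f x) * \<theta> (x \<otimes> g) ^ s) = (\<Sum>x\<in>I. of_rat (f x) * zeta (p ^ l) ^ (s * e x))"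
    if "s > 0" for s
  proof -
    have "(\<Sum>x\<in>carrier G. of_rat (f x) * \<theta> (x \<otimes> g) ^ s) = (\<Sum>x\<in>I. of_rat (f x) * \<theta> (x \<otimes> g) ^ s)"
      using that finite_G \<theta>0 by (intro sum.mono_neutral_right) (auto simp: I_def power_0_left)
    also have "\<dots> = (\<Sum>x\<in>I. of_rat (f x) * zeta (p ^ l) ^ (s * e x))"
      using e by (intro sum.cong) (simp_all add: power_mult[symmetric] mult.commute)
    finally show ?thesis .
  qed
  have "(\<Sum>x\<in>I. of_rat (f x) * zeta (p ^ l) ^ e x) = 0" using restrict[of 1] sum by simp
  moreover have "finite I" using finite_G by (simp add: I_def)
  moreover have "zeta (p ^ l) ^ (p ^ k) \<noteq> 1" if "k < l" for k
    using that p_gt_1 by (intro zeta_pow_neq_1) simp_all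
  ultimately have "(\<Sum>x\<in>I. of_rat (f x) * zeta (p ^ l) ^ (r * e x)) = 0"
    by (intro rat_relation_conjugate[OF p _ zeta_pow_self[OF pl] _ r(1)])
  then show ?thesis using restrict[OF r(2)] by simp
qed

text \<open>Fourier inversion: the weighted sum over all levels is the regular character, and
  pairing it with f after translation by g^-1 leaves |G| f(g).\<close>

lemma level_chars_separate:
  fixes f :: "'a \<Rightarrow> rat"
  assumes "\<And>\<delta> \<psi> g. \<delta> \<le> \<gamma> \<Longrightarrow> \<psi> \<in> level_chars \<delta> \<Longrightarrow> g \<in> carrier G \<Longrightarrow>
      (\<Sum>x\<in>carrier G. of_rat (f x) * \<psi> (x \<otimes> g)) = 0"
    and g: "g \<in> carrier G"
  shows "f g = 0"
proof -
  have "0 = (\<Sum>\<delta>\<le>\<gamma>. of_nat (p ^ (2 * \<delta>)) * (\<Sum>\<psi>\<in>level_chars \<delta>. \<Sum>x\<in>carrier G. of_rat (f x) * \<psi> (x \<otimes> inv g)))"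
    using assms by simp
  also have "\<dots> = (\<Sum>\<delta>\<le>\<gamma>. \<Sum>x\<in>carrier G. of_rat (f x) * (of_nat (p ^ (2 * \<delta>)) * (\<Sum>\<psi>\<in>level_chars \<delta>. \<psi> (x \<otimes> inv g))))"
    by (intro sum.cong refl, subst sum.swap) (simp add: sum_distrib_left mult_ac)
  also have "\<dots> = (\<Sum>x\<in>carrier G. of_rat (f x) * (\<Sum>\<delta>\<le>\<gamma>. of_nat (p ^ (2 * \<delta>)) * (\<Sum>\<psi>\<in>level_chars \<delta>. \<psi> (x \<otimes> inv g))))"
    by (subst sum.swap) (simp only: sum_distrib_left)
  also have "\<dots> = (\<Sum>x\<in>carrier G. of_rat (f x) * (if x \<otimes> inv g = \<one> then of_nat (order G) else 0))"
    by (simp only: sum_level_chars)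
  also have "\<dots> = (\<Sum>x\<in>carrier G. if x = g then of_rat (f g) * of_nat (order G) else 0)"
  proof (intro sum.cong refl)
    fix x assume x: "x \<in> carrier G"
    have "x \<otimes> inv g = \<one> \<longleftrightarrow> x = g" using x g by (metis inv_closed inv_equality inv_inv r_inv)
    then show "of_rat (f x) * (if x \<otimes> inv g = \<one> then of_nat (order G) else 0)
        = (if x = g then of_rat (f g) * of_nat (order G) else 0 :: complex)" by simp
  qed
  also have "\<dots> = of_rat (f g) * of_nat (order G)" using g finite_G by simp
  finally show ?thesis using order_G p_gt_1 by simp
qed

theorem group_algebra_decomposition:
  "group_algebra_Q G \<simeq> wedderburn_sum
    ([(1, 1)]
     @ concat (map (\<lambda>l. replicate (p ^ l + p ^ (l - 1)) (1, p ^ l)) [1..<\<beta> + 1])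
     @ concat (map (\<lambda>l. replicate (p ^ \<beta>) (1, p ^ l)) [\<beta> + 1..<\<alpha> + 1])
     @ concat (map (\<lambda>\<delta>. concat (map (\<lambda>l.
           replicate (num_cyclic_subgroups (Q \<delta>) (p ^ l) - num_cyclic_subgroups (Q' \<delta>) (p ^ l)) (p ^ \<delta>, p ^ l))
         [1..<(THE e. grp_exponent (Q \<delta>) = p ^ e) + 1])) [1..<\<gamma> + 1]))"
proof -
  define M where "M \<delta> = (THE e. grp_exponent (Q \<delta>) = p ^ e)" for \<delta>
  have tot: "totient (p ^ l) \<noteq> 0" for l using p_gt_1 by simp
  have "\<forall>\<delta> l. \<exists>R. R \<subseteq> level_order_chars \<delta> l \<and> card R * totient (p ^ l) = card (level_order_chars \<delta> l) \<and>
    (\<forall>\<chi>\<in>level_order_chars \<delta> l. \<exists>\<theta>\<in>R. \<exists>r. coprime r (p ^ l) \<and> r > 0 \<and> \<chi> = (\<lambda>h. \<theta> h ^ r))"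
    using level_order_chars_representatives by simp
  then obtain R where R: "\<And>\<delta> l. R \<delta> l \<subseteq> level_order_chars \<delta> l"
    "\<And>\<delta> l. card (R \<delta> l) * totient (p ^ l) = card (level_order_chars \<delta> l)"
    "\<And>\<delta> l \<chi>. \<chi> \<in> level_order_chars \<delta> l \<Longrightarrow> \<exists>\<theta>\<in>R \<delta> l. \<exists>r. coprime r (p ^ l) \<and> r > 0 \<and> \<chi> = (\<lambda>h. \<theta> h ^ r)"
    by (simp only: choice_iff) blast
  have "finite (R \<delta> l)" for \<delta> l
    using R(1)[of \<delta> l] finite_level_chars[of \<delta>] by (auto simp: level_order_chars_def intro: finite_subset)
  then have "\<forall>\<delta> l. \<exists>xs. set xs = R \<delta> l \<and> distinct xs" using finite_distinct_list by blast
  then obtain xs where xs: "\<And>\<delta> l. set (xs \<delta> l) = R \<delta> l" "\<And>\<delta> l. distinct (xs \<delta> l)"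
    by (simp only: choice_iff) blast
  have len: "length (xs \<delta> l) = card (R \<delta> l)" for \<delta> l using xs distinct_card by metis
  define \<rho>' where "\<rho>' = (\<lambda>\<delta> l \<psi>. SOME \<rho>. cyclo_rep G (p ^ \<delta>) (p ^ l) \<rho> \<and>
      (\<forall>g\<in>carrier G. (\<Sum>i<p ^ \<delta>. \<rho> g (i, i)) = of_nat (p ^ \<delta>) * \<psi> g))"
  have \<rho>': "cyclo_rep G (p ^ \<delta>) (p ^ l) (\<rho>' \<delta> l \<psi>) \<and>
      (\<forall>g\<in>carrier G. (\<Sum>i<p ^ \<delta>. \<rho>' \<delta> l \<psi> g (i, i)) = of_nat (p ^ \<delta>) * \<psi> g)"
    if "\<delta> \<le> \<gamma>" "\<psi> \<in> R \<delta> l" for \<delta> l \<psi>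
  proof -
    have \<psi>: "\<psi> \<in> level_order_chars \<delta> l" using that R(1) by blast
    then have "\<psi> \<in> level_chars \<delta>" by (simp add: level_order_chars_def)
    show ?thesis
      unfolding \<rho>'_def by (rule someI_ex[OF level_rep_exists[OF \<open>\<psi> \<in> level_chars \<delta>\<close> that(1) level_order_char_root[OF \<psi>]]])
  qed
  define E where "E = (\<lambda>(\<delta>, l). map (\<lambda>\<psi>. (p ^ \<delta>, p ^ l, \<rho>' \<delta> l \<psi>)) (xs \<delta> l))"
  \<comment> \<open>The pairs (\<delta>, l) in the order of the summands of the theorem, so that
    \<open>D\<close> yields that list literally. The pair (0, 0) belongs to the trivial character
    and gives Q.\<close>
  define J where "J = [(0, 0)] @ map (Pair 0) [1..<\<beta> + 1] @ map (Pair 0) [\<beta> + 1..<\<alpha> + 1]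
      @ concat (map (\<lambda>\<delta>. map (Pair \<delta>) [1..<M \<delta> + 1]) [1..<\<gamma> + 1])"
  define D where "D = concat (map E J)"
  have D_iff: "(k, m, \<rho>) \<in> set D \<longleftrightarrow>
      (\<exists>\<delta> l \<psi>. (\<delta>, l) \<in> set J \<and> \<psi> \<in> R \<delta> l \<and> k = p ^ \<delta> \<and> m = p ^ l \<and> \<rho> = \<rho>' \<delta> l \<psi>)" for k m \<rho>
    by (auto simp: D_def E_def xs)
  have J_le: "\<delta> \<le> \<gamma>" if "(\<delta>, l) \<in> set J" for \<delta> l
    using that by (auto simp: J_def)
  have J_0: "(0, l) \<in> set J" if "l \<le> \<alpha>" for l
    using that by (cases "l = 0"; cases "l \<le> \<beta>") (auto simp: J_def)
  have J_pos: "(\<delta>, l) \<in> set J" if "0 < \<delta>" "\<delta> \<le> \<gamma>" "1 \<le> l" "l \<le> M \<delta>" for \<delta> l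
  proof -
    have "\<delta> \<in> set [1..<\<gamma> + 1]" "l \<in> set [1..<M \<delta> + 1]" using that by auto
    then have "(\<delta>, l) \<in> (\<Union>\<delta>\<in>set [1..<\<gamma> + 1]. Pair \<delta> ` set [1..<M \<delta> + 1])"
      by (intro UN_I[of \<delta>] imageI)
    then show ?thesis by (simp only: J_def set_append set_concat set_map image_image Un_iff simp_thms)
  qed
  have dist: "distinct J"
    using distinct_concat_map_Pair[of "[1..<\<gamma> + 1]" "\<lambda>\<delta>. [1..<M \<delta> + 1]"]
    by (auto simp: J_def distinct_map inj_on_def)
  have "group_algebra_Q G \<simeq> wedderburn_sum (map (\<lambda>(k, m, \<rho>). (k, m)) D)"
  proof (rule group_algebra_iso_wedderburn_sum[OF finite_G])
    show "cyclo_rep G k m \<rho>" if "(k, m, \<rho>) \<in> set D" for k m \<rho>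
      using that J_le \<rho>' by (auto simp: D_iff)
    show "\<exists>q::nat\<Rightarrow>rat. x = (\<Sum>j<totient m. of_rat (q j) * zeta m ^ j)"
      if D: "(k, m, \<rho>) \<in> set D" and x: "x \<in> cyclotomic_field m" for k m \<rho> x
    proof -
      obtain l where "m = p ^ l" using D by (auto simp: D_iff)
      then show ?thesis using cyclotomic_field_span[OF p] x by blast
    qed
    have E_sum: "(\<Sum>(k, m, \<rho>)\<leftarrow>E (\<delta>, l). k ^ 2 * totient m) = p ^ (2 * \<delta>) * card (level_order_chars \<delta> l)" for \<delta> l
      using R(2)[of \<delta> l]
      by (simp add: E_def comp_def sum_list_triv len power_mult[symmetric] mult_ac)
    have "(\<Sum>(k, m, \<rho>)\<leftarrow>concat (map E js). k ^ 2 * totient m)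
        = (\<Sum>(\<delta>, l)\<leftarrow>js. p ^ (2 * \<delta>) * card (level_order_chars \<delta> l))" for js
      by (induction js) (auto simp: E_sum)
    then have "(\<Sum>(k, m, \<rho>)\<leftarrow>D. k ^ 2 * totient m) = (\<Sum>(\<delta>, l)\<leftarrow>J. p ^ (2 * \<delta>) * card (level_order_chars \<delta> l))"
      by (simp only: D_def)
    also have "\<dots> = (\<Sum>(\<delta>, l)\<in>set J. p ^ (2 * \<delta>) * card (level_order_chars \<delta> l))"
      using dist by (rule sum_list_distinct_conv_sum_set)
    also have "\<dots> \<le> order G"
      using J_le by (intro sum_card_level_order_chars) auto
    finally show "(\<Sum>(k, m, \<rho>)\<leftarrow>D. k ^ 2 * totient m) \<le> order G" .
    fix f :: "'a \<Rightarrow> rat" and g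
    assume zero: "\<And>k m \<rho> ij. (k, m, \<rho>) \<in> set D \<Longrightarrow> linear_extension G \<rho> f ij = 0" and g: "g \<in> carrier G"
    show "f g = 0"
    proof (rule level_chars_separate[OF _ g])
      fix \<delta> \<psi> g assume d: "\<delta> \<le> \<gamma>" and \<psi>: "\<psi> \<in> level_chars \<delta>" and g: "g \<in> carrier G"
      obtain l where l: "\<psi> \<in> level_order_chars \<delta> l" "\<delta> = 0 \<Longrightarrow> l \<le> \<alpha>" "\<delta> > 0 \<Longrightarrow> 1 \<le> l \<and> l \<le> M \<delta>"
        by (rule level_char_order[OF \<psi> d, folded M_def]) (rule that; assumption)
      then have J: "(\<delta>, l) \<in> set J" using J_0 J_pos d by (cases "\<delta> = 0") auto
      \<comment> \<open>Only the representatives occur in \<open>D\<close>: the relation for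
        \<theta> is read off from the trace and then conjugated to \<psi>.\<close>
      obtain \<theta> r where \<theta>: "\<theta> \<in> R \<delta> l" and r: "coprime r (p ^ l)" "r > 0" and \<psi>\<theta>: "\<psi> = (\<lambda>h. \<theta> h ^ r)"
        using R(3)[OF l(1)] by blast
      have "(p ^ \<delta>, p ^ l, \<rho>' \<delta> l \<theta>) \<in> set D" using J \<theta> D_iff by blast
      then have "(\<Sum>x\<in>carrier G. of_rat (f x) * (\<Sum>i<p ^ \<delta>. \<rho>' \<delta> l \<theta> (x \<otimes> g) (i, i))) = 0"
        using cyclo_rep_translate_trace[OF conjunct1[OF \<rho>'[OF d \<theta>]] g] zero by blast
      then have "(\<Sum>x\<in>carrier G. of_nat (p ^ \<delta>) * (of_rat (f x) * \<theta> (x \<otimes> g))) = 0"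
        using \<rho>'[OF d \<theta>] g by (simp add: mult_ac)
      then have "of_nat (p ^ \<delta>) * (\<Sum>x\<in>carrier G. of_rat (f x) * \<theta> (x \<otimes> g)) = 0"
        by (simp only: sum_distrib_left)
      then have "(\<Sum>x\<in>carrier G. of_rat (f x) * \<theta> (x \<otimes> g)) = 0" using p_gt_1 by simp
      moreover have "\<theta> \<in> level_order_chars \<delta> l" using \<theta> R(1) by blast
      ultimately show "(\<Sum>x\<in>carrier G. of_rat (f x) * \<psi> (x \<otimes> g)) = 0"
        unfolding \<psi>\<theta> using level_order_char_relation_power g r by blast
    qed
  qed
  moreover have "map (\<lambda>(k, m, \<rho>). (k, m)) D = concat (map (\<lambda>(\<delta>, l). replicate (card (R \<delta> l)) (p ^ \<delta>, p ^ l)) J)"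
  proof -
    have "map (\<lambda>(k, m, \<rho>). (k, m)) (E x) = (case x of (\<delta>, l) \<Rightarrow> replicate (card (R \<delta> l)) (p ^ \<delta>, p ^ l))" for x
      by (cases x) (simp add: E_def comp_def map_replicate_const len)
    then show ?thesis by (simp only: D_def map_concat map_map comp_def)
  qed
  moreover have "concat (map (\<lambda>(\<delta>, l). replicate (card (R \<delta> l)) (p ^ \<delta>, p ^ l)) J) =
    [(1, 1)]
     @ concat (map (\<lambda>l. replicate (p ^ l + p ^ (l - 1)) (1, p ^ l)) [1..<\<beta> + 1])
     @ concat (map (\<lambda>l. replicate (p ^ \<beta>) (1, p ^ l)) [\<beta> + 1..<\<alpha> + 1])
     @ concat (map (\<lambda>\<delta>. concat (map (\<lambda>l.
           replicate (num_cyclic_subgroups (Q \<delta>) (p ^ l) - num_cyclic_subgroups (Q' \<delta>) (p ^ l)) (p ^ \<delta>, p ^ l))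
         [1..<M \<delta> + 1])) [1..<\<gamma> + 1])"
  proof -
    have R00: "card (R 0 0) = 1" using R(2)[of 0 0] by (simp add: card_level_order_chars_0)
    have tot_Suc: "totient (p ^ Suc k) = p ^ k * (p - 1)" for k by (rule totient_prime_power_Suc[OF p])
    \<comment> \<open>From p^(2l) - p^(2(l-1)) = (p^l + p^(l-1)) totient(p^l).\<close>
    have R0: "card (R 0 l) = p ^ l + p ^ (l - 1)" if l: "1 \<le> l" "l \<le> \<beta>" for l
    proof -
      obtain k where k: "l = Suc k" using l by (cases l) auto
      obtain s where s: "p = Suc s" using p_gt_1 by (cases p) auto
      have "card (level_order_chars 0 l) = p ^ (l + l) - p ^ (k + k)"
        using l \<alpha>\<beta> k by (simp add: card_level_order_chars_0 min_absorb1)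
      also have "\<dots> = Suc s * Suc s * (p ^ k * p ^ k) - p ^ k * p ^ k" by (simp only: k s[symmetric]) (simp add: power_add)
      also have "\<dots> = (Suc s * p ^ k + p ^ k) * (p ^ k * s)" by (simp add: algebra_simps)
      also have "\<dots> = (p ^ l + p ^ k) * (p ^ k * (p - 1))" by (simp add: s k)
      finally have card: "card (level_order_chars 0 l) = (p ^ l + p ^ k) * (p ^ k * (p - 1))" .
      have tl: "totient (p ^ l) = p ^ k * (p - 1)" by (simp only: k tot_Suc)
      have "card (R 0 l) * totient (p ^ l) = (p ^ l + p ^ k) * totient (p ^ l)"
        by (subst R(2), subst tl) (rule card)
      then have "card (R 0 l) = p ^ l + p ^ k" using tot[of l] by (auto simp only: mult_cancel2)
      then show ?thesis by (simp add: k)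
    qed
    \<comment> \<open>Beyond \<beta> only the factor of order p^\<alpha> still grows: p^(l+\<beta>)
      - p^(l-1+\<beta>) = p^\<beta> totient(p^l).\<close>
    have R1: "card (R 0 l) = p ^ \<beta>" if l: "\<beta> + 1 \<le> l" "l \<le> \<alpha>" for l
    proof -
      obtain k where k: "l = Suc k" using l by (cases l) auto
      have "card (level_order_chars 0 l) = p ^ (l + \<beta>) - p ^ (k + \<beta>)"
        using l k by (simp add: card_level_order_chars_0 min_absorb1 min_absorb2)
      also have "\<dots> = p ^ \<beta> * (p ^ k * (p - 1))"
        by (simp add: k power_add algebra_simps diff_mult_distrib2)
      finally have card: "card (level_order_chars 0 l) = p ^ \<beta> * (p ^ k * (p - 1))" .
      have tl: "totient (p ^ l) = p ^ k * (p - 1)" by (simp only: k tot_Suc)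
      have "card (R 0 l) * totient (p ^ l) = p ^ \<beta> * totient (p ^ l)"
        by (subst R(2), subst tl) (rule card)
      then show ?thesis using tot[of l] by (auto simp only: mult_cancel2)
    qed
    have R2: "card (R \<delta> l) = num_cyclic_subgroups (Q \<delta>) (p ^ l) - num_cyclic_subgroups (Q' \<delta>) (p ^ l)"
      if "1 \<le> \<delta>" "\<delta> \<le> \<gamma>" for \<delta> l
    proof -
      have "card (R \<delta> l) * totient (p ^ l)
          = (num_cyclic_subgroups (Q \<delta>) (p ^ l) - num_cyclic_subgroups (Q' \<delta>) (p ^ l)) * totient (p ^ l)"
        using card_level_order_chars[of \<delta> l] that R(2)[of \<delta> l] by simp
      then show ?thesis using tot[of l] by (auto simp only: mult_cancel2)
    qed
    have A: "concat (map (\<lambda>(\<delta>, l). replicate (card (R \<delta> l)) (p ^ \<delta>, p ^ l)) (map (Pair 0) [1..<\<beta> + 1]))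
        = concat (map (\<lambda>l. replicate (p ^ l + p ^ (l - 1)) (1, p ^ l)) [1..<\<beta> + 1])"
      using R0 by (intro arg_cong[of _ _ concat]) (auto simp del: upt_Suc)
    have B: "concat (map (\<lambda>(\<delta>, l). replicate (card (R \<delta> l)) (p ^ \<delta>, p ^ l)) (map (Pair 0) [\<beta> + 1..<\<alpha> + 1]))
        = concat (map (\<lambda>l. replicate (p ^ \<beta>) (1, p ^ l)) [\<beta> + 1..<\<alpha> + 1])"
      using R1 by (intro arg_cong[of _ _ concat]) (auto simp del: upt_Suc)
    have C: "concat (map (\<lambda>(\<delta>, l). replicate (card (R \<delta> l)) (p ^ \<delta>, p ^ l))
          (concat (map (\<lambda>\<delta>. map (Pair \<delta>) [1..<M \<delta> + 1]) [1..<\<gamma> + 1])))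
        = concat (map (\<lambda>\<delta>. concat (map (\<lambda>l.
           replicate (num_cyclic_subgroups (Q \<delta>) (p ^ l) - num_cyclic_subgroups (Q' \<delta>) (p ^ l)) (p ^ \<delta>, p ^ l))
         [1..<M \<delta> + 1])) [1..<\<gamma> + 1])"
    proof -
      have CC: "concat (map h (concat (map k ys))) = concat (map (\<lambda>y. concat (map h (k y))) ys)"
        for h :: "nat \<times> nat \<Rightarrow> (nat \<times> nat) list" and k :: "nat \<Rightarrow> (nat \<times> nat) list" and ys
        by (induction ys) auto
      show ?thesis unfolding CC using R2
        by (intro arg_cong[of _ _ concat] map_cong refl) (auto simp del: upt_Suc)
    qed
    have "concat (map (\<lambda>(\<delta>, l). replicate (card (R \<delta> l)) (p ^ \<delta>, p ^ l)) [(0, 0)]) = [(1, 1)]"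
      by (simp add: R00)
    then show ?thesis unfolding J_def map_append concat_append A B C by simp
  qed
  ultimately show ?thesis by (simp only: M_def)
qed

end

theorem theorem4p3:
  fixes G :: "('g, 'b) monoid_scheme" and a b :: 'g
    and p n \<alpha> \<beta> \<gamma> \<rho> \<sigma> :: nat
  assumes "Factorial_Ring.prime p" and "odd p" and "n > 2"
    and "\<alpha> \<ge> \<beta>" and "\<beta> \<ge> \<gamma>" and "\<gamma> \<ge> 1" and "\<alpha> + \<beta> + \<gamma> = n"
    and "\<rho> \<le> \<gamma>" and "\<sigma> \<le> \<gamma>"
    and "group G" and "a \<in> carrier G" and "b \<in> carrier G"
    and "generate G {a, b} = carrier G"
    and "comm G a b [^]\<^bsub>G\<^esub> (p ^ \<gamma>) = \<one>\<^bsub>G\<^esub>"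
    and "comm G (comm G a b) a = \<one>\<^bsub>G\<^esub>"
    and "comm G (comm G a b) b = \<one>\<^bsub>G\<^esub>"
    and "a [^]\<^bsub>G\<^esub> (p ^ \<alpha>) = comm G a b [^]\<^bsub>G\<^esub> (p ^ \<rho>)"
    and "b [^]\<^bsub>G\<^esub> (p ^ \<beta>) = comm G a b [^]\<^bsub>G\<^esub> (p ^ \<sigma>)"
    and "order G = p ^ n"
  shows
    "let c = comm G a b;
         H = (\<lambda>\<delta>::nat. subgroup_generated G
                 {a [^]\<^bsub>G\<^esub> (p ^ \<delta>), b [^]\<^bsub>G\<^esub> (p ^ \<delta>), c});
         Q = (\<lambda>\<delta>::nat. H \<delta> Mod generate G {c [^]\<^bsub>G\<^esub> (p ^ \<delta>)});
         Q' = (\<lambda>\<delta>::nat. H \<delta> Mod generate G {c [^]\<^bsub>G\<^esub> (p ^ (\<delta> - 1))});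
         m = (\<lambda>\<delta>::nat. THE e. grp_exponent (Q \<delta>) = p ^ e)
     in group_algebra_Q G \<simeq> wedderburn_sum
          ([(1, 1)]
           @ concat (map (\<lambda>l. replicate (p ^ l + p ^ (l - 1)) (1, p ^ l)) [1..<\<beta> + 1])
           @ concat (map (\<lambda>l. replicate (p ^ \<beta>) (1, p ^ l)) [\<beta> + 1..<\<alpha> + 1])
           @ concat (map (\<lambda>\<delta>. concat (map (\<lambda>l.
                 replicate (num_cyclic_subgroups (Q \<delta>) (p ^ l)
                            - num_cyclic_subgroups (Q' \<delta>) (p ^ l))
                           (p ^ \<delta>, p ^ l)) [1..<m \<delta> + 1])) [1..<\<gamma> + 1]))"
proof -
  interpret two_generator_class_two G a b p \<alpha> \<beta> \<gamma> \<rho> \<sigma>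
    by (intro two_generator_class_two.intro two_generator_class_two_axioms.intro)
       (use assms in \<open>simp_all add: add.assoc\<close>)
  show ?thesis
    using group_algebra_decomposition unfolding Let_def Q_def Q'_def N_def .
qed

end
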